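(* Let $S$ be the almost-standard $\mathbb N^r$-graded ring described in the context, and let $M$ be a finitely generated $\mathbb Z^r$-graded $S$-module. Then $$\Gamma\text{-}\mathrm{fg}(M)=\mathrm{gdepth}(M).$$
   Context: $\mathbb N$ is the set of non-negative integers. Fix $r\ge 1$ and let $e_1,\dots,e_r$ be the canonical basis of $\mathbb R^r$. $S=\bigoplus_{\underline n\in\mathbb N^r}S_{\underline n}$ is a Noetherian $\mathbb N^r$-graded ring whose degree-zero part $S_{\underline 0}$ is a local ring with maximal ideal $\mathfrak m$ and infinite residue field. $S$ is almost-standard: it is generated as an $S_{\underline 0}$-algebra by finitely many homogeneous elements $g_i^j$ ($1\le i\le r$, $1\le j\le\mu_i$) with $\deg g_i^j=\gamma_i=\gamma_i^ie_i$, where $\gamma_1^1,\dots,\gamma_r^r$ are positive integers. $\mathcal M=\mathfrak m\oplus\bigoplus_{\underline n\neq\underline 0}S_{\underline n}$ is the maximal homogeneous ideal of $S$. Let $I_i$ be the ideal of $S$ generated by the homogeneous components of multidegrees $(d_1,\dots,d_i,0,\dots,0)$ with $d_i\neq 0$; $S_{++}=I_1\cdots I_r$. The generalized depth $\mathrm{gdepth}(M)$ is the greatest integer $k\ge 0$ such that $S_{++}\subset \mathrm{rad}(\mathrm{Ann}_S(H^i_{\mathcal M}(M)))$ for all $i<k$. For $\underline\beta\in\mathbb N^r$, the cone with vertex $\underline\beta$ is $C_{\underline\beta}=(\underline\beta+(\mathbb R_{\ge 0})^r)\cap\mathbb N^r$. For $\underline n=(n_1,\dots,n_r)\in\mathbb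 Z^r$, $\underline n^*=(|n_1|,\dots,|n_r|)$. A $\mathbb Z^r$-graded $S$-module $N$ is $\Gamma$-finitely graded if there exists a cone $C_{\underline\beta}\subset\mathbb N^r$ such that $N_{\underline n}=0$ for all $\underline n\in\mathbb Z^r$ with $\underline n^*\in C_{\underline\beta}$. $\Gamma\text{-}\mathrm{fg}(M)$ is the greatest integer $k\ge 0$ such that $H^i_{\mathcal M}(M)$ is $\Gamma$-finitely graded for all $i<k$. Both invariants take the value $+\infty$ if the defining condition holds for every $k$. *)

theory Defs
  imports "HOL-Algebra.Module" "HOL-Algebra.QuotRing" "HOL-Algebra.Ideal_Product"
    "HOL-Algebra.Ring_Divisibility" "HOL-Algebra.Generated_Rings"
    "HOL-Analysis.Finite_Cartesian_Product" "HOL-Library.Extended_Nat"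
begin

(* The index set {1,...,r} is a type 'r of sort {finite,linorder}: types are nonempty, so r >= 1, and
   the order on it serves for the multidegrees (d_1,...,d_i,0,...,0). Elements of N^r and Z^r are the
   vectors nat^'r and int^'r. *)

section \<open>Multigraded rings and modules\<close>

definition zdeg :: "nat^'r \<Rightarrow> int^'r" where
  "zdeg n = (\<chi> i. int (n $ i))"

definition decomposes :: "('b, 'c) ring_scheme \<Rightarrow> ('i \<Rightarrow> 'b set) \<Rightarrow> 'b \<Rightarrow> ('i \<Rightarrow> 'b) \<Rightarrow> bool" where
  "decomposes G A x c \<longleftrightarrow>
     (\<forall>n. c n \<in> A n) \<and> finite {n. c n \<noteq> \<zero>\<^bsub>G\<^esub>} \<and>
     x = (\<Oplus>\<^bsub>G\<^esub>n\<in>{n. c n \<noteq> \<zero>\<^bsub>G\<^esub>}. c n)"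

(* The additive group of G is the internal direct sum of the subgroups A n. *)
definition direct_sum :: "('b, 'c) ring_scheme \<Rightarrow> ('i \<Rightarrow> 'b set) \<Rightarrow> bool" where
  "direct_sum G A \<longleftrightarrow>
     (\<forall>n. additive_subgroup (A n) G) \<and> (\<forall>x\<in>carrier G. \<exists>!c. decomposes G A x c)"

definition graded_ring :: "'a ring \<Rightarrow> (nat^'r \<Rightarrow> 'a set) \<Rightarrow> bool" where
  "graded_ring S Sg \<longleftrightarrow>
     cring S \<and> direct_sum S Sg \<and> \<one>\<^bsub>S\<^esub> \<in> Sg 0 \<and>
     (\<forall>m n. \<forall>a\<in>Sg m. \<forall>b\<in>Sg n. a \<otimes>\<^bsub>S\<^esub> b \<in> Sg (m + n))"

definition graded_module ::
  "'a ring \<Rightarrow> (nat^'r \<Rightarrow> 'a set) \<Rightarrow> ('a, 'm) module \<Rightarrow> (int^'r \<Rightarrow> 'm set) \<Rightarrow> bool" where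
  "graded_module S Sg M Mg \<longleftrightarrow>
     module S M \<and> direct_sum M Mg \<and>
     (\<forall>m n. \<forall>a\<in>Sg m. \<forall>x\<in>Mg n. a \<odot>\<^bsub>M\<^esub> x \<in> Mg (zdeg m + n))"

definition graded_hom ::
  "'a ring \<Rightarrow> ('a, 'm) module \<Rightarrow> (int^'r \<Rightarrow> 'm set) \<Rightarrow> ('a, 'n) module \<Rightarrow> (int^'r \<Rightarrow> 'n set) \<Rightarrow> ('m \<Rightarrow> 'n) set"
  where
  "graded_hom S M Mg N Ng =
     {f \<in> hom (add_monoid M) (add_monoid N).
        (\<forall>a\<in>carrier S. \<forall>x\<in>carrier M. f (a \<odot>\<^bsub>M\<^esub> x) = a \<odot>\<^bsub>N\<^esub> f x) \<and>
        (\<forall>n. f ` Mg n \<subseteq> Ng n)}"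

definition fin_gen_module :: "'a ring \<Rightarrow> ('a, 'm) module \<Rightarrow> bool" where
  "fin_gen_module S M \<longleftrightarrow>
     (\<exists>X. finite X \<and> X \<subseteq> carrier M \<and> (\<forall>N. submodule N S M \<and> X \<subseteq> N \<longrightarrow> N = carrier M))"

section \<open>Almost-standard multigraded rings\<close>

abbreviation degree_zero_part :: "'a ring \<Rightarrow> (nat^'r \<Rightarrow> 'a set) \<Rightarrow> 'a ring" where
  "degree_zero_part S Sg \<equiv> S\<lparr>carrier := Sg 0\<rparr>"

definition local_ring :: "'a ring \<Rightarrow> 'a set \<Rightarrow> bool" where
  "local_ring A \<mm> \<longleftrightarrow> cring A \<and> maximalideal \<mm> A \<and> (\<forall>J. maximalideal J A \<longrightarrow> J = \<mm>)"

definition almost_standard :: "'a ring \<Rightarrow> (nat^'r \<Rightarrow> 'a set) \<Rightarrow> bool" where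
  "almost_standard S Sg \<longleftrightarrow>
     (\<exists>(\<gamma> :: 'r \<Rightarrow> nat) (\<mu> :: 'r \<Rightarrow> nat) (g :: 'r \<Rightarrow> nat \<Rightarrow> 'a).
        (\<forall>i. 0 < \<gamma> i) \<and>
        (\<forall>i. \<forall>j\<in>{1..\<mu> i}. g i j \<in> Sg (axis i (\<gamma> i))) \<and>
        carrier S = generate_ring S (Sg 0 \<union> {g i j | i j. j \<in> {1..\<mu> i}}))"

definition max_homogeneous_ideal :: "'a ring \<Rightarrow> (nat^'r \<Rightarrow> 'a set) \<Rightarrow> 'a set \<Rightarrow> 'a set" where
  "max_homogeneous_ideal S Sg \<mm> = {x \<in> carrier S. \<exists>c. decomposes S Sg x c \<and> c 0 \<in> \<mm>}"

definition irrelevant_factor :: "'a ring \<Rightarrow> (nat^'r::{finite,linorder} \<Rightarrow> 'a set) \<Rightarrow> 'r \<Rightarrow> 'a set" where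
  "irrelevant_factor S Sg i = Idl\<^bsub>S\<^esub> (\<Union>{Sg d | d. d $ i \<noteq> 0 \<and> (\<forall>j>i. d $ j = 0)})"

(* Products and powers of ideals are taken in the commutative monoid of ideals of S, whose
   multiplication is ideal_prod and whose unit is S itself. *)
definition irrelevant_ideal :: "'a ring \<Rightarrow> (nat^'r::{finite,linorder} \<Rightarrow> 'a set) \<Rightarrow> 'a set" where
  "irrelevant_ideal S Sg = finprod (ideals_set S) (irrelevant_factor S Sg) UNIV"

definition ideal_radical :: "'a ring \<Rightarrow> 'a set \<Rightarrow> 'a set" where
  "ideal_radical S J = {a \<in> carrier S. \<exists>n::nat. a [^]\<^bsub>S\<^esub> n \<in> J}"

definition annihilator :: "'a ring \<Rightarrow> ('a, 'm) module \<Rightarrow> 'a set" where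
  "annihilator S M = {a \<in> carrier S. \<forall>x\<in>carrier M. a \<odot>\<^bsub>M\<^esub> x = \<zero>\<^bsub>M\<^esub>}"

section \<open>Local cohomology\<close>

(* Injective objects of the category of Z^r-graded S-modules. The test modules range over all
   graded modules whose elements have the same type 'a as those of S; these include all shifts S(n)
   and their homogeneous submodules, so by Baer's criterion E is injective with respect to graded
   modules of any type. *)
definition graded_injective ::
  "'a ring \<Rightarrow> (nat^'r \<Rightarrow> 'a set) \<Rightarrow> ('a, 'e) module \<Rightarrow> (int^'r \<Rightarrow> 'e set) \<Rightarrow> bool" where
  "graded_injective S Sg E Eg \<longleftrightarrow>
     graded_module S Sg E Eg \<and>
     (\<forall>(L :: ('a, 'a) module) Lg (N :: ('a, 'a) module) Ng u f.
        graded_module S Sg L Lg \<and> graded_module S Sg N Ng \<and>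
        u \<in> graded_hom S L Lg N Ng \<and> inj_on u (carrier L) \<and> f \<in> graded_hom S L Lg E Eg \<longrightarrow>
        (\<exists>h\<in>graded_hom S N Ng E Eg. \<forall>x\<in>carrier L. h (u x) = f x))"

(* 0 -> M -> E 0 -> E 1 -> ... is exact, with augmentation \<epsilon> and differentials d i : E i -> E (i+1). *)
definition graded_injective_resolution ::
  "'a ring \<Rightarrow> (nat^'r \<Rightarrow> 'a set) \<Rightarrow> ('a, 'm) module \<Rightarrow> (int^'r \<Rightarrow> 'm set) \<Rightarrow>
   (nat \<Rightarrow> ('a, 'e) module) \<Rightarrow> (nat \<Rightarrow> int^'r \<Rightarrow> 'e set) \<Rightarrow> (nat \<Rightarrow> 'e \<Rightarrow> 'e) \<Rightarrow> ('m \<Rightarrow> 'e) \<Rightarrow> bool" where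
  "graded_injective_resolution S Sg M Mg E Eg d \<epsilon> \<longleftrightarrow>
     (\<forall>i. graded_injective S Sg (E i) (Eg i)) \<and>
     \<epsilon> \<in> graded_hom S M Mg (E 0) (Eg 0) \<and>
     (\<forall>i. d i \<in> graded_hom S (E i) (Eg i) (E (Suc i)) (Eg (Suc i))) \<and>
     inj_on \<epsilon> (carrier M) \<and>
     \<epsilon> ` carrier M = a_kernel (E 0) (E 1) (d 0) \<and>
     (\<forall>i. d i ` carrier (E i) = a_kernel (E (Suc i)) (E (Suc (Suc i))) (d (Suc i)))"

(* The submodule of elements killed by some power of the ideal J. *)
definition torsion :: "'a ring \<Rightarrow> 'a set \<Rightarrow> ('a, 'e) module \<Rightarrow> 'e set" where
  "torsion S J E =
     {x \<in> carrier E. \<exists>k::nat. \<forall>a\<in>J [^]\<^bsub>ideals_set S\<^esub> k. a \<odot>\<^bsub>E\<^esub> x = \<zero>\<^bsub>E\<^esub>}"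

(* Z/B for submodules B \<subseteq> Z of E. The ring fields mult and one play no role in a module. *)
definition subquotient :: "('a, 'e) module \<Rightarrow> 'e set \<Rightarrow> 'e set \<Rightarrow> ('a, 'e set) module" where
  "subquotient E Z B =
     \<lparr>carrier = a_rcosets\<^bsub>E\<lparr>carrier := Z\<rparr>\<^esub> B, monoid.mult = undefined, one = undefined,
      zero = B, add = set_add E, smult = (\<lambda>a X. B <+>\<^bsub>E\<^esub> ((\<lambda>x. a \<odot>\<^bsub>E\<^esub> x) ` X))\<rparr>"

definition cocycles ::
  "'a ring \<Rightarrow> 'a set \<Rightarrow> (nat \<Rightarrow> ('a, 'e) module) \<Rightarrow> (nat \<Rightarrow> 'e \<Rightarrow> 'e) \<Rightarrow> nat \<Rightarrow> 'e set" where
  "cocycles S J E d i = torsion S J (E i) \<inter> a_kernel (E i) (E (Suc i)) (d i)"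

definition coboundaries ::
  "'a ring \<Rightarrow> 'a set \<Rightarrow> (nat \<Rightarrow> ('a, 'e) module) \<Rightarrow> (nat \<Rightarrow> 'e \<Rightarrow> 'e) \<Rightarrow> nat \<Rightarrow> 'e set" where
  "coboundaries S J E d i =
     (case i of 0 \<Rightarrow> {\<zero>\<^bsub>E 0\<^esub>} | Suc j \<Rightarrow> d j ` torsion S J (E j))"

(* For an injective resolution (E, d) of M, this is H^i_J(M): the i-th right derived functor of the
   J-torsion functor. *)
definition local_cohomology ::
  "'a ring \<Rightarrow> 'a set \<Rightarrow> (nat \<Rightarrow> ('a, 'e) module) \<Rightarrow> (nat \<Rightarrow> 'e \<Rightarrow> 'e) \<Rightarrow> nat \<Rightarrow> ('a, 'e set) module" where
  "local_cohomology S J E d i = subquotient (E i) (cocycles S J E d i) (coboundaries S J E d i)"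

(* The component of degree n of H^i_J(M) consists of the classes of the cocycles of degree n. *)
definition local_cohomology_grading ::
  "'a ring \<Rightarrow> 'a set \<Rightarrow> (nat \<Rightarrow> ('a, 'e) module) \<Rightarrow> (nat \<Rightarrow> int^'r \<Rightarrow> 'e set) \<Rightarrow> (nat \<Rightarrow> 'e \<Rightarrow> 'e) \<Rightarrow>
   nat \<Rightarrow> int^'r \<Rightarrow> 'e set set" where
  "local_cohomology_grading S J E Eg d i n =
     (\<lambda>z. coboundaries S J E d i +>\<^bsub>E i\<^esub> z) ` (cocycles S J E d i \<inter> Eg i n)"

section \<open>The two invariants\<close>

definition cone :: "nat^'r \<Rightarrow> (nat^'r) set" where
  "cone \<beta> = {n. \<exists>x::real^'r. (\<forall>i. 0 \<le> x $ i) \<and> (\<forall>i. real (n $ i) = real (\<beta> $ i) + x $ i)}"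

definition abs_deg :: "int^'r \<Rightarrow> nat^'r" where
  "abs_deg n = (\<chi> i. nat \<bar>n $ i\<bar>)"

definition Gamma_finitely_graded :: "('a, 'm) module \<Rightarrow> (int^'r \<Rightarrow> 'm set) \<Rightarrow> bool" where
  "Gamma_finitely_graded N Ng \<longleftrightarrow> (\<exists>\<beta>. \<forall>n. abs_deg n \<in> cone \<beta> \<longrightarrow> Ng n = {\<zero>\<^bsub>N\<^esub>})"

(* The greatest k such that P i for all i < k, and \<infinity> if this holds for every k. *)
definition greatest_initial :: "(nat \<Rightarrow> bool) \<Rightarrow> enat" where
  "greatest_initial P =
     (if \<forall>k. \<forall>i<k. P i then \<infinity> else enat (GREATEST k. \<forall>i<k. P i))"

(* Both invariants of M are computed from an injective resolution (E, d) of M. *)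

definition gdepth ::
  "'a ring \<Rightarrow> (nat^'r::{finite,linorder} \<Rightarrow> 'a set) \<Rightarrow> 'a set \<Rightarrow>
   (nat \<Rightarrow> ('a, 'e) module) \<Rightarrow> (nat \<Rightarrow> 'e \<Rightarrow> 'e) \<Rightarrow> enat" where
  "gdepth S Sg \<mm> E d =
     greatest_initial (\<lambda>i. irrelevant_ideal S Sg \<subseteq>
       ideal_radical S (annihilator S (local_cohomology S (max_homogeneous_ideal S Sg \<mm>) E d i)))"

definition Gamma_fg ::
  "'a ring \<Rightarrow> (nat^'r \<Rightarrow> 'a set) \<Rightarrow> 'a set \<Rightarrow>
   (nat \<Rightarrow> ('a, 'e) module) \<Rightarrow> (nat \<Rightarrow> int^'r \<Rightarrow> 'e set) \<Rightarrow> (nat \<Rightarrow> 'e \<Rightarrow> 'e) \<Rightarrow> enat" where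
  "Gamma_fg S Sg \<mm> E Eg d =
     greatest_initial (\<lambda>i. Gamma_finitely_graded
       (local_cohomology S (max_homogeneous_ideal S Sg \<mm>) E d i)
       (local_cohomology_grading S (max_homogeneous_ideal S Sg \<mm>) E Eg d i))"

end

theory Submission
  imports Defs
begin

text \<open>The two invariants are compared one cohomological degree at a time. Write \<open>H\<close> for
  \<open>H\<^sup>i(M)\<close>, local cohomology with support in the maximal homogeneous ideal. The claim is that \<open>H\<close> is
  \<open>\<Gamma>\<close>-finitely graded if and only if every element of the irrelevant ideal is nilpotent on \<open>H\<close>.

  Suppose that the component of degree \<open>n\<close> of \<open>H\<close> vanishes as soon as \<open>\<bar>n\<^sub>k\<bar> \<ge> \<beta>\<^sub>k\<close> for all \<open>k\<close>, and let \<open>g\<close>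
  be homogeneous of a degree \<open>G\<close> with positive coordinates. The powers of \<open>g\<close> move the component of
  degree \<open>n\<close> along the points \<open>n + tG\<close>, and at most \<open>2\<beta>\<^sub>k\<close> of these lie in the strip \<open>\<bar>n\<^sub>k\<bar> < \<beta>\<^sub>k\<close>. So
  some \<open>t \<le> 2\<Sum>\<beta>\<^sub>k\<close> lies outside all strips, and \<open>g\<close> is nilpotent on \<open>H\<close>, with an exponent that does
  not depend on \<open>n\<close> (\<open>line_leaves_strips\<close>, \<open>strip_finite_nilpotent\<close>). The irrelevant ideal is
  generated by such elements, the products of one homogeneous element from each factor.

  The converse rests on the fact that \<open>H\<close> is Artinian (\<open>artinian_local_cohomology\<close>). Suppose that the
  irrelevant ideal acts nilpotently, and let \<open>L\<close> be minimal among the graded submodules of \<open>H\<close> that are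
  not \<open>\<Gamma>\<close>-finitely graded. If for each \<open>i\<close> some generator of degree \<open>\<gamma>\<^sub>i\<close> mapped \<open>L\<close> onto itself, then
  so would the product of these generators, which is nilpotent; hence \<open>L = 0\<close>, which is absurd. So there
  is an \<open>i\<close> for which every generator \<open>g\<close> of degree \<open>\<gamma>\<^sub>i\<close> maps \<open>L\<close> to a smaller submodule. Then the sum
  \<open>W\<close> of the images \<open>g L\<close> is \<open>\<Gamma>\<close>-finitely graded, and in \<open>L/W\<close> the ring acts without changing the
  \<open>i\<close>-th coordinate of degrees. So \<open>L/W\<close> is the direct sum of submodules indexed by that coordinate, and
  the descending chain condition bounds it (\<open>strip_finite_of_quotient\<close>). Hence \<open>L\<close> is
  \<open>\<Gamma>\<close>-finitely graded after all.

  That \<open>H\<close> is Artinian is proved for an arbitrary graded injective resolution \<open>E\<close>, without Matlis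
  duality and without minimal resolutions. The sum \<open>D\<close> of all \<open>E\<^sup>i\<close> is one module with a differential
  \<open>\<delta>\<close>, and its cohomology is \<open>M\<close>, which is Noetherian. For \<open>x \<in> S\<close> the Koszul cone \<open>K(x; D)\<close> is \<open>D \<oplus> D\<close>
  with the differential \<open>(u, v) \<mapsto> (\<delta>u, xu - \<delta>v)\<close>. Its cohomology is again Noetherian and is killed by
  \<open>x\<close>. After a cone for each generator of the maximal homogeneous ideal the cohomology is Noetherian and
  torsion, so it is Artinian (\<open>dcc_of_acc_torsion\<close>). The generators are then removed one by one: if the
  cohomology of \<open>K(x; G)\<close> is Artinian and \<open>x\<close> acts surjectively on \<open>G\<close> modulo its \<open>x\<close>-torsion part, then
  the elements killed by \<open>x\<close> in the cohomology of the \<open>x\<close>-torsion part form an Artinian module, and a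
  module that is \<open>x\<close>-torsion is Artinian if its elements killed by \<open>x\<close> form an Artinian module
  (\<open>dcc_torsion_step\<close>, \<open>dcc_of_dcc_socle\<close>). The surjectivity is where injectivity of the \<open>E\<^sup>i\<close> enters
  (\<open>graded_injective_divide_part\<close>).\<close>

section \<open>Chain conditions on families of sets\<close>

text \<open>The relation is a parameter so that statements about ascending and descending chains share one
  proof.\<close>
definition strictly_wf :: "('s \<Rightarrow> 's \<Rightarrow> bool) \<Rightarrow> 's set \<Rightarrow> bool" where
  "strictly_wf R A \<longleftrightarrow> wf {(X, Y). X \<in> A \<and> Y \<in> A \<and> R X Y \<and> X \<noteq> Y}"

abbreviation dcc :: "'s set set \<Rightarrow> bool" where
  "dcc \<equiv> strictly_wf (\<subseteq>)"

abbreviation acc :: "'s set set \<Rightarrow> bool" where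
  "acc \<equiv> strictly_wf (\<lambda>X Y. Y \<subseteq> X)"

text \<open>The pair \<open>(f X, g X)\<close> strictly descends in the lexicographic product. With two maps this is the
  form in which chain conditions pass to extensions.\<close>
lemma strictly_wf_by_two_maps:
  assumes "strictly_wf R1 A1" "strictly_wf R2 A2"
    and "\<And>X. X \<in> A \<Longrightarrow> f X \<in> A1" "\<And>X. X \<in> A \<Longrightarrow> g X \<in> A2"
    and "\<And>X Y. X \<in> A \<Longrightarrow> Y \<in> A \<Longrightarrow> R X Y \<Longrightarrow> R1 (f X) (f Y)"
    and "\<And>X Y. X \<in> A \<Longrightarrow> Y \<in> A \<Longrightarrow> R X Y \<Longrightarrow> R2 (g X) (g Y)"
    and "\<And>X Y. X \<in> A \<Longrightarrow> Y \<in> A \<Longrightarrow> R X Y \<Longrightarrow> f X = f Y \<Longrightarrow> g X = g Y \<Longrightarrow> X = Y"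
  shows "strictly_wf R A"
proof -
  let ?r1 = "{(X, Y). X \<in> A1 \<and> Y \<in> A1 \<and> R1 X Y \<and> X \<noteq> Y}"
  let ?r2 = "{(X, Y). X \<in> A2 \<and> Y \<in> A2 \<and> R2 X Y \<and> X \<noteq> Y}"
  have "wf (inv_image (?r1 <*lex*> ?r2) (\<lambda>X. (f X, g X)))"
    using assms(1,2) unfolding strictly_wf_def by (intro wf_inv_image wf_lex_prod)
  moreover have "{(X, Y). X \<in> A \<and> Y \<in> A \<and> R X Y \<and> X \<noteq> Y}
      \<subseteq> inv_image (?r1 <*lex*> ?r2) (\<lambda>X. (f X, g X))"
    using assms(3-) by (auto simp: inv_image_def)
  ultimately show ?thesis
    unfolding strictly_wf_def by (rule wf_subset)
qed

lemma strictly_wf_by_map: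
  assumes "strictly_wf R1 A1" and "\<And>X. X \<in> A \<Longrightarrow> f X \<in> A1"
    and "\<And>X Y. X \<in> A \<Longrightarrow> Y \<in> A \<Longrightarrow> R X Y \<Longrightarrow> R1 (f X) (f Y)"
    and "\<And>X Y. X \<in> A \<Longrightarrow> Y \<in> A \<Longrightarrow> R X Y \<Longrightarrow> f X = f Y \<Longrightarrow> X = Y"
  shows "strictly_wf R A"
  by (rule strictly_wf_by_two_maps[OF assms(1,1), of A f f]) (use assms in auto)

lemma strictly_wf_stabilizes:
  fixes f :: "nat \<Rightarrow> 's"
  assumes "strictly_wf R A" "\<And>n. f n \<in> A" "\<And>m n. m \<le> n \<Longrightarrow> R (f n) (f m)"
  obtains n where "\<And>m. n \<le> m \<Longrightarrow> f m = f n"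
proof -
  obtain n where n: "\<And>y. (y, f n) \<in> {(X, Y). X \<in> A \<and> Y \<in> A \<and> R X Y \<and> X \<noteq> Y} \<Longrightarrow> y \<notin> range f"
    using wfE_min[OF assms(1)[unfolded strictly_wf_def], of "f 0" "range f"] by blast
  show ?thesis
    by (rule that[of n]) (use n assms(2,3) in blast)
qed

lemma strictly_wf_minimal:
  assumes "strictly_wf R A" "X0 \<in> A" "P X0"
  obtains X where "X \<in> A" "P X" "\<And>Y. Y \<in> A \<Longrightarrow> P Y \<Longrightarrow> R Y X \<Longrightarrow> Y = X"
proof -
  obtain X where "X \<in> {X \<in> A. P X}"
    "\<And>y. (y, X) \<in> {(X, Y). X \<in> A \<and> Y \<in> A \<and> R X Y \<and> X \<noteq> Y} \<Longrightarrow> y \<notin> {X \<in> A. P X}"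
    using wfE_min[OF assms(1)[unfolded strictly_wf_def], of X0 "{X \<in> A. P X}"] assms(2,3) by blast
  then show ?thesis using that by blast
qed

lemma strictly_wf_mono: "strictly_wf R A \<Longrightarrow> B \<subseteq> A \<Longrightarrow> strictly_wf R B"
  unfolding strictly_wf_def by (erule wf_subset) auto

lemma dcc_pair: "dcc {X, Y}"
  unfolding strictly_wf_def
proof (rule wf_subset)
  show "wf (if X = Y then {} else if X \<subseteq> Y then {(X, Y)} else {(Y, X)})"
    by (auto simp: wf_insert)
qed auto

text \<open>A doubly indexed family that decreases in both indices becomes constant in the first index,
  uniformly in the second one: beyond a corner \<open>(k, k)\<close> nothing moves, and the finitely many
  columns before \<open>k\<close> stabilize one by one.\<close>
lemma dcc_by_sequences:
  fixes f :: "'s set \<Rightarrow> nat \<Rightarrow> 't set"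
  assumes "dcc A1" and "\<And>X j. X \<in> A \<Longrightarrow> f X j \<in> A1"
    and "\<And>X i j. X \<in> A \<Longrightarrow> i \<le> j \<Longrightarrow> f X j \<subseteq> f X i"
    and "\<And>X Y j. X \<in> A \<Longrightarrow> Y \<in> A \<Longrightarrow> X \<subseteq> Y \<Longrightarrow> f X j \<subseteq> f Y j"
    and "\<And>X Y. X \<in> A \<Longrightarrow> Y \<in> A \<Longrightarrow> X \<subseteq> Y \<Longrightarrow> f X = f Y \<Longrightarrow> X = Y"
  shows "dcc A"
  unfolding strictly_wf_def wf_iff_no_infinite_down_chain
proof (rule notI, elim exE)
  fix X assume "\<forall>i. (X (Suc i), X i) \<in> {(X, Y). X \<in> A \<and> Y \<in> A \<and> X \<subseteq> Y \<and> X \<noteq> Y}"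
  then have XA: "X i \<in> A" and Xs: "X (Suc i) \<subseteq> X i" "X (Suc i) \<noteq> X i" for i by auto
  have Xd: "X m \<subseteq> X n" if "n \<le> m" for m n using that Xs(1) by (rule lift_Suc_antimono_le[rotated])
  define a where "a m j = f (X m) j" for m j
  have a_A: "a m j \<in> A1" for m j using assms(2) XA unfolding a_def by blast
  have a_mono: "a m' j' \<subseteq> a m j" if "m \<le> m'" "j \<le> j'" for m m' j j'
    using assms(3)[OF XA that(2)] assms(4)[OF XA XA Xd[OF that(1)]] unfolding a_def by blast
  obtain k where k: "\<And>m. k \<le> m \<Longrightarrow> a m m = a k k"
    using strictly_wf_stabilizes[OF assms(1), of "\<lambda>m. a m m"] a_A a_mono by auto
  have corner: "a m j = a k k" if "k \<le> m" "k \<le> j" for m j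
    using a_mono[of k m k j] a_mono[of m "max m j" j "max m j"] k[of "max m j"] that by auto
  have "\<exists>n. \<forall>m\<ge>n. a m j = a n j" for j
    using strictly_wf_stabilizes[OF assms(1), of "\<lambda>m. a m j"] a_A a_mono by (metis order_refl)
  then obtain n where n: "\<And>j m. n j \<le> m \<Longrightarrow> a m j = a (n j) j" by metis
  define N where "N = Max (insert k (n ` {..<k}))"
  have "k \<le> N" "\<And>j. j < k \<Longrightarrow> n j \<le> N" unfolding N_def by auto
  then have "a (Suc N) j = a N j" for j
    using corner[of N j] corner[of "Suc N" j] n[of j N] n[of j "Suc N"]
    by (cases "j < k") (simp_all add: le_SucI)
  then have "f (X (Suc N)) = f (X N)" unfolding a_def by auto
  then show False using assms(5)[OF XA XA Xs(1)] Xs(2) by blast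
qed

section \<open>Submodules between two submodules\<close>

text \<open>These sets are the submodules of \<open>Z/B\<close>. All arguments about subquotients take place between two
  submodules of one ambient module, so that no quotient module has to be formed.\<close>
definition intermediate :: "('a, 'c) ring_scheme \<Rightarrow> ('a, 'b, 'd) module_scheme \<Rightarrow> 'b set \<Rightarrow> 'b set \<Rightarrow> 'b set set"
  where "intermediate R M B Z = {L. submodule L R M \<and> B \<subseteq> L \<and> L \<subseteq> Z}"

text \<open>The submodule \<open>aL + B\<close>. With \<open>a = 1\<close> it also serves as the sum \<open>L + B\<close>.\<close>
definition image_plus :: "('a, 'b, 'd) module_scheme \<Rightarrow> 'a \<Rightarrow> 'b set \<Rightarrow> 'b set \<Rightarrow> 'b set" where
  "image_plus M a L B = {a \<odot>\<^bsub>M\<^esub> l \<oplus>\<^bsub>M\<^esub> b | l b. l \<in> L \<and> b \<in> B}"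

lemma image_plusI:
  "x = a \<odot>\<^bsub>M\<^esub> l \<oplus>\<^bsub>M\<^esub> b \<Longrightarrow> l \<in> L \<Longrightarrow> b \<in> B \<Longrightarrow> x \<in> image_plus M a L B"
  unfolding image_plus_def by auto

context module
begin

lemma neg_zero: "\<ominus>\<^bsub>M\<^esub> \<zero>\<^bsub>M\<^esub> = \<zero>\<^bsub>M\<^esub>"
  by (rule M.minus_equality) auto

lemma submoduleI_smult:
  assumes "H \<subseteq> carrier M" "\<zero>\<^bsub>M\<^esub> \<in> H"
    and "\<And>x y. x \<in> H \<Longrightarrow> y \<in> H \<Longrightarrow> x \<oplus>\<^bsub>M\<^esub> y \<in> H"
    and "\<And>a x. a \<in> carrier R \<Longrightarrow> x \<in> H \<Longrightarrow> a \<odot>\<^bsub>M\<^esub> x \<in> H"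
  shows "submodule H R M"
proof (rule submoduleI)
  fix x assume "x \<in> H"
  then have "(\<ominus> \<one>) \<odot>\<^bsub>M\<^esub> x \<in> H" "x \<in> carrier M" using assms by auto
  then show "\<ominus>\<^bsub>M\<^esub> x \<in> H" by (simp add: smult_l_minus)
qed (use assms in auto)

lemma submodule_carrier: "submodule L R M \<Longrightarrow> x \<in> L \<Longrightarrow> x \<in> carrier M"
  using submoduleE(1) by blast

lemma submodule_zero: "submodule L R M \<Longrightarrow> \<zero>\<^bsub>M\<^esub> \<in> L"
  using submodule.axioms(1) subgroup.one_closed by fastforce

lemma submodule_add: "submodule L R M \<Longrightarrow> x \<in> L \<Longrightarrow> y \<in> L \<Longrightarrow> x \<oplus>\<^bsub>M\<^esub> y \<in> L"
  using submoduleE(5) by blast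

lemma submodule_smult: "submodule L R M \<Longrightarrow> a \<in> carrier R \<Longrightarrow> x \<in> L \<Longrightarrow> a \<odot>\<^bsub>M\<^esub> x \<in> L"
  using submoduleE(4) by blast

lemma submodule_minus: "submodule L R M \<Longrightarrow> x \<in> L \<Longrightarrow> \<ominus>\<^bsub>M\<^esub> x \<in> L"
  using submoduleE(3) by blast

lemma submodule_diff: "submodule L R M \<Longrightarrow> x \<in> L \<Longrightarrow> y \<in> L \<Longrightarrow> x \<ominus>\<^bsub>M\<^esub> y \<in> L"
  unfolding a_minus_def by (intro submodule_add submodule_minus)

lemma submodule_add_cancel:
  assumes "submodule L R M" "x \<in> carrier M" "y \<in> L" "x \<oplus>\<^bsub>M\<^esub> y \<in> L"
  shows "x \<in> L"
proof -
  have "x \<oplus>\<^bsub>M\<^esub> y \<ominus>\<^bsub>M\<^esub> y = x"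
    using assms submodule_carrier[OF assms(1,3)] by (simp add: a_minus_def M.a_assoc M.r_neg)
  then show ?thesis using submodule_diff[OF assms(1,4,3)] by simp
qed

lemma submodule_diff_cancel:
  assumes "submodule L R M" "x \<in> carrier M" "y \<in> L" "x \<ominus>\<^bsub>M\<^esub> y \<in> L"
  shows "x \<in> L"
  using assms submodule_minus[OF assms(1,3)] by (auto simp: a_minus_def intro: submodule_add_cancel)

lemmas submodule_rules = submodule_carrier submodule_zero submodule_add submodule_smult
  submodule_minus submodule_diff

lemma intermediateI:
  "submodule L R M \<Longrightarrow> (\<And>x. x \<in> B \<Longrightarrow> x \<in> L) \<Longrightarrow> (\<And>x. x \<in> L \<Longrightarrow> x \<in> Z) \<Longrightarrow> L \<in> intermediate R M B Z"
  unfolding intermediate_def by auto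

lemma intermediateD:
  assumes "L \<in> intermediate R M B Z"
  shows "submodule L R M" "B \<subseteq> L" "L \<subseteq> Z"
  using assms unfolding intermediate_def by auto

lemma submodule_Int: "submodule L R M \<Longrightarrow> submodule K R M \<Longrightarrow> submodule (L \<inter> K) R M"
  by (rule submoduleI_smult) (auto intro: submodule_rules)

lemma submodule_image_plus:
  assumes "a \<in> carrier R" "submodule L R M" "submodule B R M"
  shows "submodule (image_plus M a L B) R M"
proof (rule submoduleI_smult)
  note rules = submodule_rules[OF assms(2)] submodule_rules[OF assms(3)]
  show "image_plus M a L B \<subseteq> carrier M"
    unfolding image_plus_def using assms(1) rules by auto
  have "\<zero>\<^bsub>M\<^esub> = a \<odot>\<^bsub>M\<^esub> \<zero>\<^bsub>M\<^esub> \<oplus>\<^bsub>M\<^esub> \<zero>\<^bsub>M\<^esub>" using assms(1) by simp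
  then show "\<zero>\<^bsub>M\<^esub> \<in> image_plus M a L B"
    by (rule image_plusI) (intro rules)+
  fix x y assume "x \<in> image_plus M a L B" "y \<in> image_plus M a L B"
  then obtain l b l' b' where *: "x = a \<odot>\<^bsub>M\<^esub> l \<oplus>\<^bsub>M\<^esub> b" "y = a \<odot>\<^bsub>M\<^esub> l' \<oplus>\<^bsub>M\<^esub> b'"
    "l \<in> L" "l' \<in> L" "b \<in> B" "b' \<in> B"
    unfolding image_plus_def by auto
  then have "x \<oplus>\<^bsub>M\<^esub> y = a \<odot>\<^bsub>M\<^esub> (l \<oplus>\<^bsub>M\<^esub> l') \<oplus>\<^bsub>M\<^esub> (b \<oplus>\<^bsub>M\<^esub> b')"
    using rules assms(1) by (simp add: smult_r_distr M.a_ac)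
  then show "x \<oplus>\<^bsub>M\<^esub> y \<in> image_plus M a L B"
    by (rule image_plusI) (use * rules in auto)
next
  note rules = submodule_rules[OF assms(2)] submodule_rules[OF assms(3)]
  fix s x assume s: "s \<in> carrier R" and "x \<in> image_plus M a L B"
  then obtain l b where *: "x = a \<odot>\<^bsub>M\<^esub> l \<oplus>\<^bsub>M\<^esub> b" "l \<in> L" "b \<in> B"
    unfolding image_plus_def by auto
  then have "s \<odot>\<^bsub>M\<^esub> x = a \<odot>\<^bsub>M\<^esub> (s \<odot>\<^bsub>M\<^esub> l) \<oplus>\<^bsub>M\<^esub> s \<odot>\<^bsub>M\<^esub> b"
    using rules assms(1) s by (simp add: smult_r_distr smult_assoc1[symmetric] R.m_comm)
  then show "s \<odot>\<^bsub>M\<^esub> x \<in> image_plus M a L B"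
    by (rule image_plusI) (use * s rules in auto)
qed

lemma image_plus_upper: "a \<in> carrier R \<Longrightarrow> submodule L R M \<Longrightarrow> submodule B R M \<Longrightarrow> B \<subseteq> image_plus M a L B"
proof
  fix x assume *: "a \<in> carrier R" "submodule L R M" "submodule B R M" "x \<in> B"
  then have "x = a \<odot>\<^bsub>M\<^esub> \<zero>\<^bsub>M\<^esub> \<oplus>\<^bsub>M\<^esub> x" using submodule_carrier by simp
  then show "x \<in> image_plus M a L B"
    by (rule image_plusI) (use * submodule_zero in auto)
qed

lemma image_plus_least:
  assumes "a \<in> carrier R" "submodule K R M" "L \<subseteq> K" "B \<subseteq> K"
  shows "image_plus M a L B \<subseteq> K"
  using assms unfolding image_plus_def by (auto intro!: submodule_add submodule_smult)

abbreviation cyclic_plus :: "'c \<Rightarrow> 'c set \<Rightarrow> 'c set" where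
  "cyclic_plus x N \<equiv> {a \<odot>\<^bsub>M\<^esub> x \<oplus>\<^bsub>M\<^esub> n | a n. a \<in> carrier R \<and> n \<in> N}"

lemma submodule_cyclic_plus:
  assumes "x \<in> carrier M" "submodule N R M"
  shows "submodule (cyclic_plus x N) R M" (is "submodule ?N R M")
proof (rule submoduleI_smult)
  note rules = submodule_rules[OF assms(2)]
  show "?N \<subseteq> carrier M" using rules assms(1) by auto
  have "\<zero>\<^bsub>M\<^esub> = \<zero> \<odot>\<^bsub>M\<^esub> x \<oplus>\<^bsub>M\<^esub> \<zero>\<^bsub>M\<^esub>" using assms(1) by simp
  then show "\<zero>\<^bsub>M\<^esub> \<in> ?N"
    by (intro CollectI exI conjI) (use rules in auto)
  fix u v assume "u \<in> ?N" "v \<in> ?N"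
  then obtain a n a' n' where *: "u = a \<odot>\<^bsub>M\<^esub> x \<oplus>\<^bsub>M\<^esub> n" "v = a' \<odot>\<^bsub>M\<^esub> x \<oplus>\<^bsub>M\<^esub> n'"
    "a \<in> carrier R" "a' \<in> carrier R" "n \<in> N" "n' \<in> N" by auto
  then have "u \<oplus>\<^bsub>M\<^esub> v = (a \<oplus> a') \<odot>\<^bsub>M\<^esub> x \<oplus>\<^bsub>M\<^esub> (n \<oplus>\<^bsub>M\<^esub> n')"
    using rules assms(1) by (simp add: smult_l_distr M.a_ac)
  then show "u \<oplus>\<^bsub>M\<^esub> v \<in> ?N"
    using * rules by (intro CollectI exI[of _ "a \<oplus> a'"] exI[of _ "n \<oplus>\<^bsub>M\<^esub> n'"] conjI) auto
next
  note rules = submodule_rules[OF assms(2)]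
  fix s u assume s: "s \<in> carrier R" and "u \<in> ?N"
  then obtain a n where *: "u = a \<odot>\<^bsub>M\<^esub> x \<oplus>\<^bsub>M\<^esub> n" "a \<in> carrier R" "n \<in> N" by auto
  then have "s \<odot>\<^bsub>M\<^esub> u = (s \<otimes> a) \<odot>\<^bsub>M\<^esub> x \<oplus>\<^bsub>M\<^esub> s \<odot>\<^bsub>M\<^esub> n"
    using rules assms(1) s by (simp add: smult_r_distr smult_assoc1)
  then show "s \<odot>\<^bsub>M\<^esub> u \<in> ?N"
    using * s rules by (intro CollectI exI[of _ "s \<otimes> a"] exI[of _ "s \<odot>\<^bsub>M\<^esub> n"] conjI) auto
qed

lemma smult_commute:
  "a \<in> carrier R \<Longrightarrow> b \<in> carrier R \<Longrightarrow> x \<in> carrier M \<Longrightarrow> a \<odot>\<^bsub>M\<^esub> (b \<odot>\<^bsub>M\<^esub> x) = b \<odot>\<^bsub>M\<^esub> (a \<odot>\<^bsub>M\<^esub> x)"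
  by (simp add: smult_assoc1[symmetric] R.m_comm)

text \<open>The annihilator of the class of \<open>x\<close> in \<open>M/L\<close>.\<close>
lemma colon_ideal:
  assumes "submodule L R M" "x \<in> carrier M"
  shows "ideal {s \<in> carrier R. s \<odot>\<^bsub>M\<^esub> x \<in> L} R" (is "ideal ?I R")
proof (rule idealI)
  note rules = submodule_rules[OF assms(1)]
  show "subgroup ?I (add_monoid R)"
    by (rule R.add.subgroupI)
       (use assms rules R.zero_closed in \<open>auto simp: smult_l_distr smult_l_minus\<close>)
  fix a s assume *: "a \<in> ?I" "s \<in> carrier R"
  then show l: "s \<otimes> a \<in> ?I"
    using assms rules by (auto simp: smult_assoc1)
  show "a \<otimes> s \<in> ?I"
    using l * by (simp add: R.m_comm)
qed (rule R.ring_axioms)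

text \<open>By the modular law \<open>L\<close> is determined, within a chain, by \<open>L \<inter> N\<close> and \<open>L + N\<close>.\<close>
lemma strictly_wf_extension:
  assumes R: "R' = (\<subseteq>) \<or> R' = (\<lambda>X Y. Y \<subseteq> X)"
    and sub: "submodule B R M" "submodule N R M" "submodule Z R M" "B \<subseteq> N" "N \<subseteq> Z"
    and wf: "strictly_wf R' (intermediate R M B N)" "strictly_wf R' (intermediate R M N Z)"
  shows "strictly_wf R' (intermediate R M B Z)"
proof (rule strictly_wf_by_two_maps[OF wf, where f = "\<lambda>L. L \<inter> N" and g = "\<lambda>L. image_plus M \<one> L N"])
  fix X assume X: "X \<in> intermediate R M B Z"
  note X = intermediateD[OF X]
  show "X \<inter> N \<in> intermediate R M B N"
    using X sub by (intro intermediateI submodule_Int) auto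
  show "image_plus M \<one> X N \<in> intermediate R M N Z"
    using X sub image_plus_upper[of \<one> X N] image_plus_least[of \<one> Z X N]
    by (intro intermediateI submodule_image_plus) auto
next
  fix X Y
  show "R' X Y \<Longrightarrow> R' (X \<inter> N) (Y \<inter> N)" using R by auto
  show "R' X Y \<Longrightarrow> R' (image_plus M \<one> X N) (image_plus M \<one> Y N)"
    using R by (auto simp: image_plus_def)
next
  fix X Y assume "X \<in> intermediate R M B Z" "Y \<in> intermediate R M B Z"
    and eq: "R' X Y" "X \<inter> N = Y \<inter> N" "image_plus M \<one> X N = image_plus M \<one> Y N"
  then have X: "submodule X R M" and Y: "submodule Y R M" using intermediateD by blast+
  have le: "Y \<subseteq> X" if XY: "X \<subseteq> Y" "X \<inter> N = Y \<inter> N" "image_plus M \<one> X N = image_plus M \<one> Y N"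
    and X: "submodule X R M" and Y: "submodule Y R M" for X Y
  proof
    fix y assume y: "y \<in> Y"
    have "y = \<one> \<odot>\<^bsub>M\<^esub> y \<oplus>\<^bsub>M\<^esub> \<zero>\<^bsub>M\<^esub>" using Y y submodule_carrier by simp
    then have "y \<in> image_plus M \<one> Y N"
      by (rule image_plusI) (use y sub(2) submodule_zero in auto)
    then obtain x n where xn: "x \<in> X" "n \<in> N" "y = \<one> \<odot>\<^bsub>M\<^esub> x \<oplus>\<^bsub>M\<^esub> n"
      unfolding XY(3)[symmetric] by (auto simp: image_plus_def)
    then have c: "x \<in> carrier M" "n \<in> carrier M" using X sub(2) submodule_carrier by auto
    then have "n \<oplus>\<^bsub>M\<^esub> x \<in> Y" using xn(3) y by (simp add: M.a_comm)
    then have "n \<in> X" using XY(1,2) xn submodule_add_cancel[OF Y c(2)] by blast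
    then show "y \<in> X" using xn c submodule_add[OF X xn(1)] by simp
  qed
  from R show "X = Y"
  proof (elim disjE)
    assume "R' = (\<subseteq>)"
    then have "X \<subseteq> Y" using eq(1) by simp
    then show ?thesis using le[OF _ eq(2,3) X Y] by blast
  next
    assume "R' = (\<lambda>X Y. Y \<subseteq> X)"
    then have "Y \<subseteq> X" using eq(1) by simp
    then show ?thesis using le[OF _ eq(2,3)[symmetric] Y X] by blast
  qed
qed

lemmas dcc_extension = strictly_wf_extension[of "(\<subseteq>)", OF disjI1[OF refl]]
lemmas acc_extension = strictly_wf_extension[of "\<lambda>X Y. Y \<subseteq> X", OF disjI2[OF refl]]

end

section \<open>Linear maps\<close>

definition linear_map ::
  "('a, 'c) ring_scheme \<Rightarrow> ('a, 'b, 'd) module_scheme \<Rightarrow> ('a, 'e, 'f) module_scheme \<Rightarrow> ('b \<Rightarrow> 'e) \<Rightarrow> bool" where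
  "linear_map R M N f \<longleftrightarrow>
     (\<forall>x\<in>carrier M. f x \<in> carrier N \<and> (\<forall>y\<in>carrier M. f (x \<oplus>\<^bsub>M\<^esub> y) = f x \<oplus>\<^bsub>N\<^esub> f y) \<and>
        (\<forall>a\<in>carrier R. f (a \<odot>\<^bsub>M\<^esub> x) = a \<odot>\<^bsub>N\<^esub> f x))"

lemma linear_mapD:
  assumes "linear_map R M N f" "x \<in> carrier M"
  shows "f x \<in> carrier N" "y \<in> carrier M \<Longrightarrow> f (x \<oplus>\<^bsub>M\<^esub> y) = f x \<oplus>\<^bsub>N\<^esub> f y"
    "a \<in> carrier R \<Longrightarrow> f (a \<odot>\<^bsub>M\<^esub> x) = a \<odot>\<^bsub>N\<^esub> f x"
  using assms unfolding linear_map_def by auto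

lemma linear_map_zero_minus:
  assumes "module R M" "module R N" "linear_map R M N f"
  shows "f \<zero>\<^bsub>M\<^esub> = \<zero>\<^bsub>N\<^esub>" and "x \<in> carrier M \<Longrightarrow> f (\<ominus>\<^bsub>M\<^esub> x) = \<ominus>\<^bsub>N\<^esub> f x"
proof -
  interpret M: module R M by fact
  interpret N: module R N by fact
  note f = linear_mapD[OF assms(3)]
  have "f (\<zero>\<^bsub>R\<^esub> \<odot>\<^bsub>M\<^esub> \<zero>\<^bsub>M\<^esub>) = \<zero>\<^bsub>R\<^esub> \<odot>\<^bsub>N\<^esub> f \<zero>\<^bsub>M\<^esub>" by (rule f(3)) auto
  then show "f \<zero>\<^bsub>M\<^esub> = \<zero>\<^bsub>N\<^esub>" using f(1)[of "\<zero>\<^bsub>M\<^esub>"] by simp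
  assume x: "x \<in> carrier M"
  then have "f ((\<ominus>\<^bsub>R\<^esub> \<one>\<^bsub>R\<^esub>) \<odot>\<^bsub>M\<^esub> x) = (\<ominus>\<^bsub>R\<^esub> \<one>\<^bsub>R\<^esub>) \<odot>\<^bsub>N\<^esub> f x" by (rule f(3)) auto
  then show "f (\<ominus>\<^bsub>M\<^esub> x) = \<ominus>\<^bsub>N\<^esub> f x" using x f(1)[OF x] by (simp add: M.smult_l_minus N.smult_l_minus)
qed

lemma submodule_image:
  assumes "module R M" "module R N" "linear_map R M N f" and L: "submodule L R M"
  shows "submodule (f ` L) R N"
proof -
  interpret M: module R M by fact
  interpret N: module R N by fact
  note f = linear_mapD[OF assms(3)] and Lr = M.submodule_rules[OF L]
  show ?thesis
  proof (rule N.submoduleI_smult)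
    show "f ` L \<subseteq> carrier N" using Lr(1) f(1) by blast
    show "\<zero>\<^bsub>N\<^esub> \<in> f ` L" using Lr(2) linear_map_zero_minus(1)[OF assms(1-3)] by (metis imageI)
    fix x y assume "x \<in> f ` L" "y \<in> f ` L"
    then obtain u v where "u \<in> L" "v \<in> L" "x = f u" "y = f v" by blast
    then show "x \<oplus>\<^bsub>N\<^esub> y \<in> f ` L" using Lr(1,3) f(2) by (intro image_eqI[of _ _ "u \<oplus>\<^bsub>M\<^esub> v"]) auto
  next
    fix a x assume a: "a \<in> carrier R" and "x \<in> f ` L"
    then obtain u where "u \<in> L" "x = f u" by blast
    then show "a \<odot>\<^bsub>N\<^esub> x \<in> f ` L" using a Lr(1,4) f(3) by (intro image_eqI[of _ _ "a \<odot>\<^bsub>M\<^esub> u"]) auto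
  qed
qed

lemma submodule_preimage:
  assumes "module R M" "module R N" "linear_map R M N f" and L: "submodule L R N"
  shows "submodule {x \<in> carrier M. f x \<in> L} R M"
proof -
  interpret M: module R M by fact
  interpret N: module R N by fact
  show ?thesis
    by (rule M.submoduleI_smult)
       (use linear_mapD[OF assms(3)] N.submodule_rules[OF L] linear_map_zero_minus(1)[OF assms(1-3)] in auto)
qed

section \<open>Ideals of commutative rings\<close>

text \<open>The union of a strictly ascending chain of ideals would be one of its members.\<close>
lemma (in noetherian_ring) acc_ideals: "acc {I. ideal I R}"
  unfolding strictly_wf_def wf_iff_no_infinite_down_chain
proof (rule notI, elim exE)
  fix f assume "\<forall>i. (f (Suc i), f i) \<in> {(X, Y). X \<in> {I. ideal I R} \<and> Y \<in> {I. ideal I R} \<and> Y \<subseteq> X \<and> X \<noteq> Y}"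
  then have f: "ideal (f i) R" "f i \<subseteq> f (Suc i)" "f (Suc i) \<noteq> f i" for i by auto
  have mono: "f i \<subseteq> f j" if "i \<le> j" for i j using that f(2) by (rule lift_Suc_mono_le[rotated])
  then have "f i \<subseteq> f j \<or> f j \<subseteq> f i" for i j using nat_le_linear by blast
  then have "subset.chain {I. ideal I R} (range f)"
    unfolding subset_chain_def using f(1) by blast
  then have "\<Union>(range f) \<in> range f" by (intro ideal_chain_is_trivial) auto
  then obtain n where "\<Union>(range f) = f n" by auto
  then have "f (Suc n) \<subseteq> f n" by auto
  then show False using f(2,3) by blast
qed

context cring
begin

lemma colon_element_ideal:
  assumes "ideal A R" "b \<in> carrier R"
  shows "ideal {a \<in> carrier R. a \<otimes> b \<in> A} R" (is "ideal ?C R")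
proof (rule idealI)
  interpret A: ideal A R by fact
  show "subgroup ?C (add_monoid R)"
    by (rule add.subgroupI)
       (use assms(2) additive_subgroup.zero_closed[OF A.additive_subgroup_axioms]
          additive_subgroup.a_closed[OF A.additive_subgroup_axioms] in
          \<open>auto simp: l_distr l_minus A.a_inv_closed intro!: exI[of _ \<zero>]\<close>)
  fix a s assume *: "a \<in> ?C" "s \<in> carrier R"
  show "s \<otimes> a \<in> ?C" using * assms(2) A.I_l_closed by (auto simp: m_assoc)
  then show "a \<otimes> s \<in> ?C" using * by (simp add: m_comm)
qed (rule ring_axioms)

lemma ideal_eq_carrier: "ideal A R \<Longrightarrow> \<one> \<in> A \<Longrightarrow> A = carrier R"
  using ideal.one_imp_carrier by blast

text \<open>Noetherian induction in place of a count of monomials. An ideal \<open>B\<close> that is maximal among the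
  counterexamples misses some \<open>y \<in> Y\<close>; the last power \<open>w\<close> of \<open>y\<close> outside \<open>B\<close> satisfies \<open>w\<^sup>2 \<in> B\<close>, so
  \<open>(B + (w))\<^sup>2 \<subseteq> B\<close>. By maximality some power of \<open>Idl Y\<close> lies in \<open>B + (w)\<close>, hence its square in \<open>B\<close>.\<close>
lemma ideal_power_le:
  assumes acc: "acc {I. ideal I R}" and Y: "Y \<subseteq> carrier R"
    and A: "ideal A R" "\<And>y. y \<in> Y \<Longrightarrow> \<exists>p::nat. y [^] p \<in> A"
  shows "\<exists>k::nat. (Idl Y) [^]\<^bsub>ideals_set R\<^esub> k \<subseteq> A"
proof (rule ccontr)
  let ?J = "Idl Y"
  interpret I: comm_monoid "ideals_set R" by (rule ideals_set_is_comm_monoid)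
  have car: "carrier (ideals_set R) = {I. ideal I R}" and mult: "monoid.mult (ideals_set R) = ideal_prod R"
    and one: "one (ideals_set R) = carrier R"
    by (simp_all add: ideals_set_def)
  have J: "?J \<in> carrier (ideals_set R)" using genideal_ideal[OF Y] by (simp add: car)
  let ?bad = "\<lambda>A. (\<forall>y\<in>Y. \<exists>p::nat. y [^] p \<in> A) \<and> \<not> (\<exists>k::nat. ?J [^]\<^bsub>ideals_set R\<^esub> k \<subseteq> A)"
  assume "\<not> (\<exists>k::nat. ?J [^]\<^bsub>ideals_set R\<^esub> k \<subseteq> A)"
  then have "?bad A" using A(2) by blast
  then obtain B where B: "B \<in> {I. ideal I R}" "?bad B"
    and B_max: "\<And>C. C \<in> {I. ideal I R} \<Longrightarrow> ?bad C \<Longrightarrow> B \<subseteq> C \<Longrightarrow> C = B"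
    using strictly_wf_minimal[OF acc, of A ?bad] A(1) by blast
  interpret B: ideal B R using B(1) by simp
  have "?J [^]\<^bsub>ideals_set R\<^esub> (1::nat) = ?J" using J by simp
  then have "\<not> ?J \<subseteq> B" using B(2) by metis
  then have "\<not> Y \<subseteq> B" using genideal_minimal[of B Y] B(1) by blast
  then obtain y where y: "y \<in> Y" "y \<notin> B" by blast
  have yR: "y \<in> carrier R" using y Y by blast
  define p where "p = (LEAST p::nat. y [^] p \<in> B)"
  have p: "y [^] p \<in> B" unfolding p_def by (rule LeastI_ex) (use B(2) y in blast)
  have min: "q < p \<Longrightarrow> y [^] q \<notin> B" for q unfolding p_def by (rule not_less_Least)
  have "p \<noteq> 0"
  proof
    assume "p = 0"
    then have "\<one> \<in> B" using p by simp
    then show False using B.one_imp_carrier y yR by blast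
  qed
  moreover have "p \<noteq> 1" using p y yR by auto
  ultimately obtain q where q: "p = Suc (Suc q)" by (metis One_nat_def old.nat.exhaust)
  define w where "w = y [^] Suc q"
  have wR: "w \<in> carrier R" unfolding w_def using yR by blast
  have wB: "w \<notin> B" unfolding w_def using min q by blast
  have "w \<otimes> w = y [^] (p + q)"
    unfolding w_def q using yR by (simp only: nat_pow_mult) (simp add: add.commute add.left_commute)
  also have "\<dots> = y [^] p \<otimes> y [^] q" using yR by (simp add: nat_pow_mult)
  finally have ww: "w \<otimes> w \<in> B" using p yR B.I_r_closed by simp
  define C where "C = B <+>\<^bsub>R\<^esub> PIdl w"
  have C: "ideal C R" unfolding C_def by (intro add_ideals B.ideal_axioms cgenideal_ideal wR)
  have Cmem: "c \<in> C \<longleftrightarrow> (\<exists>b\<in>B. \<exists>s\<in>carrier R. c = b \<oplus> s \<otimes> w)" for c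
    unfolding C_def set_add_def' cgenideal_def by auto
  have zB: "\<zero> \<in> B" by (rule additive_subgroup.zero_closed[OF B.additive_subgroup_axioms])
  have BC: "B \<subseteq> C"
  proof
    fix b assume b: "b \<in> B"
    then have "b = b \<oplus> \<zero> \<otimes> w" using wR B.Icarr by simp
    then show "b \<in> C" unfolding Cmem using b by blast
  qed
  have "w = \<zero> \<oplus> \<one> \<otimes> w" using wR by simp
  then have "w \<in> C" unfolding Cmem using zB by blast
  then have "C \<noteq> B" using wB by blast
  then have "\<not> ?bad C" using B_max[of C] C BC by blast
  moreover have "\<forall>y\<in>Y. \<exists>p::nat. y [^] p \<in> C" using B(2) BC by blast
  ultimately obtain k :: nat where k: "?J [^]\<^bsub>ideals_set R\<^esub> k \<subseteq> C" by blast
  have prod: "u \<otimes> v \<in> B" if uv: "u \<in> C" "v \<in> C" for u v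
  proof -
    obtain b s where u: "b \<in> B" "s \<in> carrier R" "u = b \<oplus> s \<otimes> w" using uv(1) unfolding Cmem by blast
    obtain b' s' where v: "b' \<in> B" "s' \<in> carrier R" "v = b' \<oplus> s' \<otimes> w" using uv(2) unfolding Cmem by blast
    have c: "b \<in> carrier R" "b' \<in> carrier R" using u v B.Icarr by auto
    have "u \<otimes> v = b \<otimes> v \<oplus> ((s \<otimes> w) \<otimes> b' \<oplus> (s \<otimes> s') \<otimes> (w \<otimes> w))"
      using u v c wR by (simp add: r_distr l_distr m_ac a_ac)
    moreover have "b \<otimes> v \<in> B" using u v c wR B.I_r_closed by simp
    moreover have "(s \<otimes> w) \<otimes> b' \<in> B" using u v wR B.I_l_closed by simp
    moreover have "(s \<otimes> s') \<otimes> (w \<otimes> w) \<in> B" using u v ww B.I_l_closed by simp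
    ultimately show ?thesis by (simp add: additive_subgroup.a_closed[OF B.additive_subgroup_axioms])
  qed
  have "?J [^]\<^bsub>ideals_set R\<^esub> (k + k) = ideal_prod R (?J [^]\<^bsub>ideals_set R\<^esub> k) (?J [^]\<^bsub>ideals_set R\<^esub> k)"
    using I.nat_pow_mult[OF J, of k k] mult by simp
  moreover have "ideal_prod R (?J [^]\<^bsub>ideals_set R\<^esub> k) (?J [^]\<^bsub>ideals_set R\<^esub> k) \<subseteq> B"
  proof
    fix s assume "s \<in> ideal_prod R (?J [^]\<^bsub>ideals_set R\<^esub> k) (?J [^]\<^bsub>ideals_set R\<^esub> k)"
    then show "s \<in> B"
      by induction (use prod k in \<open>auto intro: additive_subgroup.a_closed[OF B.additive_subgroup_axioms]\<close>)
  qed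
  ultimately show False using B(2) by metis
qed

text \<open>Instead of the binomial theorem: \<open>(a + b)\<^sup>k\<^sup>+\<^sup>1 = (a + b)\<^sup>k a + (a + b)\<^sup>k b\<close>, and the induction
  hypothesis applies to the ideals \<open>(A : a)\<close> and \<open>(A : b)\<close>, where one exponent has dropped.\<close>
lemma pow_add_mem_ideal:
  assumes "a \<in> carrier R" "b \<in> carrier R" "ideal A R" "a [^] (n::nat) \<in> A" "b [^] (m::nat) \<in> A"
  shows "(a \<oplus> b) [^] (n + m) \<in> A"
  using assms(3-)
proof (induction "n + m" arbitrary: n m A rule: less_induct)
  case less
  interpret A: ideal A R by (rule less.prems)
  show ?case
  proof (cases "n = 0 \<or> m = 0")
    case True
    then have "\<one> \<in> A" using less.prems by auto
    then show ?thesis using ideal_eq_carrier[OF less.prems(1)] assms(1,2) by simp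
  next
    case False
    then obtain n' m' where nm: "n = Suc n'" "m = Suc m'" by (metis not0_implies_Suc)
    have "(a \<oplus> b) [^] (n' + m) \<in> {s \<in> carrier R. s \<otimes> a \<in> A}"
    proof (rule less.hyps[OF _ colon_element_ideal[OF less.prems(1) assms(1)]])
      show "a [^] n' \<in> {s \<in> carrier R. s \<otimes> a \<in> A}" using less.prems(2) assms(1) nm by simp
      show "b [^] m \<in> {s \<in> carrier R. s \<otimes> a \<in> A}" using less.prems(3) assms(1,2) A.I_r_closed by simp
    qed (use nm in simp)
    moreover have "(a \<oplus> b) [^] (n + m') \<in> {s \<in> carrier R. s \<otimes> b \<in> A}"
    proof (rule less.hyps[OF _ colon_element_ideal[OF less.prems(1) assms(2)]])
      show "a [^] n \<in> {s \<in> carrier R. s \<otimes> b \<in> A}" using less.prems(2) assms(1,2) A.I_r_closed by simp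
      show "b [^] m' \<in> {s \<in> carrier R. s \<otimes> b \<in> A}" using less.prems(3) assms(2) nm by simp
    qed (use nm in simp)
    moreover have "n + m' = n' + m" "n + m = Suc (n' + m)" using nm by auto
    ultimately show ?thesis
      using assms(1,2) additive_subgroup.a_closed[OF A.additive_subgroup_axioms] by (simp add: r_distr)
  qed
qed

text \<open>Products of generators generate the product of the ideals. The ideal \<open>A\<close> varies in the induction,
  since splitting off one factor \<open>h\<close> replaces \<open>A\<close> by \<open>(A : h)\<close>.\<close>
lemma finprod_genideal_le:
  assumes "finite F" "\<And>i. i \<in> F \<Longrightarrow> H i \<subseteq> carrier R" "ideal A R"
    and "\<And>h. (\<And>i. i \<in> F \<Longrightarrow> h i \<in> H i) \<Longrightarrow> finprod R h F \<in> A"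
  shows "finprod (ideals_set R) (\<lambda>i. Idl (H i)) F \<subseteq> A"
  using assms
proof (induction F arbitrary: A rule: finite_induct)
  case empty
  interpret I: comm_monoid "ideals_set R" by (rule ideals_set_is_comm_monoid)
  have "\<one> \<in> A" using empty(3)[of "\<lambda>_. \<one>"] by simp
  then show ?case
    using ideal_eq_carrier[OF empty(2)] unfolding I.finprod_empty by (simp add: ideals_set_def)
next
  case (insert i F)
  interpret I: comm_monoid "ideals_set R" by (rule ideals_set_is_comm_monoid)
  interpret A: ideal A R by (rule insert.prems)
  let ?P = "finprod (ideals_set R) (\<lambda>i. Idl (H i)) F"
  have id: "ideal (Idl (H k)) R" if "k \<in> insert i F" for k
    using insert.prems(1)[OF that] by (rule genideal_ideal)
  have car: "carrier (ideals_set R) = {I. ideal I R}" and mult: "monoid.mult (ideals_set R) = ideal_prod R"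
    by (simp_all add: ideals_set_def)
  have P: "ideal ?P R"
    using I.finprod_closed[of "\<lambda>i. Idl (H i)" F] id car by auto
  have prod: "finprod (ideals_set R) (\<lambda>i. Idl (H i)) (insert i F) = ideal_prod R (Idl (H i)) ?P"
    unfolding mult[symmetric] by (rule I.finprod_insert) (use insert.hyps id car in auto)
  have Hi: "h \<in> carrier R" if "h \<in> H i" for h using insert.prems(1) that by blast
  have P_le: "b \<otimes> h \<in> A" if h: "h \<in> H i" and b: "b \<in> ?P" for h b
  proof -
    have "?P \<subseteq> {b \<in> carrier R. b \<otimes> h \<in> A}"
    proof (rule insert.IH)
      show "ideal {b \<in> carrier R. b \<otimes> h \<in> A} R"
        by (rule colon_element_ideal[OF insert.prems(2) Hi[OF h]])
      fix h' assume h': "\<And>k. k \<in> F \<Longrightarrow> h' k \<in> H k"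
      then have c: "h' k \<in> carrier R" if "k \<in> F" for k using that insert.prems(1) by blast
      have "finprod R (h'(i := h)) (insert i F) \<in> A"
        by (rule insert.prems(3)) (use h h' in auto)
      also have "finprod R (h'(i := h)) (insert i F) = h \<otimes> finprod R (h'(i := h)) F"
        using finprod_insert[of F i "h'(i := h)"] insert.hyps c Hi[OF h] by (simp add: Pi_def)
      also have "finprod R (h'(i := h)) F = finprod R h' F"
        by (rule finprod_cong') (use insert.hyps c in auto)
      finally have "h \<otimes> finprod R h' F \<in> A" .
      moreover have fc: "finprod R h' F \<in> carrier R" by (rule finprod_closed) (use c in auto)
      moreover have "finprod R h' F \<otimes> h = h \<otimes> finprod R h' F" by (rule m_comm[OF fc Hi[OF h]])
      ultimately show "finprod R h' F \<in> {b \<in> carrier R. b \<otimes> h \<in> A}" by (simp only: mem_Collect_eq)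
    qed (use insert.prems(1) in auto)
    then show ?thesis using b by blast
  qed
  have "a \<otimes> b \<in> A" if a: "a \<in> Idl (H i)" and b: "b \<in> ?P" for a b
  proof -
    have bR: "b \<in> carrier R" by (rule ideal.Icarr[OF P b])
    have "Idl (H i) \<subseteq> {a \<in> carrier R. a \<otimes> b \<in> A}"
    proof (rule genideal_minimal[OF colon_element_ideal[OF insert.prems(2) bR]], rule subsetI)
      fix h assume h: "h \<in> H i"
      have "h \<otimes> b = b \<otimes> h" by (rule m_comm[OF Hi[OF h] bR])
      then show "h \<in> {a \<in> carrier R. a \<otimes> b \<in> A}" using P_le[OF h b] Hi[OF h] by simp
    qed
    then show ?thesis using a by blast
  qed
  then show ?case
    unfolding prod
  proof (intro subsetI)
    fix s assume *: "\<And>a b. a \<in> Idl (H i) \<Longrightarrow> b \<in> ?P \<Longrightarrow> a \<otimes> b \<in> A"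
    assume "s \<in> ideal_prod R (Idl (H i)) ?P"
    then show "s \<in> A"
      by induction (use * in \<open>auto intro: additive_subgroup.a_closed[OF A.additive_subgroup_axioms]\<close>)
  qed
qed

lemma finprod_mem_finprod_ideals:
  assumes "finite F" "\<And>i. i \<in> F \<Longrightarrow> ideal (J i) R" "\<And>i. i \<in> F \<Longrightarrow> h i \<in> J i"
  shows "finprod R h F \<in> finprod (ideals_set R) J F"
  using assms
proof (induction F rule: finite_induct)
  case empty
  interpret I: comm_monoid "ideals_set R" by (rule ideals_set_is_comm_monoid)
  show ?case unfolding I.finprod_empty by (simp add: ideals_set_def)
next
  case (insert i F)
  interpret I: comm_monoid "ideals_set R" by (rule ideals_set_is_comm_monoid)
  have car: "carrier (ideals_set R) = {I. ideal I R}" by (simp add: ideals_set_def)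
  have c: "h k \<in> carrier R" if "k \<in> insert i F" for k
    by (rule ideal.Icarr[OF insert.prems(1)[OF that] insert.prems(2)[OF that]])
  have mult: "monoid.mult (ideals_set R) = ideal_prod R" by (simp add: ideals_set_def)
  have "finprod (ideals_set R) J (insert i F) = ideal_prod R (J i) (finprod (ideals_set R) J F)"
    unfolding mult[symmetric] by (rule I.finprod_insert) (use insert.hyps insert.prems(1) car in auto)
  moreover have "finprod R h (insert i F) = h i \<otimes> finprod R h F"
    using finprod_insert[of F i h] insert.hyps c by (simp add: Pi_def)
  moreover have "finprod R h F \<in> finprod (ideals_set R) J F"
    by (rule insert.IH) (use insert.prems in auto)
  ultimately show ?case
    using insert.prems(2)[of i] by (simp add: ideal_prod.prod)
qed

end

lemma ideal_ideal_radical: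
  fixes S :: "'a ring" (structure)
  assumes "cring S" "ideal A S"
  shows "ideal (ideal_radical S A) S"
proof -
  interpret cring S by fact
  interpret A: ideal A S by fact
  have l: "s \<otimes> a \<in> ideal_radical S A" if a: "a \<in> ideal_radical S A" and s: "s \<in> carrier S" for a s
  proof -
    obtain n :: nat where n: "a \<in> carrier S" "a [^] n \<in> A" 
      using a unfolding ideal_radical_def by blast
    have "(s \<otimes> a) [^] n = s [^] n \<otimes> a [^] n" using n s by (simp add: nat_pow_distrib)
    then show ?thesis using n s A.I_l_closed by (auto simp: ideal_radical_def intro!: exI[of _ n])
  qed
  show ?thesis
  proof (rule idealI)
    show "subgroup (ideal_radical S A) (add_monoid S)"
    proof (rule add.subgroupI)
      have "\<zero> [^] (1::nat) \<in> A" using additive_subgroup.zero_closed[OF A.additive_subgroup_axioms] by simp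
      then have "\<zero> \<in> ideal_radical S A" unfolding ideal_radical_def by blast
      then show "ideal_radical S A \<noteq> {}" by blast
      fix a assume a: "a \<in> ideal_radical S A"
      have "(\<ominus> \<one>) \<otimes> a \<in> ideal_radical S A" by (rule l[OF a]) simp
      then show "\<ominus> a \<in> ideal_radical S A" using a by (simp add: l_minus ideal_radical_def)
      fix b assume "b \<in> ideal_radical S A"
      then show "a \<oplus> b \<in> ideal_radical S A"
        using a pow_add_mem_ideal[OF _ _ assms(2)] unfolding ideal_radical_def by blast
    qed (auto simp: ideal_radical_def)
    fix a s assume *: "a \<in> ideal_radical S A" "s \<in> carrier S"
    show "s \<otimes> a \<in> ideal_radical S A" by (rule l[OF *])
    then show "a \<otimes> s \<in> ideal_radical S A" using * by (simp add: m_comm ideal_radical_def)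
  qed (rule ring_axioms)
qed

section \<open>Noetherian and Artinian subquotients\<close>

definition power_torsion :: "('a, 'c) ring_scheme \<Rightarrow> ('a, 'b, 'd) module_scheme \<Rightarrow> 'a set \<Rightarrow> 'b set" where
  "power_torsion R M Y =
     {z \<in> carrier M. \<forall>y\<in>Y. \<exists>p::nat. (y [^]\<^bsub>R\<^esub> p) \<odot>\<^bsub>M\<^esub> z = \<zero>\<^bsub>M\<^esub>}"

context module
begin

lemma pow_Suc_smult:
  assumes "y \<in> carrier R" "z \<in> carrier M"
  shows "(y [^] Suc n) \<odot>\<^bsub>M\<^esub> z = y \<odot>\<^bsub>M\<^esub> ((y [^] n) \<odot>\<^bsub>M\<^esub> z)"
  using assms by (simp add: smult_assoc1 smult_commute[of "y [^] n" y z])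

lemma pow_add_smult:
  "y \<in> carrier R \<Longrightarrow> z \<in> carrier M \<Longrightarrow> (y [^] (m + n :: nat)) \<odot>\<^bsub>M\<^esub> z = (y [^] m) \<odot>\<^bsub>M\<^esub> ((y [^] n) \<odot>\<^bsub>M\<^esub> z)"
  by (simp add: R.nat_pow_mult[symmetric] smult_assoc1)

lemma pow_smult_mem_mono:
  assumes "submodule L R M" "y \<in> carrier R" "z \<in> carrier M" "(y [^] (m::nat)) \<odot>\<^bsub>M\<^esub> z \<in> L" "m \<le> n"
  shows "(y [^] n) \<odot>\<^bsub>M\<^esub> z \<in> L"
  using assms pow_add_smult[of y z "n - m" m] submodule_smult[OF assms(1)] by simp

lemma pow_smult_zero_mono:
  assumes "y \<in> carrier R" "z \<in> carrier M" "(y [^] (m::nat)) \<odot>\<^bsub>M\<^esub> z = \<zero>\<^bsub>M\<^esub>" "m \<le> n"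
  shows "(y [^] n) \<odot>\<^bsub>M\<^esub> z = \<zero>\<^bsub>M\<^esub>"
  using assms pow_add_smult[of y z "n - m" m] by simp

lemma cyclic_plusI:
  "v = a \<odot>\<^bsub>M\<^esub> x \<oplus>\<^bsub>M\<^esub> n \<Longrightarrow> a \<in> carrier R \<Longrightarrow> n \<in> N
    \<Longrightarrow> v \<in> cyclic_plus x N"
  by auto

lemma cyclic_plus_upper:
  assumes "x \<in> carrier M" "submodule N R M"
  shows "x \<in> cyclic_plus x N"
    and "N \<subseteq> cyclic_plus x N"
proof -
  show "x \<in> cyclic_plus x N"
    by (rule cyclic_plusI[of _ \<one> _ "\<zero>\<^bsub>M\<^esub>"]) (use assms submodule_zero in auto)
  show "N \<subseteq> cyclic_plus x N"
  proof
    fix n assume "n \<in> N"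
    then show "n \<in> cyclic_plus x N"
      by (intro cyclic_plusI[of _ \<zero> _ n]) (use assms submodule_carrier in auto)
  qed
qed

lemma cyclic_plus_mem:
  assumes "submodule N R M" "submodule K R M" "N \<subseteq> K" "x \<in> carrier M"
    and "a \<in> carrier R" "n \<in> N" "a \<odot>\<^bsub>M\<^esub> x \<oplus>\<^bsub>M\<^esub> n \<in> K"
  shows "a \<odot>\<^bsub>M\<^esub> x \<in> K"
  using assms submodule_add_cancel[of K "a \<odot>\<^bsub>M\<^esub> x" n] by auto

text \<open>A submodule between \<open>N\<close> and \<open>Rx + N\<close> is determined by the ideal of all \<open>s\<close> for which it contains
  \<open>sx\<close>.\<close>
lemma acc_cyclic_extension:
  assumes "acc {I. ideal I R}" "x \<in> carrier M" "submodule N R M"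
  shows "acc (intermediate R M N (cyclic_plus x N))" (is "acc ?A")
proof (rule strictly_wf_by_map[OF assms(1), where f = "\<lambda>L. {s \<in> carrier R. s \<odot>\<^bsub>M\<^esub> x \<in> L}"])
  fix X assume "X \<in> ?A"
  then show "{s \<in> carrier R. s \<odot>\<^bsub>M\<^esub> x \<in> X} \<in> {I. ideal I R}"
    using colon_ideal assms(2) intermediateD(1) by blast
next
  fix X Y assume XY: "X \<in> ?A" "Y \<in> ?A" "Y \<subseteq> X"
    and eq: "{s \<in> carrier R. s \<odot>\<^bsub>M\<^esub> x \<in> X} = {s \<in> carrier R. s \<odot>\<^bsub>M\<^esub> x \<in> Y}"
  note X = intermediateD[OF XY(1)] and Y = intermediateD[OF XY(2)]
  have "X \<subseteq> Y"
  proof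
    fix v assume v: "v \<in> X"
    then obtain a n where an: "v = a \<odot>\<^bsub>M\<^esub> x \<oplus>\<^bsub>M\<^esub> n" "a \<in> carrier R" "n \<in> N" using X by blast
    then have "a \<odot>\<^bsub>M\<^esub> x \<in> X"
      using cyclic_plus_mem[OF assms(3) X(1,2) assms(2)] v by blast
    then have "a \<odot>\<^bsub>M\<^esub> x \<in> Y" using eq an by blast
    then show "v \<in> Y" using an Y submodule_add by blast
  qed
  then show "X = Y" using XY by blast
qed auto

lemma acc_finitely_generated:
  assumes "acc {I. ideal I R}" "finite X" "X \<subseteq> carrier M"
    and gen: "\<And>N. submodule N R M \<Longrightarrow> X \<subseteq> N \<Longrightarrow> N = carrier M"
  shows "acc (intermediate R M {\<zero>\<^bsub>M\<^esub>} (carrier M))"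
proof -
  have zero: "submodule {\<zero>\<^bsub>M\<^esub>} R M" by (rule submoduleI_smult) auto
  from assms(2,3) have "\<exists>N. submodule N R M \<and> X \<subseteq> N \<and> acc (intermediate R M {\<zero>\<^bsub>M\<^esub>} N)"
  proof (induction X rule: finite_induct)
    case empty
    have "intermediate R M {\<zero>\<^bsub>M\<^esub>} {\<zero>\<^bsub>M\<^esub>} \<subseteq> {{\<zero>\<^bsub>M\<^esub>}}" by (auto simp: intermediate_def)
    then have "acc (intermediate R M {\<zero>\<^bsub>M\<^esub>} {\<zero>\<^bsub>M\<^esub>})"
      unfolding strictly_wf_def by (intro wf_subset[OF wf_on_bot]) auto
    then show ?case using zero by blast
  next
    case (insert x X)
    then obtain N where N: "submodule N R M" "X \<subseteq> N" "acc (intermediate R M {\<zero>\<^bsub>M\<^esub>} N)" by auto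
    let ?N = "cyclic_plus x N"
    have x: "x \<in> carrier M" using insert by auto
    note N' = submodule_cyclic_plus[OF x N(1)] cyclic_plus_upper[OF x N(1)]
    have "acc (intermediate R M {\<zero>\<^bsub>M\<^esub>} ?N)"
      by (rule acc_extension[OF zero N(1) N'(1) _ N'(3) N(3) acc_cyclic_extension[OF assms(1) x N(1)]])
         (use N(1) submodule_zero in auto)
    then show ?case using N' N(2) by blast
  qed
  then show ?thesis using gen by metis
qed

text \<open>For each \<open>y\<close> in turn, replace \<open>z\<close> by its last multiple \<open>y\<^sup>q z\<close> outside \<open>L\<close>. Multiples already
  known to lie in \<open>L\<close> stay there.\<close>
lemma exists_socle_element:
  assumes L: "submodule L R M" and Z: "submodule Z R M" and z: "z \<in> Z" "z \<notin> L"
    and Y: "finite Y" "Y \<subseteq> carrier R"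
    and tors: "\<And>y v. y \<in> Y \<Longrightarrow> v \<in> Z \<Longrightarrow> \<exists>p::nat. (y [^] p) \<odot>\<^bsub>M\<^esub> v \<in> L"
  shows "\<exists>z. z \<in> Z \<and> z \<notin> L \<and> (\<forall>y\<in>Y. y \<odot>\<^bsub>M\<^esub> z \<in> L)"
  using Y tors
proof (induction Y rule: finite_induct)
  case empty
  then show ?case using z by auto
next
  case (insert y Y)
  then obtain z where z: "z \<in> Z" "z \<notin> L" "\<forall>y\<in>Y. y \<odot>\<^bsub>M\<^esub> z \<in> L" by auto
  have zM: "z \<in> carrier M" using z(1) Z submodule_carrier by blast
  have y: "y \<in> carrier R" using insert.prems by auto
  define p where "p = (LEAST p::nat. (y [^] p) \<odot>\<^bsub>M\<^esub> z \<in> L)"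
  have p: "(y [^] p) \<odot>\<^bsub>M\<^esub> z \<in> L"
    unfolding p_def by (rule LeastI_ex) (use insert.prems z in auto)
  have min: "q < p \<Longrightarrow> (y [^] q) \<odot>\<^bsub>M\<^esub> z \<notin> L" for q unfolding p_def by (rule not_less_Least)
  have "p \<noteq> 0"
  proof
    assume "p = 0"
    then show False using p z(2) zM by simp
  qed
  then obtain q where q: "p = Suc q" by (cases p) auto
  let ?z = "(y [^] q) \<odot>\<^bsub>M\<^esub> z"
  have "y' \<odot>\<^bsub>M\<^esub> ?z \<in> L" if "y' \<in> Y" for y'
    using that z(3) insert.prems zM y submodule_smult[OF L]
    by (subst smult_commute) auto
  moreover have "y \<odot>\<^bsub>M\<^esub> ?z \<in> L" using p pow_Suc_smult[OF y zM] q by simp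
  moreover have "?z \<in> Z" "?z \<notin> L" using z(1) y submodule_smult[OF Z] min q by auto
  ultimately show ?case by blast
qed

text \<open>Among the submodules \<open>L\<close> for which \<open>L/B\<close> is Artinian there is a maximal one. If it were not \<open>Z\<close>,
  some \<open>z\<close> outside \<open>L\<close> would be multiplied into \<open>L\<close> by the whole maximal ideal, so that \<open>(L + Rz)/L\<close>
  would be simple and \<open>L + Rz\<close> a larger such submodule.\<close>
lemma dcc_of_acc_torsion:
  assumes B: "submodule B R M" and Z: "submodule Z R M" and BZ: "B \<subseteq> Z"
    and acc: "acc (intermediate R M B Z)"
    and Y: "finite Y" "Y \<subseteq> carrier R" and max: "maximalideal (Idl Y) R"
    and tors: "\<And>y v. y \<in> Y \<Longrightarrow> v \<in> Z \<Longrightarrow> \<exists>p::nat. (y [^] p) \<odot>\<^bsub>M\<^esub> v \<in> B"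
  shows "dcc (intermediate R M B Z)"
proof -
  have "intermediate R M B B \<subseteq> {B, B}" by (auto simp: intermediate_def)
  then have "dcc (intermediate R M B B)" by (rule strictly_wf_mono[OF dcc_pair])
  moreover have "B \<in> intermediate R M B Z" using B BZ by (auto simp: intermediate_def)
  ultimately obtain L where L: "L \<in> intermediate R M B Z" "dcc (intermediate R M B L)"
    and L_max: "\<And>K. K \<in> intermediate R M B Z \<Longrightarrow> dcc (intermediate R M B K) \<Longrightarrow> L \<subseteq> K \<Longrightarrow> K = L"
    using strictly_wf_minimal[OF acc, of B "\<lambda>L. dcc (intermediate R M B L)"] by blast
  note LD = intermediateD[OF L(1)]
  have "L = Z"
  proof (rule ccontr)
    assume "L \<noteq> Z"
    then obtain z0 where z0: "z0 \<in> Z" "z0 \<notin> L" using LD by blast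
    obtain z where z: "z \<in> Z" "z \<notin> L" "\<forall>y\<in>Y. y \<odot>\<^bsub>M\<^esub> z \<in> L"
      using exists_socle_element[OF LD(1) Z z0 Y] tors LD(2) by blast
    have zM: "z \<in> carrier M" using z(1) Z submodule_carrier by blast
    let ?K = "cyclic_plus z L"
    note K = submodule_cyclic_plus[OF zM LD(1)] cyclic_plus_upper[OF zM LD(1)]
    have "Idl Y \<subseteq> {s \<in> carrier R. s \<odot>\<^bsub>M\<^esub> z \<in> L}"
      using z(3) Y by (intro R.genideal_minimal colon_ideal[OF LD(1) zM]) auto
    then have sub: "Idl Y \<subseteq> {s \<in> carrier R. s \<odot>\<^bsub>M\<^esub> z \<in> X}" if "L \<subseteq> X" for X using that by blast
    have "intermediate R M L ?K \<subseteq> {L, ?K}"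
    proof
      fix X assume "X \<in> intermediate R M L ?K"
      note X = intermediateD[OF this]
      have id: "ideal {s \<in> carrier R. s \<odot>\<^bsub>M\<^esub> z \<in> X} R" by (rule colon_ideal[OF X(1) zM])
      consider "{s \<in> carrier R. s \<odot>\<^bsub>M\<^esub> z \<in> X} = Idl Y" | "{s \<in> carrier R. s \<odot>\<^bsub>M\<^esub> z \<in> X} = carrier R"
        using maximalideal.I_maximal[OF max id sub[OF X(2)]] by blast
      then show "X \<in> {L, ?K}"
      proof cases
        case 1
        have "X \<subseteq> L"
        proof
          fix v assume v: "v \<in> X"
          then obtain a n where an: "v = a \<odot>\<^bsub>M\<^esub> z \<oplus>\<^bsub>M\<^esub> n" "a \<in> carrier R" "n \<in> L" using X by blast
          then have "a \<odot>\<^bsub>M\<^esub> z \<in> X" using cyclic_plus_mem[OF LD(1) X(1,2) zM] v by blast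
          then have "a \<odot>\<^bsub>M\<^esub> z \<in> L" using 1 an sub[of L] by blast
          then show "v \<in> L" using an LD(1) submodule_add by blast
        qed
        then show ?thesis using X by blast
      next
        case 2
        have "?K \<subseteq> X" using 2 X by (auto intro!: submodule_add[OF X(1)])
        then show ?thesis using X by blast
      qed
    qed
    then have "dcc (intermediate R M L ?K)" by (rule strictly_wf_mono[OF dcc_pair])
    then have "dcc (intermediate R M B ?K)"
      by (rule dcc_extension[OF B LD(1) K(1) LD(2) K(3) L(2)])
    moreover have "?K \<subseteq> Z" using LD z(1) Z by (auto intro!: submodule_add[OF Z] submodule_smult[OF Z])
    then have "?K \<in> intermediate R M B Z" using K LD by (auto simp: intermediate_def)
    ultimately have "?K = L" using L_max K by blast
    then show False using K(2) z(2) by blast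
  qed
  then show ?thesis using L by simp
qed

text \<open>An argument of Melkersson, in the spirit of Hilbert's basis theorem. A submodule \<open>L\<close> of the
  \<open>x\<close>-torsion module \<open>Z/B\<close> is recorded by the descending sequence of the submodules
  \<open>x\<^sup>j (L \<inter> (0 : x\<^sup>j\<^sup>+\<^sup>1))\<close> of the Artinian module \<open>0 : x\<close>; an element killed by \<open>x\<^sup>j\<^sup>+\<^sup>1\<close> can be corrected
  by an element of the smaller submodule so that \<open>x\<^sup>j\<close> kills the difference.\<close>
lemma dcc_of_dcc_socle:
  assumes B: "submodule B R M" and Z: "submodule Z R M" and BZ: "B \<subseteq> Z" and x: "x \<in> carrier R"
    and tors: "\<And>v. v \<in> Z \<Longrightarrow> \<exists>p::nat. (x [^] p) \<odot>\<^bsub>M\<^esub> v \<in> B"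
    and dcc: "dcc (intermediate R M B {v \<in> Z. x \<odot>\<^bsub>M\<^esub> v \<in> B})"
  shows "dcc (intermediate R M B Z)"
proof -
  note Br = submodule_rules[OF B] and Zr = submodule_rules[OF Z]
  define f where "f L j = {u \<in> Z. \<exists>z\<in>L. (x [^] Suc j) \<odot>\<^bsub>M\<^esub> z \<in> B \<and> u \<ominus>\<^bsub>M\<^esub> (x [^] j) \<odot>\<^bsub>M\<^esub> z \<in> B}"
    for L and j :: nat
  show ?thesis
  proof (rule dcc_by_sequences[OF dcc, where f = f])
    fix L j assume "L \<in> intermediate R M B Z"
    note L = intermediateD[OF this]
    note Lr = submodule_rules[OF L(1)]
    show "f L j \<in> intermediate R M B {v \<in> Z. x \<odot>\<^bsub>M\<^esub> v \<in> B}"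
    proof (rule intermediateI)
      show "submodule (f L j) R M"
      proof (rule submoduleI_smult)
        show "f L j \<subseteq> carrier M" unfolding f_def using Zr by auto
        show "\<zero>\<^bsub>M\<^esub> \<in> f L j"
          unfolding f_def using x Br Zr Lr
          by (auto simp del: R.nat_pow_Suc simp: a_minus_def intro!: bexI[of _ "\<zero>\<^bsub>M\<^esub>"])
      next
        fix u v assume "u \<in> f L j" "v \<in> f L j"
        then obtain z w where *: "u \<in> Z" "v \<in> Z" "z \<in> L" "w \<in> L"
          "(x [^] Suc j) \<odot>\<^bsub>M\<^esub> z \<in> B" "(x [^] Suc j) \<odot>\<^bsub>M\<^esub> w \<in> B"
          "u \<ominus>\<^bsub>M\<^esub> (x [^] j) \<odot>\<^bsub>M\<^esub> z \<in> B" "v \<ominus>\<^bsub>M\<^esub> (x [^] j) \<odot>\<^bsub>M\<^esub> w \<in> B"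
          unfolding f_def by auto
        have c: "u \<in> carrier M" "v \<in> carrier M" "z \<in> carrier M" "w \<in> carrier M"
          using * Zr Lr by auto
        have "(x [^] Suc j) \<odot>\<^bsub>M\<^esub> (z \<oplus>\<^bsub>M\<^esub> w) \<in> B"
          using Br(3)[OF *(5,6)] x c by (simp add: smult_r_distr del: R.nat_pow_Suc)
        moreover have "u \<oplus>\<^bsub>M\<^esub> v \<ominus>\<^bsub>M\<^esub> (x [^] j) \<odot>\<^bsub>M\<^esub> (z \<oplus>\<^bsub>M\<^esub> w) \<in> B"
          using Br(3)[OF *(7,8)] x c by (simp add: smult_r_distr M.minus_add M.a_ac a_minus_def)
        ultimately show "u \<oplus>\<^bsub>M\<^esub> v \<in> f L j"
          unfolding f_def using Zr(3)[OF *(1,2)] Lr(3)[OF *(3,4)] by blast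
      next
        fix s u assume s: "s \<in> carrier R" and "u \<in> f L j"
        then obtain z where *: "u \<in> Z" "z \<in> L" 
          "(x [^] Suc j) \<odot>\<^bsub>M\<^esub> z \<in> B" "u \<ominus>\<^bsub>M\<^esub> (x [^] j) \<odot>\<^bsub>M\<^esub> z \<in> B"
          unfolding f_def by auto
        have c: "u \<in> carrier M" "z \<in> carrier M" using * Zr Lr by auto
        have "(x [^] Suc j) \<odot>\<^bsub>M\<^esub> (s \<odot>\<^bsub>M\<^esub> z) \<in> B"
          using Br(4)[OF s *(3)] x c s by (simp add: smult_commute[of s] del: R.nat_pow_Suc)
        moreover have "s \<odot>\<^bsub>M\<^esub> u \<ominus>\<^bsub>M\<^esub> (x [^] j) \<odot>\<^bsub>M\<^esub> (s \<odot>\<^bsub>M\<^esub> z) \<in> B"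
          using Br(4)[OF s *(4)] x c s
          by (simp add: smult_r_distr smult_r_minus a_minus_def smult_commute[of s])
        ultimately show "s \<odot>\<^bsub>M\<^esub> u \<in> f L j"
          unfolding f_def using * s Zr(4)[OF s *(1)] Lr(4)[OF s *(2)] by blast
      qed
    next
      fix b assume "b \<in> B"
      then show "b \<in> f L j"
        unfolding f_def using x Br Lr BZ
        by (auto simp del: R.nat_pow_Suc simp: a_minus_def intro!: bexI[of _ "\<zero>\<^bsub>M\<^esub>"])
    next
      fix u assume "u \<in> f L j"
      then obtain z where *: "u \<in> Z" "z \<in> L" 
        "(x [^] Suc j) \<odot>\<^bsub>M\<^esub> z \<in> B" "u \<ominus>\<^bsub>M\<^esub> (x [^] j) \<odot>\<^bsub>M\<^esub> z \<in> B"
        unfolding f_def by auto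
      have c: "u \<in> carrier M" "z \<in> carrier M" using * Zr Lr by auto
      have "x \<odot>\<^bsub>M\<^esub> (u \<ominus>\<^bsub>M\<^esub> (x [^] j) \<odot>\<^bsub>M\<^esub> z) = x \<odot>\<^bsub>M\<^esub> u \<ominus>\<^bsub>M\<^esub> (x [^] Suc j) \<odot>\<^bsub>M\<^esub> z"
        using x c by (simp add: a_minus_def smult_r_distr smult_r_minus smult_assoc1 smult_commute[of x "x [^] j" z])
      then have "x \<odot>\<^bsub>M\<^esub> u \<in> B"
        using Br(4)[OF x *(4)] submodule_diff_cancel[OF B _ *(3)] x c by simp
      then show "u \<in> {v \<in> Z. x \<odot>\<^bsub>M\<^esub> v \<in> B}" using * by simp
    qed
    show "f L j \<subseteq> f L i" if "i \<le> j" for i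
      using that
    proof (rule lift_Suc_antimono_le[rotated])
      fix j show "f L (Suc j) \<subseteq> f L j"
      proof
        fix u assume "u \<in> f L (Suc j)"
        then obtain z where *: "u \<in> Z" "z \<in> L" 
          "(x [^] Suc (Suc j)) \<odot>\<^bsub>M\<^esub> z \<in> B" "u \<ominus>\<^bsub>M\<^esub> (x [^] Suc j) \<odot>\<^bsub>M\<^esub> z \<in> B"
          unfolding f_def by auto
        have z: "z \<in> carrier M" using * Lr by auto
        show "u \<in> f L j"
          unfolding f_def using * x z Lr(4)[OF x *(2)]
          by (auto simp: smult_assoc1 intro!: bexI[of _ "x \<odot>\<^bsub>M\<^esub> z"])
      qed
    qed
  next
    fix X Y :: "'c set" and j assume "X \<subseteq> Y"
    then show "f X j \<subseteq> f Y j" unfolding f_def by blast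
  next
    fix X Y assume XY: "X \<in> intermediate R M B Z" "Y \<in> intermediate R M B Z" "X \<subseteq> Y" "f X = f Y"
    note X = intermediateD[OF XY(1)] and Y = intermediateD[OF XY(2)]
    have "y \<in> X" if "y \<in> Y" "(x [^] j) \<odot>\<^bsub>M\<^esub> y \<in> B" for y and j :: nat
      using that
    proof (induction j arbitrary: y)
      case 0
      then show ?case using X Y submodule_carrier[OF Y(1)] by auto
    next
      case (Suc j)
      have y: "y \<in> carrier M" using Suc Y submodule_carrier by blast
      have "(x [^] j) \<odot>\<^bsub>M\<^esub> y \<in> f Y j"
        unfolding f_def using Suc x y Y Br(2) Zr(4)[of "x [^] j" y]
        by (auto simp del: R.nat_pow_Suc simp: a_minus_def M.r_neg intro!: bexI[of _ y])
      then have "(x [^] j) \<odot>\<^bsub>M\<^esub> y \<in> f X j" using XY(4) by simp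
      then obtain z where z: "z \<in> X" "(x [^] j) \<odot>\<^bsub>M\<^esub> y \<ominus>\<^bsub>M\<^esub> (x [^] j) \<odot>\<^bsub>M\<^esub> z \<in> B"
        unfolding f_def by auto
      have zM: "z \<in> carrier M" using z X submodule_carrier by blast
      have "(x [^] j) \<odot>\<^bsub>M\<^esub> (y \<ominus>\<^bsub>M\<^esub> z) \<in> B"
        using z(2) x y zM by (simp add: a_minus_def smult_r_distr smult_r_minus)
      moreover have "y \<ominus>\<^bsub>M\<^esub> z \<in> Y" using Suc z XY(3) submodule_diff[OF Y(1)] by blast
      ultimately have "y \<ominus>\<^bsub>M\<^esub> z \<in> X" using Suc.IH by blast
      then show ?case using submodule_diff_cancel[OF X(1) y z(1)] by blast
    qed
    then show "X = Y" using XY(3) Y tors by blast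
  qed
qed

end

section \<open>Modules with a differential and their Koszul cones\<close>

text \<open>Complexes are handled as single modules with a square-zero endomorphism. Forgetting the
  cohomological index removes all bookkeeping of degrees from the cone construction.\<close>
locale differential_module = module R M for R :: "('a, 'c) ring_scheme" (structure)
    and M :: "('a, 'b, 'd) module_scheme" (structure) +
  fixes \<delta> :: "'b \<Rightarrow> 'b"
  assumes linear: "linear_map R M M \<delta>"
    and d_d: "x \<in> carrier M \<Longrightarrow> \<delta> (\<delta> x) = \<zero>\<^bsub>M\<^esub>"

definition cycles :: "('a, 'b, 'd) module_scheme \<Rightarrow> ('b \<Rightarrow> 'b) \<Rightarrow> 'b set" where
  "cycles M \<delta> = {z \<in> carrier M. \<delta> z = \<zero>\<^bsub>M\<^esub>}"

text \<open>For \<open>Y = {}\<close> this says that \<open>x\<close> acts surjectively on \<open>M\<close> modulo \<open>x\<close>-power torsion. The condition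
  on \<open>Y\<close> makes the property descend to the torsion submodules with respect to subsets of \<open>X\<close>; the
  exponent \<open>p\<close> is the same for \<open>e\<close> and \<open>e'\<close>, which gives uniform control over finitely many
  components.\<close>
definition torsion_divisible :: "('a, 'c) ring_scheme \<Rightarrow> ('a, 'b, 'd) module_scheme \<Rightarrow> 'a set \<Rightarrow> bool" where
  "torsion_divisible R M X \<longleftrightarrow>
     (\<forall>Y\<subseteq>X. \<forall>x\<in>X. \<forall>p::nat. \<forall>e\<in>carrier M. (\<forall>y\<in>Y. (y [^]\<^bsub>R\<^esub> p) \<odot>\<^bsub>M\<^esub> e = \<zero>\<^bsub>M\<^esub>) \<longrightarrow>
        (\<exists>m::nat. \<exists>e'\<in>carrier M. (\<forall>y\<in>Y. (y [^]\<^bsub>R\<^esub> p) \<odot>\<^bsub>M\<^esub> e' = \<zero>\<^bsub>M\<^esub>) \<and>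
           (x [^]\<^bsub>R\<^esub> Suc m) \<odot>\<^bsub>M\<^esub> e' = (x [^]\<^bsub>R\<^esub> m) \<odot>\<^bsub>M\<^esub> e))"

context module
begin

lemma power_torsion_uniform:
  assumes "finite Y" "Y \<subseteq> carrier R" "z \<in> power_torsion R M Y"
  obtains p :: nat where "\<And>y. y \<in> Y \<Longrightarrow> (y [^] p) \<odot>\<^bsub>M\<^esub> z = \<zero>\<^bsub>M\<^esub>"
proof -
  have z: "z \<in> carrier M" using assms(3) by (auto simp: power_torsion_def)
  have "\<forall>y\<in>Y. \<exists>p::nat. (y [^] p) \<odot>\<^bsub>M\<^esub> z = \<zero>\<^bsub>M\<^esub>" using assms(3) by (auto simp: power_torsion_def)
  then obtain p :: "'a \<Rightarrow> nat" where p: "\<And>y. y \<in> Y \<Longrightarrow> (y [^] p y) \<odot>\<^bsub>M\<^esub> z = \<zero>\<^bsub>M\<^esub>" by metis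
  show ?thesis
  proof (rule that[of "Max (p ` Y)"])
    fix y assume "y \<in> Y"
    then show "(y [^] Max (p ` Y)) \<odot>\<^bsub>M\<^esub> z = \<zero>\<^bsub>M\<^esub>"
      by (intro pow_smult_zero_mono[of y z "p y" "Max (p ` Y)"]) (use p assms(1,2) z in auto)
  qed
qed

lemma submodule_power_torsion:
  assumes "Y \<subseteq> carrier R"
  shows "submodule (power_torsion R M Y) R M"
proof (rule submoduleI_smult)
  show "power_torsion R M Y \<subseteq> carrier M" "\<zero>\<^bsub>M\<^esub> \<in> power_torsion R M Y"
    using assms by (auto simp: power_torsion_def)
  fix u v assume *: "u \<in> power_torsion R M Y" "v \<in> power_torsion R M Y"
  have "\<exists>p::nat. (y [^] p) \<odot>\<^bsub>M\<^esub> (u \<oplus>\<^bsub>M\<^esub> v) = \<zero>\<^bsub>M\<^esub>" if "y \<in> Y" for y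
  proof -
    obtain p q :: nat where "(y [^] p) \<odot>\<^bsub>M\<^esub> u = \<zero>\<^bsub>M\<^esub>" "(y [^] q) \<odot>\<^bsub>M\<^esub> v = \<zero>\<^bsub>M\<^esub>"
      using * \<open>y \<in> Y\<close> unfolding power_torsion_def by blast
    then have "(y [^] max p q) \<odot>\<^bsub>M\<^esub> u = \<zero>\<^bsub>M\<^esub>" "(y [^] max p q) \<odot>\<^bsub>M\<^esub> v = \<zero>\<^bsub>M\<^esub>"
      using pow_smult_zero_mono[of y u p "max p q"] pow_smult_zero_mono[of y v q "max p q"]
        * that assms by (auto simp: power_torsion_def)
    then show ?thesis
      using * that assms by (intro exI[of _ "max p q"]) (auto simp: power_torsion_def smult_r_distr)
  qed
  then show "u \<oplus>\<^bsub>M\<^esub> v \<in> power_torsion R M Y" using * by (auto simp: power_torsion_def)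
next
  fix a u assume a: "a \<in> carrier R" and u: "u \<in> power_torsion R M Y"
  have "(y [^] p) \<odot>\<^bsub>M\<^esub> (a \<odot>\<^bsub>M\<^esub> u) = a \<odot>\<^bsub>M\<^esub> ((y [^] p) \<odot>\<^bsub>M\<^esub> u)" if "y \<in> Y" for y and p :: nat
    using that assms a u by (intro smult_commute) (auto simp: power_torsion_def)
  then show "a \<odot>\<^bsub>M\<^esub> u \<in> power_torsion R M Y"
    using a u by (auto simp: power_torsion_def) (metis a smult_r_null)
qed

text \<open>With \<open>x\<^sup>m\<^sup>+\<^sup>1 v' = x\<^sup>m v\<close> the difference \<open>v - x v'\<close> is killed by \<open>x\<^sup>m\<close>.\<close>
lemma power_torsion_split:
  assumes X: "X \<subseteq> carrier R" and div: "torsion_divisible R M X"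
    and Y: "finite Y" "Y \<subseteq> X" and x: "x \<in> X" and v: "v \<in> power_torsion R M Y"
  obtains v' v'' where "v' \<in> power_torsion R M Y" "v'' \<in> power_torsion R M (insert x Y)"
    "v = x \<odot>\<^bsub>M\<^esub> v' \<oplus>\<^bsub>M\<^esub> v''"
proof -
  have YR: "Y \<subseteq> carrier R" and xR: "x \<in> carrier R" using X Y x by auto
  note G = submodule_power_torsion[OF YR]
  have vM: "v \<in> carrier M" using v submodule_carrier[OF G] by blast
  obtain p :: nat where "\<And>y. y \<in> Y \<Longrightarrow> (y [^] p) \<odot>\<^bsub>M\<^esub> v = \<zero>\<^bsub>M\<^esub>"
    using power_torsion_uniform[OF Y(1) YR v] by blast
  then obtain m :: nat and v' where v': "v' \<in> carrier M" "\<forall>y\<in>Y. (y [^] p) \<odot>\<^bsub>M\<^esub> v' = \<zero>\<^bsub>M\<^esub>"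
    "(x [^] Suc m) \<odot>\<^bsub>M\<^esub> v' = (x [^] m) \<odot>\<^bsub>M\<^esub> v"
    using div[unfolded torsion_divisible_def, rule_format, OF Y(2) x vM, of p] by blast
  have v'G: "v' \<in> power_torsion R M Y" using v' by (auto simp: power_torsion_def)
  let ?w = "v \<ominus>\<^bsub>M\<^esub> x \<odot>\<^bsub>M\<^esub> v'"
  have wG: "?w \<in> power_torsion R M Y"
    using v v'G xR by (intro submodule_diff[OF G] submodule_smult[OF G])
  have "(x [^] m) \<odot>\<^bsub>M\<^esub> ?w = (x [^] m) \<odot>\<^bsub>M\<^esub> v \<ominus>\<^bsub>M\<^esub> (x [^] Suc m) \<odot>\<^bsub>M\<^esub> v'"
    using xR vM v' by (simp add: a_minus_def smult_r_distr smult_r_minus smult_assoc1)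
  also have "\<dots> = \<zero>\<^bsub>M\<^esub>" using v'(3) xR vM by (simp add: a_minus_def M.r_neg)
  finally have "?w \<in> power_torsion R M (insert x Y)"
    using wG by (auto simp: power_torsion_def)
  moreover have "v = x \<odot>\<^bsub>M\<^esub> v' \<oplus>\<^bsub>M\<^esub> ?w"
    using vM v' xR by (simp add: a_minus_def M.a_ac M.r_neg2 M.r_neg1 M.r_neg M.a_lcomm[of _ v])
  ultimately show ?thesis using that v'G by blast
qed

end

context differential_module
begin

lemmas d_closed = linear_mapD(1)[OF linear]
  and d_add = linear_mapD(2)[OF linear]
  and d_smult = linear_mapD(3)[OF linear]
  and d_zero = linear_map_zero_minus(1)[OF module_axioms module_axioms linear]
  and d_minus = linear_map_zero_minus(2)[OF module_axioms module_axioms linear]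
  and submodule_d_image = submodule_image[OF module_axioms module_axioms linear]

lemma d_diff: "x \<in> carrier M \<Longrightarrow> y \<in> carrier M \<Longrightarrow> \<delta> (x \<ominus>\<^bsub>M\<^esub> y) = \<delta> x \<ominus>\<^bsub>M\<^esub> \<delta> y"
  by (simp add: a_minus_def d_add d_minus)

lemma submodule_cycles: "submodule (cycles M \<delta>) R M"
  by (rule submoduleI_smult) (auto simp: cycles_def d_add d_smult d_zero)

lemma d_power_torsion:
  assumes "Y \<subseteq> carrier R" "u \<in> power_torsion R M Y"
  shows "\<delta> u \<in> power_torsion R M Y"
proof -
  have u: "u \<in> carrier M" using assms(2) by (auto simp: power_torsion_def)
  have "(y [^] p) \<odot>\<^bsub>M\<^esub> \<delta> u = \<delta> ((y [^] p) \<odot>\<^bsub>M\<^esub> u)" if "y \<in> Y" for y and p :: nat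
    using that assms(1) u by (subst d_smult) auto
  then have "(y [^] p) \<odot>\<^bsub>M\<^esub> \<delta> u = \<zero>\<^bsub>M\<^esub>" if "y \<in> Y" "(y [^] p) \<odot>\<^bsub>M\<^esub> u = \<zero>\<^bsub>M\<^esub>" for y and p :: nat
    using that d_zero by simp
  then show ?thesis
    using assms(2) u d_closed unfolding power_torsion_def by blast
qed

end

text \<open>Sequences are in bijection with pairs of sequences. This keeps iterated cones inside one type, so
  that an induction on the number of cones is possible.\<close>
definition evens :: "(nat \<Rightarrow> 'e) \<Rightarrow> nat \<Rightarrow> 'e" where "evens f = (\<lambda>n. f (2 * n))"
definition odds :: "(nat \<Rightarrow> 'e) \<Rightarrow> nat \<Rightarrow> 'e" where "odds f = (\<lambda>n. f (2 * n + 1))"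
definition interleave :: "(nat \<Rightarrow> 'e) \<Rightarrow> (nat \<Rightarrow> 'e) \<Rightarrow> nat \<Rightarrow> 'e" where
  "interleave f g = (\<lambda>n. if even n then f (n div 2) else g (n div 2))"

lemma interleave_simps [simp]:
  "evens (interleave f g) = f" "odds (interleave f g) = g" "interleave (evens h) (odds h) = h"
  by (auto simp: evens_def odds_def interleave_def fun_eq_iff)

lemma interleave_eq_iff [simp]: "interleave f g = interleave f' g' \<longleftrightarrow> f = f' \<and> g = g'"
  by (metis interleave_simps(1,2))

lemma interleave_eqI: "evens v = evens w \<Longrightarrow> odds v = odds w \<Longrightarrow> v = w"
  by (metis interleave_simps(3))

definition pair_module :: "('a, nat \<Rightarrow> 'e, 'd) module_scheme \<Rightarrow> ('a, nat \<Rightarrow> 'e) module" where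
  "pair_module M =
     \<lparr>carrier = {w. evens w \<in> carrier M \<and> odds w \<in> carrier M}, monoid.mult = undefined, one = undefined,
      zero = interleave \<zero>\<^bsub>M\<^esub> \<zero>\<^bsub>M\<^esub>,
      add = (\<lambda>v w. interleave (evens v \<oplus>\<^bsub>M\<^esub> evens w) (odds v \<oplus>\<^bsub>M\<^esub> odds w)),
      smult = (\<lambda>a w. interleave (a \<odot>\<^bsub>M\<^esub> evens w) (a \<odot>\<^bsub>M\<^esub> odds w))\<rparr>"

text \<open>The map \<open>(u, v) \<mapsto> (\<delta> u, x u - \<delta> v)\<close>.\<close>
definition koszul_diff ::
  "('a, nat \<Rightarrow> 'e, 'd) module_scheme \<Rightarrow> 'a \<Rightarrow> ((nat \<Rightarrow> 'e) \<Rightarrow> nat \<Rightarrow> 'e) \<Rightarrow> (nat \<Rightarrow> 'e) \<Rightarrow> nat \<Rightarrow> 'e" where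
  "koszul_diff M x \<delta> w = interleave (\<delta> (evens w)) (x \<odot>\<^bsub>M\<^esub> evens w \<ominus>\<^bsub>M\<^esub> \<delta> (odds w))"

lemma pair_module_simps [simp]:
  "w \<in> carrier (pair_module M) \<longleftrightarrow> evens w \<in> carrier M \<and> odds w \<in> carrier M"
  "\<zero>\<^bsub>pair_module M\<^esub> = interleave \<zero>\<^bsub>M\<^esub> \<zero>\<^bsub>M\<^esub>"
  "v \<oplus>\<^bsub>pair_module M\<^esub> w = interleave (evens v \<oplus>\<^bsub>M\<^esub> evens w) (odds v \<oplus>\<^bsub>M\<^esub> odds w)"
  "a \<odot>\<^bsub>pair_module M\<^esub> w = interleave (a \<odot>\<^bsub>M\<^esub> evens w) (a \<odot>\<^bsub>M\<^esub> odds w)"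
  by (simp_all add: pair_module_def)

lemma koszul_diff_simps [simp]:
  "evens (koszul_diff M x \<delta> w) = \<delta> (evens w)"
  "odds (koszul_diff M x \<delta> w) = x \<odot>\<^bsub>M\<^esub> evens w \<ominus>\<^bsub>M\<^esub> \<delta> (odds w)"
  by (simp_all add: koszul_diff_def)

lemma pair_module_is_module:
  fixes R (structure) and M (structure)
  assumes "module R M"
  shows "module R (pair_module M)"
proof -
  interpret module R M by fact
  have "abelian_group (pair_module M)"
  proof (rule abelian_groupI)
    fix w assume w: "w \<in> carrier (pair_module M)"
    then show "\<exists>v\<in>carrier (pair_module M). v \<oplus>\<^bsub>pair_module M\<^esub> w = \<zero>\<^bsub>pair_module M\<^esub>"
      by (intro bexI[of _ "interleave (\<ominus>\<^bsub>M\<^esub> evens w) (\<ominus>\<^bsub>M\<^esub> odds w)"]) (auto simp: M.l_neg)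
  qed (auto simp: M.a_ac)
  then show ?thesis
    by (intro moduleI R.is_cring)
       (auto simp: smult_l_distr smult_r_distr smult_assoc1)
qed

locale koszul_cone = differential_module R M \<delta> for R :: "('a, 'c) ring_scheme" (structure)
    and M :: "('a, nat \<Rightarrow> 'e, 'd) module_scheme" (structure) and \<delta> +
  fixes x :: 'a
  assumes x_carrier: "x \<in> carrier R"
begin

abbreviation "P \<equiv> pair_module M"
abbreviation "\<delta>' \<equiv> koszul_diff M x \<delta>"

sublocale P: differential_module R P \<delta>'
proof -
  interpret P: module R P by (rule pair_module_is_module[OF module_axioms])
  show "differential_module R P \<delta>'"
  proof
    show "linear_map R P P \<delta>'"
      unfolding linear_map_def
    proof (intro ballI conjI)
      fix v w assume *: "v \<in> carrier P" "w \<in> carrier P"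
      show "\<delta>' (v \<oplus>\<^bsub>P\<^esub> w) = \<delta>' v \<oplus>\<^bsub>P\<^esub> \<delta>' w"
        by (rule interleave_eqI)
           (use * x_carrier in \<open>auto simp: d_add d_closed smult_r_distr a_minus_def M.minus_add M.a_ac\<close>)
    next
      fix a w assume *: "a \<in> carrier R" "w \<in> carrier P"
      show "\<delta>' (a \<odot>\<^bsub>P\<^esub> w) = a \<odot>\<^bsub>P\<^esub> \<delta>' w"
        by (rule interleave_eqI)
           (use * x_carrier in \<open>auto simp: d_smult d_closed smult_r_distr smult_r_minus a_minus_def
              smult_commute[of x a]\<close>)
    qed (use x_carrier d_closed in auto)
    fix w assume *: "w \<in> carrier P"
    show "\<delta>' (\<delta>' w) = \<zero>\<^bsub>P\<^esub>"
      by (rule interleave_eqI)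
         (use * x_carrier in \<open>auto simp: d_d d_add d_minus d_smult d_closed a_minus_def M.r_neg neg_zero\<close>)
  qed
qed

lemma P_minus: "w \<in> carrier P \<Longrightarrow> \<ominus>\<^bsub>P\<^esub> w = interleave (\<ominus>\<^bsub>M\<^esub> evens w) (\<ominus>\<^bsub>M\<^esub> odds w)"
  by (rule P.M.minus_equality) (auto simp: M.l_neg)

lemma P_diff: "v \<in> carrier P \<Longrightarrow> w \<in> carrier P \<Longrightarrow>
    v \<ominus>\<^bsub>P\<^esub> w = interleave (evens v \<ominus>\<^bsub>M\<^esub> evens w) (odds v \<ominus>\<^bsub>M\<^esub> odds w)"
  by (simp add: a_minus_def P_minus)

lemma diff_eq_zero_iff:
  assumes "u \<in> carrier M" "v \<in> carrier M"
  shows "u \<ominus>\<^bsub>M\<^esub> v = \<zero>\<^bsub>M\<^esub> \<longleftrightarrow> u = v"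
proof
  assume "u \<ominus>\<^bsub>M\<^esub> v = \<zero>\<^bsub>M\<^esub>"
  then have "u \<ominus>\<^bsub>M\<^esub> v \<oplus>\<^bsub>M\<^esub> v = v" using assms by simp
  then show "u = v" using assms by (simp add: a_minus_def M.a_assoc M.l_neg)
qed (use assms in \<open>simp add: a_minus_def M.r_neg\<close>)

lemma cycles_P: "w \<in> cycles P \<delta>' \<longleftrightarrow>
    evens w \<in> cycles M \<delta> \<and> odds w \<in> carrier M \<and> x \<odot>\<^bsub>M\<^esub> evens w = \<delta> (odds w)"
proof (cases "evens w \<in> carrier M \<and> odds w \<in> carrier M")
  case True
  then have "x \<odot>\<^bsub>M\<^esub> evens w \<ominus>\<^bsub>M\<^esub> \<delta> (odds w) = \<zero>\<^bsub>M\<^esub> \<longleftrightarrow> x \<odot>\<^bsub>M\<^esub> evens w = \<delta> (odds w)"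
    using x_carrier d_closed by (intro diff_eq_zero_iff) auto
  then show ?thesis using True by (auto simp: cycles_def koszul_diff_def)
qed (auto simp: cycles_def)

lemma power_torsion_P:
  assumes "Y \<subseteq> carrier R"
  shows "w \<in> power_torsion R P Y \<longleftrightarrow> evens w \<in> power_torsion R M Y \<and> odds w \<in> power_torsion R M Y"
proof
  assume "w \<in> power_torsion R P Y"
  then show "evens w \<in> power_torsion R M Y \<and> odds w \<in> power_torsion R M Y"
    by (fastforce simp: power_torsion_def)
next
  assume *: "evens w \<in> power_torsion R M Y \<and> odds w \<in> power_torsion R M Y"
  have "\<exists>p::nat. (y [^] p) \<odot>\<^bsub>P\<^esub> w = \<zero>\<^bsub>P\<^esub>" if "y \<in> Y" for y
  proof -
    obtain p q :: nat where "(y [^] p) \<odot>\<^bsub>M\<^esub> evens w = \<zero>\<^bsub>M\<^esub>" "(y [^] q) \<odot>\<^bsub>M\<^esub> odds w = \<zero>\<^bsub>M\<^esub>"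
      using * \<open>y \<in> Y\<close> unfolding power_torsion_def by blast
    then have "(y [^] max p q) \<odot>\<^bsub>M\<^esub> evens w = \<zero>\<^bsub>M\<^esub>" "(y [^] max p q) \<odot>\<^bsub>M\<^esub> odds w = \<zero>\<^bsub>M\<^esub>"
      using pow_smult_zero_mono[of y "evens w" p "max p q"] pow_smult_zero_mono[of y "odds w" q "max p q"]
        * that assms by (auto simp: power_torsion_def)
    then show ?thesis by (intro exI[of _ "max p q"]) auto
  qed
  then show "w \<in> power_torsion R P Y" using * by (auto simp: power_torsion_def)
qed

lemma torsion_divisible_P:
  assumes X: "X \<subseteq> carrier R" and div: "torsion_divisible R M X"
  shows "torsion_divisible R P X"
  unfolding torsion_divisible_def
proof (intro allI ballI impI)
  fix Y y and p :: nat and e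
  assume Y: "Y \<subseteq> X" "y \<in> X" and e: "e \<in> carrier P" "\<forall>y\<in>Y. (y [^] p) \<odot>\<^bsub>P\<^esub> e = \<zero>\<^bsub>P\<^esub>"
  note D = div[unfolded torsion_divisible_def, rule_format, OF Y]
  obtain m u where u: "u \<in> carrier M" "\<forall>y\<in>Y. (y [^] p) \<odot>\<^bsub>M\<^esub> u = \<zero>\<^bsub>M\<^esub>"
    "(y [^] Suc m) \<odot>\<^bsub>M\<^esub> u = (y [^] m) \<odot>\<^bsub>M\<^esub> evens e"
    using D[of "evens e" p] e by auto
  obtain n v where v: "v \<in> carrier M" "\<forall>y\<in>Y. (y [^] p) \<odot>\<^bsub>M\<^esub> v = \<zero>\<^bsub>M\<^esub>"
    "(y [^] Suc n) \<odot>\<^bsub>M\<^esub> v = (y [^] n) \<odot>\<^bsub>M\<^esub> odds e"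
    using D[of "odds e" p] e by auto
  have y: "y \<in> carrier R" using Y X by blast
  have raise: "(y [^] Suc (k + m)) \<odot>\<^bsub>M\<^esub> u = (y [^] (k + m)) \<odot>\<^bsub>M\<^esub> e"
    if "(y [^] Suc m) \<odot>\<^bsub>M\<^esub> u = (y [^] m) \<odot>\<^bsub>M\<^esub> e" "u \<in> carrier M" "e \<in> carrier M" for k m :: nat and u e
    using that pow_add_smult[OF y, of u k "Suc m"] pow_add_smult[OF y, of e k m] by simp
  show "\<exists>m::nat. \<exists>e'\<in>carrier P. (\<forall>y\<in>Y. (y [^] p) \<odot>\<^bsub>P\<^esub> e' = \<zero>\<^bsub>P\<^esub>) \<and>
      (y [^] Suc m) \<odot>\<^bsub>P\<^esub> e' = (y [^] m) \<odot>\<^bsub>P\<^esub> e"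
  proof (intro exI[of _ "n + m"] bexI[of _ "interleave u v"] conjI)
    show "(y [^] Suc (n + m)) \<odot>\<^bsub>P\<^esub> interleave u v = (y [^] (n + m)) \<odot>\<^bsub>P\<^esub> e"
      using raise[OF u(3), of n] raise[OF v(3), of m] u v e by (simp add: add.commute)
  qed (use u v in auto)
qed

text \<open>The exact sequence \<open>H(M) \<rightarrow> H(K(x; M)) \<rightarrow> H(M)\<close>, on the level of submodules: \<open>L\<close> is recorded by
  its image under the first projection and by the elements \<open>v\<close> with \<open>(0, v) \<in> L\<close>.\<close>
lemma acc_cohomology_P:
  assumes "acc (intermediate R M (\<delta> ` carrier M) (cycles M \<delta>))" (is "acc ?A")
  shows "acc (intermediate R P (\<delta>' ` carrier P) (cycles P \<delta>'))" (is "acc ?B")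
proof (rule strictly_wf_by_two_maps[OF assms assms,
      where f = "\<lambda>L. evens ` L" and g = "\<lambda>L. {v \<in> carrier M. interleave \<zero>\<^bsub>M\<^esub> v \<in> L}"])
  fix L assume "L \<in> ?B"
  note L = P.intermediateD[OF this]
  show "evens ` L \<in> ?A"
  proof (rule intermediateI)
    show "submodule (evens ` L) R M"
      by (rule submodule_image[OF P.module_axioms module_axioms _ L(1)]) (auto simp: linear_map_def)
    fix b assume "b \<in> \<delta> ` carrier M"
    then obtain u where "u \<in> carrier M" "b = \<delta> u" by auto
    moreover from this have "\<delta>' (interleave u \<zero>\<^bsub>M\<^esub>) \<in> L" using L(2) by auto
    ultimately show "b \<in> evens ` L" by (intro image_eqI[of _ _ "\<delta>' (interleave u \<zero>\<^bsub>M\<^esub>)"]) auto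
  next
    fix u assume "u \<in> evens ` L"
    then show "u \<in> cycles M \<delta>" using L(3) cycles_P by blast
  qed
  show "{v \<in> carrier M. interleave \<zero>\<^bsub>M\<^esub> v \<in> L} \<in> ?A"
  proof (rule intermediateI)
    show "submodule {v \<in> carrier M. interleave \<zero>\<^bsub>M\<^esub> v \<in> L} R M"
      by (rule submodule_preimage[OF module_axioms P.module_axioms _ L(1)]) (auto simp: linear_map_def)
    fix b assume "b \<in> \<delta> ` carrier M"
    then obtain u where u: "u \<in> carrier M" "b = \<delta> u" by auto
    then have "\<delta>' (interleave \<zero>\<^bsub>M\<^esub> (\<ominus>\<^bsub>M\<^esub> u)) \<in> L" using L(2) by auto
    then show "b \<in> {v \<in> carrier M. interleave \<zero>\<^bsub>M\<^esub> v \<in> L}"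
      using u x_carrier by (simp add: koszul_diff_def d_zero d_minus d_closed a_minus_def)
  next
    fix u assume "u \<in> {v \<in> carrier M. interleave \<zero>\<^bsub>M\<^esub> v \<in> L}"
    then have "interleave \<zero>\<^bsub>M\<^esub> u \<in> cycles P \<delta>'" "u \<in> carrier M" using L(3) by auto
    then show "u \<in> cycles M \<delta>" using x_carrier unfolding cycles_P by (simp add: cycles_def)
  qed
next
  fix X Y assume XY: "X \<in> ?B" "Y \<in> ?B" "Y \<subseteq> X" "evens ` X = evens ` Y"
    "{v \<in> carrier M. interleave \<zero>\<^bsub>M\<^esub> v \<in> X} = {v \<in> carrier M. interleave \<zero>\<^bsub>M\<^esub> v \<in> Y}"
  note X = P.intermediateD[OF XY(1)] and Y = P.intermediateD[OF XY(2)]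
  have "X \<subseteq> Y"
  proof
    fix w assume w: "w \<in> X"
    then obtain v where v: "v \<in> Y" "evens w = evens v" using XY(4) by blast
    have c: "w \<in> carrier P" "v \<in> carrier P"
      using w v X Y P.submodule_carrier by blast+
    have "w \<ominus>\<^bsub>P\<^esub> v \<in> X" using w v XY(3) P.submodule_diff[OF X(1)] by blast
    moreover have eq: "w \<ominus>\<^bsub>P\<^esub> v = interleave \<zero>\<^bsub>M\<^esub> (odds w \<ominus>\<^bsub>M\<^esub> odds v)"
      using c v(2) unfolding P_diff[OF c] by (simp add: a_minus_def M.r_neg)
    ultimately have "odds w \<ominus>\<^bsub>M\<^esub> odds v \<in> {v \<in> carrier M. interleave \<zero>\<^bsub>M\<^esub> v \<in> X}"
      using c by simp
    then have "w \<ominus>\<^bsub>P\<^esub> v \<in> Y" using XY(5) eq by simp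
    then show "w \<in> Y" using P.submodule_diff_cancel[OF Y(1) c(1) v(1)] by blast
  qed
  then show "X = Y" using XY(3) by blast
qed auto

text \<open>For a cycle \<open>(u, v)\<close> one has \<open>\<delta> u = 0\<close> and \<open>x u = \<delta> v\<close>, so \<open>x (u, v) = (\<delta> v, x v)\<close> is the
  boundary of \<open>(v, 0)\<close>.\<close>
lemma x_kills_cohomology_P:
  assumes "w \<in> cycles P \<delta>'"
  shows "x \<odot>\<^bsub>P\<^esub> w \<in> \<delta>' ` carrier P"
proof (rule image_eqI)
  show "x \<odot>\<^bsub>P\<^esub> w = \<delta>' (interleave (odds w) \<zero>\<^bsub>M\<^esub>)"
    by (rule interleave_eqI) (use assms[unfolded cycles_P] x_carrier in \<open>auto simp: d_zero a_minus_def\<close>)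
qed (use assms cycles_P in auto)

text \<open>If \<open>y\<^sup>p u = \<delta> a\<close>, then \<open>y\<^sup>p (u, v)\<close> is homologous to \<open>(0, y\<^sup>p v - x a)\<close>, whose second entry is a
  cycle and therefore becomes a boundary after multiplication by a further power of \<open>y\<close>.\<close>
lemma torsion_cohomology_P:
  assumes y: "y \<in> carrier R"
    and tors: "\<And>z. z \<in> cycles M \<delta> \<Longrightarrow> \<exists>p::nat. (y [^] p) \<odot>\<^bsub>M\<^esub> z \<in> \<delta> ` carrier M"
    and w: "w \<in> cycles P \<delta>'"
  shows "\<exists>p::nat. (y [^] p) \<odot>\<^bsub>P\<^esub> w \<in> \<delta>' ` carrier P"
proof -
  define u where "u = evens w" define v where "v = odds w"
  have u: "u \<in> cycles M \<delta>" and v: "v \<in> carrier M" and uv: "x \<odot>\<^bsub>M\<^esub> u = \<delta> v"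
    using w unfolding cycles_P u_def v_def by auto
  have uM: "u \<in> carrier M" using u by (simp add: cycles_def)
  obtain p :: nat and a where a: "a \<in> carrier M" "(y [^] p) \<odot>\<^bsub>M\<^esub> u = \<delta> a" using tors[OF u] by auto
  let ?c = "(y [^] p) \<odot>\<^bsub>M\<^esub> v \<ominus>\<^bsub>M\<^esub> x \<odot>\<^bsub>M\<^esub> a"
  have "\<delta> ?c = (y [^] p) \<odot>\<^bsub>M\<^esub> (x \<odot>\<^bsub>M\<^esub> u) \<ominus>\<^bsub>M\<^esub> x \<odot>\<^bsub>M\<^esub> ((y [^] p) \<odot>\<^bsub>M\<^esub> u)"
    using x_carrier y v a uv by (simp add: d_diff d_smult)
  also have "\<dots> = \<zero>\<^bsub>M\<^esub>" using x_carrier y uM by (simp add: smult_commute[of x] a_minus_def M.r_neg)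
  finally have "?c \<in> cycles M \<delta>" using x_carrier y v a by (simp add: cycles_def)
  then obtain q :: nat and b where b: "b \<in> carrier M" "(y [^] q) \<odot>\<^bsub>M\<^esub> ?c = \<delta> b" using tors by blast
  have "(y [^] (q + p)) \<odot>\<^bsub>P\<^esub> w = \<delta>' (interleave ((y [^] q) \<odot>\<^bsub>M\<^esub> a) (\<ominus>\<^bsub>M\<^esub> b))"
  proof (rule interleave_eqI)
    show "evens ((y [^] (q + p)) \<odot>\<^bsub>P\<^esub> w) = evens (\<delta>' (interleave ((y [^] q) \<odot>\<^bsub>M\<^esub> a) (\<ominus>\<^bsub>M\<^esub> b)))"
      using a y uM by (simp add: pow_add_smult d_smult u_def)
    have "odds (\<delta>' (interleave ((y [^] q) \<odot>\<^bsub>M\<^esub> a) (\<ominus>\<^bsub>M\<^esub> b))) = (y [^] q) \<odot>\<^bsub>M\<^esub> (x \<odot>\<^bsub>M\<^esub> a) \<oplus>\<^bsub>M\<^esub> (y [^] q) \<odot>\<^bsub>M\<^esub> ?c"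
      using b a y x_carrier v by (simp add: d_minus a_minus_def d_closed smult_commute[of x])
    also have "\<dots> = (y [^] q) \<odot>\<^bsub>M\<^esub> (x \<odot>\<^bsub>M\<^esub> a \<oplus>\<^bsub>M\<^esub> ?c)"
      using a y x_carrier v by (simp add: smult_r_distr)
    also have "x \<odot>\<^bsub>M\<^esub> a \<oplus>\<^bsub>M\<^esub> ?c = (y [^] p) \<odot>\<^bsub>M\<^esub> v"
      using a y x_carrier v by (simp add: a_minus_def M.a_lcomm[of "x \<odot>\<^bsub>M\<^esub> a"] M.r_neg)
    finally show "odds ((y [^] (q + p)) \<odot>\<^bsub>P\<^esub> w) = odds (\<delta>' (interleave ((y [^] q) \<odot>\<^bsub>M\<^esub> a) (\<ominus>\<^bsub>M\<^esub> b)))"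
      using v y by (simp add: pow_add_smult v_def)
  qed
  then show ?thesis using a b y by (intro exI[of _ "q + p"] image_eqI) auto
qed

text \<open>Let \<open>G\<close> and \<open>T\<close> be the torsion submodules with respect to \<open>Y\<close> and to \<open>Y\<close> together with \<open>x\<close>. By
  \<open>dcc_of_dcc_socle\<close> it suffices to treat the classes in \<open>H(T)\<close> killed by \<open>x\<close>. Such a class is
  represented by \<open>z\<close> with \<open>x z = \<delta> t\<close> for some \<open>t \<in> T\<close>, so \<open>(z, t)\<close> is a cycle of \<open>K(x; G)\<close>. This
  assigns to a submodule \<open>L\<close> of these classes a submodule \<open>F L\<close> of the cohomology of \<open>K(x; G)\<close>, and
  divisibility shows that \<open>F L\<close> determines \<open>L\<close>.\<close>
lemma dcc_torsion_step:
  assumes X: "X \<subseteq> carrier R" and div: "torsion_divisible R M X"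
    and Y: "finite Y" "Y \<subseteq> X" and x: "x \<in> X"
    and dcc: "dcc (intermediate R P (\<delta>' ` power_torsion R P Y) (cycles P \<delta>' \<inter> power_torsion R P Y))"
      (is "dcc ?B")
  shows "dcc (intermediate R M (\<delta> ` power_torsion R M (insert x Y)) (cycles M \<delta> \<inter> power_torsion R M (insert x Y)))"
proof -
  define G T where "G = power_torsion R M Y" and "T = power_torsion R M (insert x Y)"
  have YR: "Y \<subseteq> carrier R" "insert x Y \<subseteq> carrier R" using X Y x by auto
  note G = submodule_power_torsion[OF YR(1), folded G_def]
  note T = submodule_power_torsion[OF YR(2), folded T_def]
  note Gr = submodule_rules[OF G] and Tr = submodule_rules[OF T]
  have TG: "T \<subseteq> G" unfolding T_def G_def power_torsion_def by auto
  have dG: "u \<in> G \<Longrightarrow> \<delta> u \<in> G" for u unfolding G_def by (rule d_power_torsion[OF YR(1)])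
  have dT: "u \<in> T \<Longrightarrow> \<delta> u \<in> T" for u unfolding T_def by (rule d_power_torsion[OF YR(2)])
  have PG: "w \<in> power_torsion R P Y \<longleftrightarrow> evens w \<in> G \<and> odds w \<in> G" for w
    unfolding G_def by (rule power_torsion_P[OF YR(1)])
  note PGsub = P.submodule_power_torsion[OF YR(1)]
  note B = submodule_d_image[OF T]
  have Z: "submodule (cycles M \<delta> \<inter> T) R M" by (rule submodule_Int[OF submodule_cycles T])
  have BZ: "\<delta> ` T \<subseteq> cycles M \<delta> \<inter> T" using dT Tr d_closed d_d by (auto simp: cycles_def)
  define S where "S = {v \<in> cycles M \<delta> \<inter> T. x \<odot>\<^bsub>M\<^esub> v \<in> \<delta> ` T}"
  define F where "F L = {w. \<exists>z\<in>L. \<exists>t\<in>T. \<exists>u\<in>G. \<exists>v\<in>G. x \<odot>\<^bsub>M\<^esub> z = \<delta> t \<and>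
      evens w = z \<oplus>\<^bsub>M\<^esub> \<delta> u \<and> odds w = t \<oplus>\<^bsub>M\<^esub> (x \<odot>\<^bsub>M\<^esub> u \<ominus>\<^bsub>M\<^esub> \<delta> v)}" for L
  have "dcc (intermediate R M (\<delta> ` T) S)"
  proof (rule strictly_wf_by_map[OF dcc, where f = F])
    fix L assume "L \<in> intermediate R M (\<delta> ` T) S"
    note L = intermediateD[OF this]
    note Lr = submodule_rules[OF L(1)]
    have LS: "z \<in> L \<Longrightarrow> z \<in> carrier M \<and> \<delta> z = \<zero>\<^bsub>M\<^esub> \<and> z \<in> T" for z
      using L(3) unfolding S_def cycles_def by auto
    show "F L \<in> ?B"
    proof (rule P.intermediateI)
      show "submodule (F L) R P"
      proof (rule P.submoduleI_smult)
        show "F L \<subseteq> carrier P" unfolding F_def using Lr Tr Gr d_closed x_carrier by auto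
        show "\<zero>\<^bsub>P\<^esub> \<in> F L"
          unfolding F_def using Lr(2) Tr(2) Gr(2) x_carrier d_zero
          by (auto simp: a_minus_def neg_zero intro!: bexI[of _ "\<zero>\<^bsub>M\<^esub>"])
      next
        fix w w' assume "w \<in> F L" "w' \<in> F L"
        then obtain z t u v z' t' u' v' where *: "z \<in> L" "t \<in> T" "u \<in> G" "v \<in> G"
          "z' \<in> L" "t' \<in> T" "u' \<in> G" "v' \<in> G"
          and eq: "x \<odot>\<^bsub>M\<^esub> z = \<delta> t" "evens w = z \<oplus>\<^bsub>M\<^esub> \<delta> u" "odds w = t \<oplus>\<^bsub>M\<^esub> (x \<odot>\<^bsub>M\<^esub> u \<ominus>\<^bsub>M\<^esub> \<delta> v)"
           "x \<odot>\<^bsub>M\<^esub> z' = \<delta> t'" "evens w' = z' \<oplus>\<^bsub>M\<^esub> \<delta> u'" "odds w' = t' \<oplus>\<^bsub>M\<^esub> (x \<odot>\<^bsub>M\<^esub> u' \<ominus>\<^bsub>M\<^esub> \<delta> v')"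
          unfolding F_def by blast
        have c: "z \<in> carrier M" "t \<in> carrier M" "u \<in> carrier M" "v \<in> carrier M"
          "z' \<in> carrier M" "t' \<in> carrier M" "u' \<in> carrier M" "v' \<in> carrier M"
          using * Lr(1) Tr(1) Gr(1) by auto
        have "x \<odot>\<^bsub>M\<^esub> (z \<oplus>\<^bsub>M\<^esub> z') = \<delta> (t \<oplus>\<^bsub>M\<^esub> t')"
          using eq c x_carrier by (simp add: smult_r_distr d_add)
        moreover have "evens (w \<oplus>\<^bsub>P\<^esub> w') = (z \<oplus>\<^bsub>M\<^esub> z') \<oplus>\<^bsub>M\<^esub> \<delta> (u \<oplus>\<^bsub>M\<^esub> u')"
          using eq c d_closed by (simp add: d_add M.a_ac)
        moreover have "odds (w \<oplus>\<^bsub>P\<^esub> w') = (t \<oplus>\<^bsub>M\<^esub> t') \<oplus>\<^bsub>M\<^esub> (x \<odot>\<^bsub>M\<^esub> (u \<oplus>\<^bsub>M\<^esub> u') \<ominus>\<^bsub>M\<^esub> \<delta> (v \<oplus>\<^bsub>M\<^esub> v'))"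
          using eq c d_closed x_carrier
          by (simp add: d_add M.a_ac a_minus_def M.minus_add smult_r_distr)
        ultimately show "w \<oplus>\<^bsub>P\<^esub> w' \<in> F L"
          unfolding F_def using Lr(3)[OF *(1,5)] Tr(3)[OF *(2,6)] Gr(3)[OF *(3,7)] Gr(3)[OF *(4,8)]
          by blast
      next
        fix a w assume a: "a \<in> carrier R" and "w \<in> F L"
        then obtain z t u v where *: "z \<in> L" "t \<in> T" "u \<in> G" "v \<in> G"
          and eq: "x \<odot>\<^bsub>M\<^esub> z = \<delta> t" "evens w = z \<oplus>\<^bsub>M\<^esub> \<delta> u" "odds w = t \<oplus>\<^bsub>M\<^esub> (x \<odot>\<^bsub>M\<^esub> u \<ominus>\<^bsub>M\<^esub> \<delta> v)"
          unfolding F_def by blast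
        have c: "z \<in> carrier M" "t \<in> carrier M" "u \<in> carrier M" "v \<in> carrier M"
          using * Lr(1) Tr(1) Gr(1) by auto
        have "x \<odot>\<^bsub>M\<^esub> (a \<odot>\<^bsub>M\<^esub> z) = \<delta> (a \<odot>\<^bsub>M\<^esub> t)"
          using eq c x_carrier a by (simp add: smult_commute[of x] d_smult)
        moreover have "evens (a \<odot>\<^bsub>P\<^esub> w) = (a \<odot>\<^bsub>M\<^esub> z) \<oplus>\<^bsub>M\<^esub> \<delta> (a \<odot>\<^bsub>M\<^esub> u)"
          using eq c d_closed a by (simp add: d_smult smult_r_distr)
        moreover have "odds (a \<odot>\<^bsub>P\<^esub> w) = (a \<odot>\<^bsub>M\<^esub> t) \<oplus>\<^bsub>M\<^esub> (x \<odot>\<^bsub>M\<^esub> (a \<odot>\<^bsub>M\<^esub> u) \<ominus>\<^bsub>M\<^esub> \<delta> (a \<odot>\<^bsub>M\<^esub> v))"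
          using eq c d_closed x_carrier a
          by (simp add: d_smult a_minus_def smult_r_minus smult_r_distr smult_commute[of x])
        ultimately show "a \<odot>\<^bsub>P\<^esub> w \<in> F L"
          unfolding F_def using Lr(4)[OF a *(1)] Tr(4)[OF a *(2)] Gr(4)[OF a *(3)] Gr(4)[OF a *(4)]
          by blast
      qed
    next
      fix b assume "b \<in> \<delta>' ` power_torsion R P Y"
      then obtain w where w: "evens w \<in> G" "odds w \<in> G" "b = \<delta>' w" using PG by auto
      have "x \<odot>\<^bsub>M\<^esub> \<zero>\<^bsub>M\<^esub> = \<delta> \<zero>\<^bsub>M\<^esub>" "evens b = \<zero>\<^bsub>M\<^esub> \<oplus>\<^bsub>M\<^esub> \<delta> (evens w)"
        "odds b = \<zero>\<^bsub>M\<^esub> \<oplus>\<^bsub>M\<^esub> (x \<odot>\<^bsub>M\<^esub> evens w \<ominus>\<^bsub>M\<^esub> \<delta> (odds w))"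
        using w Gr(1) d_closed x_carrier d_zero by auto
      then show "b \<in> F L" unfolding F_def using w Lr(2) Tr(2) by blast
    next
      fix w assume "w \<in> F L"
      then obtain z t u v where *: "z \<in> L" "t \<in> T" "u \<in> G" "v \<in> G"
        and eq: "x \<odot>\<^bsub>M\<^esub> z = \<delta> t" "evens w = z \<oplus>\<^bsub>M\<^esub> \<delta> u" "odds w = t \<oplus>\<^bsub>M\<^esub> (x \<odot>\<^bsub>M\<^esub> u \<ominus>\<^bsub>M\<^esub> \<delta> v)"
        unfolding F_def by blast
      have c: "z \<in> carrier M" "t \<in> carrier M" "u \<in> carrier M" "v \<in> carrier M"
        using * Lr(1) Tr(1) Gr(1) by auto
      have "evens w \<in> G" "odds w \<in> G"
        unfolding eq using * TG LS[OF *(1)] dG x_carrier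
        by (auto intro!: Gr(3,4,6))
      moreover have "\<delta> (evens w) = \<zero>\<^bsub>M\<^esub>"
        using eq c d_closed LS[OF *(1)] by (simp add: d_add d_d)
      moreover have "x \<odot>\<^bsub>M\<^esub> evens w = \<delta> (odds w)"
        using eq c d_closed x_carrier by (simp add: d_add d_minus d_smult d_d a_minus_def smult_r_distr)
      ultimately show "w \<in> cycles P \<delta>' \<inter> power_torsion R P Y"
        using Gr(1) by (simp add: cycles_P PG) (simp add: cycles_def)
    qed
  next
    fix X Y :: "(nat \<Rightarrow> 'e) set" assume "X \<subseteq> Y"
    then show "F X \<subseteq> F Y" unfolding F_def by blast
  next
    fix K L assume KL: "K \<in> intermediate R M (\<delta> ` T) S" "L \<in> intermediate R M (\<delta> ` T) S" "K \<subseteq> L" "F K = F L"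
    note K = intermediateD[OF KL(1)] and L = intermediateD[OF KL(2)]
    have "L \<subseteq> K"
    proof
      fix z' assume z': "z' \<in> L"
      then obtain t' where t': "t' \<in> T" "x \<odot>\<^bsub>M\<^esub> z' = \<delta> t'" using L(3) unfolding S_def by auto
      have c': "z' \<in> carrier M" "t' \<in> carrier M" using z' t' L(1) submodule_carrier Tr(1) by auto
      have "interleave z' t' \<in> F L"
        unfolding F_def
        by (intro CollectI bexI[OF _ z'] bexI[OF _ t'(1)] bexI[OF _ Gr(2)])
           (use t'(2) c' x_carrier d_zero in \<open>simp add: a_minus_def neg_zero\<close>)
      then have "interleave z' t' \<in> F K" using KL(4) by simp
      then obtain z t u v where *: "z \<in> K" "t \<in> T" "u \<in> G" "v \<in> G"
        and eq: "z' = z \<oplus>\<^bsub>M\<^esub> \<delta> u" "t' = t \<oplus>\<^bsub>M\<^esub> (x \<odot>\<^bsub>M\<^esub> u \<ominus>\<^bsub>M\<^esub> \<delta> v)"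
        unfolding F_def by auto
      obtain v' v'' where v: "v' \<in> G" "v'' \<in> T" "v = x \<odot>\<^bsub>M\<^esub> v' \<oplus>\<^bsub>M\<^esub> v''"
        using power_torsion_split[OF X div Y x] *(4) unfolding G_def T_def by blast
      have c: "z \<in> carrier M" "t \<in> carrier M" "u \<in> carrier M" "v' \<in> carrier M" "v'' \<in> carrier M"
        using * v submodule_carrier[OF K(1)] Tr(1) Gr(1) by auto
      \<comment> \<open>\<open>u\<close> and \<open>s = u - \<delta> v'\<close> have the same differential. As \<open>x s\<close> differs from \<open>x u - \<delta> v\<close>, which
        lies in \<open>T\<close>, by \<open>\<delta> v''\<close>, the element \<open>s\<close> is \<open>x\<close>-torsion; so \<open>\<delta> u\<close> is a boundary in \<open>T\<close>.\<close>
      define s where "s = u \<ominus>\<^bsub>M\<^esub> \<delta> v'"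
      have sG: "s \<in> G" unfolding s_def by (rule Gr(6)[OF *(3) dG[OF v(1)]])
      have sM: "s \<in> carrier M" using sG Gr(1) by blast
      have "x \<odot>\<^bsub>M\<^esub> u \<ominus>\<^bsub>M\<^esub> \<delta> v = x \<odot>\<^bsub>M\<^esub> s \<ominus>\<^bsub>M\<^esub> \<delta> v''"
        using c x_carrier d_closed unfolding s_def v(3)
        by (simp add: d_add d_smult smult_r_distr smult_r_minus a_minus_def M.minus_add M.a_assoc)
      then have "x \<odot>\<^bsub>M\<^esub> s \<ominus>\<^bsub>M\<^esub> \<delta> v'' \<in> T"
        using eq(2) t'(1) *(2) submodule_add_cancel[OF T, of "x \<odot>\<^bsub>M\<^esub> s \<ominus>\<^bsub>M\<^esub> \<delta> v''" t] x_carrier sM c d_closed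
        by (simp add: M.a_comm)
      then have "x \<odot>\<^bsub>M\<^esub> s \<in> T"
        using submodule_diff_cancel[OF T] x_carrier sM dT[OF v(2)] by blast
      then obtain q :: nat where "(x [^] q) \<odot>\<^bsub>M\<^esub> (x \<odot>\<^bsub>M\<^esub> s) = \<zero>\<^bsub>M\<^esub>"
        unfolding T_def power_torsion_def by auto
      then have "(x [^] Suc q) \<odot>\<^bsub>M\<^esub> s = \<zero>\<^bsub>M\<^esub>" using x_carrier sM by (simp add: smult_assoc1)
      then have "s \<in> T"
        using sG unfolding T_def G_def power_torsion_def by blast
      then have "\<delta> s \<in> K" using K(2) by blast
      moreover have "\<delta> s = \<delta> u" unfolding s_def using c d_closed by (simp add: d_add d_minus d_d a_minus_def)
      ultimately show "z' \<in> K" using eq(1) *(1) submodule_add[OF K(1)] by simp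
    qed
    then show "K = L" using KL(3) by blast
  qed
  note socle = this
  show ?thesis
    unfolding T_def[symmetric]
  proof (rule dcc_of_dcc_socle[OF B Z BZ x_carrier _ socle[unfolded S_def]])
    fix v assume "v \<in> cycles M \<delta> \<inter> T"
    then obtain p :: nat where "(x [^] p) \<odot>\<^bsub>M\<^esub> v = \<zero>\<^bsub>M\<^esub>" unfolding T_def power_torsion_def by auto
    then show "\<exists>p::nat. (x [^] p) \<odot>\<^bsub>M\<^esub> v \<in> \<delta> ` T" using submodule_zero[OF B] by metis
  qed
qed

end

text \<open>By induction on \<open>Y\<close>, for all modules with a differential at once: the step for \<open>x\<close> applies the
  induction hypothesis to the cone over \<open>x\<close>, whose cohomology is still Noetherian and is torsion for
  \<open>x\<close> and for the elements of \<open>X - Y\<close>. When \<open>Y\<close> is empty, the cohomology is torsion for all of \<open>X\<close>.\<close>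
theorem dcc_torsion_cohomology:
  fixes R :: "('a, 'c) ring_scheme" and M :: "('a, nat \<Rightarrow> 'e) module"
  assumes X: "finite X" "X \<subseteq> carrier R" "maximalideal (Idl\<^bsub>R\<^esub> X) R"
    and Y: "finite Y" "Y \<subseteq> X"
    and M: "differential_module R M \<delta>" "torsion_divisible R M X"
    and acc: "acc (intermediate R M (\<delta> ` carrier M) (cycles M \<delta>))"
    and tors: "\<And>y z. y \<in> X - Y \<Longrightarrow> z \<in> cycles M \<delta> \<Longrightarrow>
      \<exists>p::nat. (y [^]\<^bsub>R\<^esub> p) \<odot>\<^bsub>M\<^esub> z \<in> \<delta> ` carrier M"
  shows "dcc (intermediate R M (\<delta> ` power_torsion R M Y) (cycles M \<delta> \<inter> power_torsion R M Y))"
  using Y M acc tors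
proof (induction Y arbitrary: M \<delta> rule: finite_induct)
  case empty
  interpret differential_module R M \<delta> by fact
  have "power_torsion R M {} = carrier M" by (auto simp: power_torsion_def)
  moreover have "cycles M \<delta> \<inter> carrier M = cycles M \<delta>" by (auto simp: cycles_def)
  moreover have "\<delta> ` carrier M \<subseteq> cycles M \<delta>" by (auto simp: cycles_def d_closed d_d)
  ultimately show ?case
    using dcc_of_acc_torsion[OF submodule_d_image[OF carrier_is_submodule] submodule_cycles _ empty.prems(4) X]
      empty.prems(5) by simp
next
  case (insert x Y)
  interpret differential_module R M \<delta> by fact
  interpret koszul_cone R M \<delta> x by unfold_locales (use insert.prems(1) X in auto)
  have "dcc (intermediate R P (\<delta>' ` power_torsion R P Y) (cycles P \<delta>' \<inter> power_torsion R P Y))"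
  proof (rule insert.IH)
    fix y z assume *: "y \<in> X - Y" "z \<in> cycles P \<delta>'"
    show "\<exists>p::nat. (y [^]\<^bsub>R\<^esub> p) \<odot>\<^bsub>P\<^esub> z \<in> \<delta>' ` carrier P"
    proof (cases "y = x")
      case True
      show ?thesis
        by (rule exI[of _ "Suc 0"])
           (use x_kills_cohomology_P[OF *(2)] x_carrier True in \<open>simp del: pair_module_simps\<close>)
    next
      case False
      then have "y \<in> X - insert x Y" "y \<in> carrier R" using * X by auto
      then show ?thesis using torsion_cohomology_P insert.prems(5) *(2) by blast
    qed
  qed (use insert.prems X P.differential_module_axioms torsion_divisible_P acc_cohomology_P in auto)
  then show ?case
    using dcc_torsion_step[OF X(2) insert.prems(3) insert.hyps(1)] insert.prems(1) by blast
qed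

section \<open>Homogeneous components\<close>

definition hcomp :: "('b, 'c) ring_scheme \<Rightarrow> ('i \<Rightarrow> 'b set) \<Rightarrow> 'b \<Rightarrow> 'i \<Rightarrow> 'b" where
  "hcomp G A x = (THE c. decomposes G A x c)"

definition homogeneous :: "('b, 'c) ring_scheme \<Rightarrow> ('i \<Rightarrow> 'b set) \<Rightarrow> 'b set \<Rightarrow> bool" where
  "homogeneous G A L \<longleftrightarrow> (\<forall>x\<in>L. \<forall>n. hcomp G A x n \<in> L)"

locale graded_group = abelian_group G for G :: "('b, 'c) ring_scheme" (structure) and A :: "'i \<Rightarrow> 'b set" +
  assumes direct_sum: "direct_sum G A"
begin

lemma part_subgroup: "additive_subgroup (A n) G"
  using direct_sum unfolding direct_sum_def by blast

lemma part_carrier: "x \<in> A n \<Longrightarrow> x \<in> carrier G"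
  using additive_subgroup.a_Hcarr[OF part_subgroup] .

lemma part_zero: "\<zero> \<in> A n"
  by (rule additive_subgroup.zero_closed[OF part_subgroup])

lemma part_add: "x \<in> A n \<Longrightarrow> y \<in> A n \<Longrightarrow> x \<oplus> y \<in> A n"
  by (rule additive_subgroup.a_closed[OF part_subgroup])

lemma part_minus: "x \<in> A n \<Longrightarrow> \<ominus> x \<in> A n"
  using subgroup.m_inv_closed[OF additive_subgroup.a_subgroup[OF part_subgroup]] by (simp add: a_inv_def)

lemma decomposes_hcomp: "x \<in> carrier G \<Longrightarrow> decomposes G A x (hcomp G A x)"
  using direct_sum unfolding direct_sum_def hcomp_def by (metis (mono_tags, lifting) theI')

lemma hcomp_unique: "x \<in> carrier G \<Longrightarrow> decomposes G A x c \<Longrightarrow> hcomp G A x = c"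
  using direct_sum decomposes_hcomp unfolding direct_sum_def by blast

lemma hcomp_part: "x \<in> carrier G \<Longrightarrow> hcomp G A x n \<in> A n"
  using decomposes_hcomp unfolding decomposes_def by blast

lemma hcomp_carrier: "x \<in> carrier G \<Longrightarrow> hcomp G A x n \<in> carrier G"
  using hcomp_part part_carrier by blast

lemma hcomp_finite: "x \<in> carrier G \<Longrightarrow> finite {n. hcomp G A x n \<noteq> \<zero>}"
  using decomposes_hcomp unfolding decomposes_def by blast

lemma decomposesI:
  assumes "\<And>n. c n \<in> A n" "finite F" "\<And>n. n \<notin> F \<Longrightarrow> c n = \<zero>" "x = (\<Oplus>n\<in>F. c n)"
  shows "decomposes G A x c"
proof -
  have "{n. c n \<noteq> \<zero>} \<subseteq> F" using assms(3) by auto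
  moreover from this have "(\<Oplus>n\<in>{n. c n \<noteq> \<zero>}. c n) = (\<Oplus>n\<in>F. c n)"
    using assms(1,2) part_carrier by (intro add.finprod_mono_neutral_cong_left) auto
  ultimately show ?thesis
    unfolding decomposes_def using assms finite_subset by auto
qed

lemma hcomp_sum:
  assumes "x \<in> carrier G" "finite F" "\<And>n. n \<notin> F \<Longrightarrow> hcomp G A x n = \<zero>"
  shows "x = (\<Oplus>n\<in>F. hcomp G A x n)"
proof -
  have "{n. hcomp G A x n \<noteq> \<zero>} \<subseteq> F" using assms(3) by auto
  then have "(\<Oplus>n\<in>{n. hcomp G A x n \<noteq> \<zero>}. hcomp G A x n) = (\<Oplus>n\<in>F. hcomp G A x n)"
    using assms(1,2) hcomp_carrier by (intro add.finprod_mono_neutral_cong_left) auto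
  then show ?thesis using decomposes_hcomp[OF assms(1)] unfolding decomposes_def by simp
qed

lemma hcomp_homogeneous:
  assumes "x \<in> A n"
  shows "hcomp G A x = (\<lambda>m. if m = n then x else \<zero>)"
  by (rule hcomp_unique[OF part_carrier[OF assms] decomposesI[of _ "{n}"]])
     (use assms part_zero part_carrier[OF assms] in auto)

lemma hcomp_zero: "hcomp G A \<zero> n = \<zero>"
  using hcomp_homogeneous[OF part_zero[of n]] by simp

lemma hcomp_add:
  assumes "x \<in> carrier G" "y \<in> carrier G"
  shows "hcomp G A (x \<oplus> y) n = hcomp G A x n \<oplus> hcomp G A y n"
proof -
  let ?F = "{n. hcomp G A x n \<noteq> \<zero>} \<union> {n. hcomp G A y n \<noteq> \<zero>}"
  have F: "finite ?F" using assms hcomp_finite by auto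
  have "x = (\<Oplus>n\<in>?F. hcomp G A x n)" by (rule hcomp_sum[OF assms(1) F]) auto
  moreover have "y = (\<Oplus>n\<in>?F. hcomp G A y n)" by (rule hcomp_sum[OF assms(2) F]) auto
  moreover have "(\<Oplus>n\<in>?F. hcomp G A x n \<oplus> hcomp G A y n) = (\<Oplus>n\<in>?F. hcomp G A x n) \<oplus> (\<Oplus>n\<in>?F. hcomp G A y n)"
    using assms hcomp_carrier by (intro add.finprod_multf) auto
  ultimately have eq: "x \<oplus> y = (\<Oplus>n\<in>?F. hcomp G A x n \<oplus> hcomp G A y n)" by simp
  have "decomposes G A (x \<oplus> y) (\<lambda>n. hcomp G A x n \<oplus> hcomp G A y n)"
    by (rule decomposesI[OF _ F _ eq]) (use assms part_add hcomp_part in auto)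
  from hcomp_unique[OF _ this] show ?thesis using assms by simp
qed

lemma homogeneous_induct [consumes 1, case_names part add]:
  assumes "x \<in> carrier G" "\<And>n y. y \<in> A n \<Longrightarrow> Q y"
    and "\<And>y z. y \<in> carrier G \<Longrightarrow> z \<in> carrier G \<Longrightarrow> Q y \<Longrightarrow> Q z \<Longrightarrow> Q (y \<oplus> z)"
  shows "Q x"
proof -
  have "(\<Oplus>n\<in>F. hcomp G A x n) \<in> carrier G \<and> Q (\<Oplus>n\<in>F. hcomp G A x n)" if "finite F" for F
    using that
  proof induction
    case empty
    then show ?case using assms(2)[OF part_zero] by simp
  next
    case (insert n F)
    have "Q (hcomp G A x n \<oplus> (\<Oplus>n\<in>F. hcomp G A x n))"
      by (rule assms(3)) (use insert assms(1) assms(2)[OF hcomp_part[OF assms(1)]] hcomp_carrier in auto)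
    then show ?case using insert assms(1) hcomp_carrier by (simp add: Pi_def)
  qed
  from this[OF hcomp_finite[OF assms(1)]] show ?thesis
    using decomposes_hcomp[OF assms(1)] unfolding decomposes_def by simp
qed

lemma hcomp_minus: "x \<in> carrier G \<Longrightarrow> hcomp G A (\<ominus> x) n = \<ominus> hcomp G A x n"
  using hcomp_add[of x "\<ominus> x" n] hcomp_zero[of n] hcomp_carrier[of _ n]
  by (metis a_inv_closed minus_equality minus_minus r_neg)

lemma mem_of_hcomp_mem:
  assumes "x \<in> carrier G" "\<And>n. hcomp G A x n \<in> L" "\<zero> \<in> L"
    "\<And>u v. u \<in> L \<Longrightarrow> v \<in> L \<Longrightarrow> u \<oplus> v \<in> L"
  shows "x \<in> L"
proof -
  have "(\<Oplus>n\<in>F. hcomp G A x n) \<in> L" if "finite F" for F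
    using that by induction (use assms hcomp_carrier in \<open>auto simp: Pi_def\<close>)
  from this[OF hcomp_finite[OF assms(1)]] show ?thesis
    using decomposes_hcomp[OF assms(1)] unfolding decomposes_def by simp
qed

end

text \<open>A homogeneous map commutes with taking components. The degree change \<open>\<sigma>\<close> is arbitrary, so that the
  lemma covers graded homomorphisms as well as multiplication by a homogeneous element.\<close>
lemma hcomp_map:
  assumes "graded_group G A" "graded_group H B" and x: "x \<in> carrier G"
    and f: "\<And>x. x \<in> carrier G \<Longrightarrow> f x \<in> carrier H"
      "\<And>x y. x \<in> carrier G \<Longrightarrow> y \<in> carrier G \<Longrightarrow> f (x \<oplus>\<^bsub>G\<^esub> y) = f x \<oplus>\<^bsub>H\<^esub> f y"
    and deg: "\<And>n x. x \<in> A n \<Longrightarrow> f x \<in> B (\<sigma> n)" and inj: "inj \<sigma>"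
  shows "hcomp H B (f x) (\<sigma> n) = f (hcomp G A x n)"
    and "m \<notin> range \<sigma> \<Longrightarrow> hcomp H B (f x) m = \<zero>\<^bsub>H\<^esub>"
proof -
  interpret G: graded_group G A by fact
  interpret H: graded_group H B by fact
  have z: "f \<zero>\<^bsub>G\<^esub> = \<zero>\<^bsub>H\<^esub>" using f(2)[of "\<zero>\<^bsub>G\<^esub>" "\<zero>\<^bsub>G\<^esub>"] f(1)[of "\<zero>\<^bsub>G\<^esub>"]
    by (metis G.zero_closed G.l_zero H.add.l_cancel_one')
  show "hcomp H B (f x) (\<sigma> n) = f (hcomp G A x n)"
    using x
  proof (induction rule: G.homogeneous_induct)
    case (part k y)
    then show ?case
      using G.hcomp_homogeneous[OF part] H.hcomp_homogeneous[OF deg[OF part]] z inj by (auto dest: injD)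
  next
    case (add y z)
    then show ?case using f by (simp add: G.hcomp_add H.hcomp_add G.hcomp_carrier)
  qed
  show "hcomp H B (f x) m = \<zero>\<^bsub>H\<^esub>" if m: "m \<notin> range \<sigma>"
    using x
  proof (induction rule: G.homogeneous_induct)
    case (part k y)
    then show ?case using H.hcomp_homogeneous[OF deg[OF part]] m by auto
  next
    case (add y z)
    then show ?case using f by (simp add: H.hcomp_add)
  qed
qed

lemma zdeg_add: "zdeg (m + n) = zdeg m + zdeg n"
  by (simp add: zdeg_def vec_eq_iff)

lemma zdeg_zero [simp]: "zdeg 0 = 0"
  by (simp add: zdeg_def vec_eq_iff)

lemma zdeg_inject [simp]: "zdeg m = zdeg n \<longleftrightarrow> m = n"
  by (simp add: zdeg_def vec_eq_iff)

locale graded_cring = fixes S :: "'a ring" (structure) and Sg :: "nat^'r \<Rightarrow> 'a set"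
  assumes graded: "graded_ring S Sg"
begin

sublocale cring S using graded unfolding graded_ring_def by blast
sublocale graded_group S Sg
  by unfold_locales (use graded in \<open>auto simp: graded_ring_def\<close>)

lemma one_part: "\<one> \<in> Sg 0"
  using graded unfolding graded_ring_def by blast

lemma mult_part: "a \<in> Sg m \<Longrightarrow> b \<in> Sg n \<Longrightarrow> a \<otimes> b \<in> Sg (m + n)"
  using graded unfolding graded_ring_def by blast

lemma hcomp_mult:
  assumes "a \<in> Sg k" "x \<in> carrier S"
  shows "hcomp S Sg (a \<otimes> x) (k + n) = a \<otimes> hcomp S Sg x n"
    and "\<nexists>n. m = k + n \<Longrightarrow> hcomp S Sg (a \<otimes> x) m = \<zero>"
proof -
  have inj: "inj (\<lambda>n. k + n)" by (simp add: inj_on_def)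
  note * = hcomp_map[OF graded_group_axioms graded_group_axioms assms(2), of "\<lambda>x. a \<otimes> x" "\<lambda>n. k + n", OF _ _ _ inj]
  show "hcomp S Sg (a \<otimes> x) (k + n) = a \<otimes> hcomp S Sg x n"
    by (rule *(1)) (use assms mult_part part_carrier r_distr in auto)
  show "hcomp S Sg (a \<otimes> x) m = \<zero>" if "\<nexists>n. m = k + n"
    by (rule *(2)) (use assms mult_part part_carrier r_distr that in auto)
qed

lemma pow_part: "a \<in> Sg k \<Longrightarrow> \<exists>l. a [^] (p::nat) \<in> Sg l"
  by (induction p) (use one_part mult_part in \<open>auto, blast+\<close>)

text \<open>The elements all of whose components lie in \<open>Idl Y\<close> form an ideal, and this ideal contains \<open>Y\<close>.\<close>
lemma homogeneous_genideal:
  assumes "Y \<subseteq> carrier S" "\<And>y. y \<in> Y \<Longrightarrow> \<exists>k. y \<in> Sg k"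
  shows "homogeneous S Sg (Idl Y)"
proof -
  let ?J = "Idl Y"
  have J: "ideal ?J S" by (rule genideal_ideal[OF assms(1)])
  interpret J: ideal ?J S by (rule J)
  let ?K = "{a \<in> carrier S. \<forall>n. hcomp S Sg a n \<in> ?J}"
  have smult: "r \<otimes> a \<in> ?K" if a: "a \<in> ?K" and r: "r \<in> carrier S" for a r
    using r
  proof (induction rule: homogeneous_induct)
    case (part k r)
    have "hcomp S Sg (r \<otimes> a) m \<in> ?J" for m
      using hcomp_mult[OF part, of a] a J.I_l_closed part_carrier[OF part] J.zero_closed
      by (cases "\<exists>n. m = k + n") auto
    then show ?case using a part_carrier[OF part] by simp
  next
    case (add y z)
    then show ?case using a by (auto simp: l_distr hcomp_add)
  qed
  have "ideal ?K S"
  proof (rule idealI)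
    show "subgroup ?K (add_monoid S)"
      by (rule add.subgroupI) (auto simp: hcomp_add hcomp_minus hcomp_zero intro!: exI[of _ \<zero>])
    fix a r assume a: "a \<in> ?K" "r \<in> carrier S"
    show "r \<otimes> a \<in> ?K" by (rule smult[OF a])
    then show "a \<otimes> r \<in> ?K" using a by (simp add: m_comm)
  qed (rule ring_axioms)
  moreover have "Y \<subseteq> ?K"
  proof
    fix y assume y: "y \<in> Y"
    then obtain k where "y \<in> Sg k" using assms(2) by blast
    then have "hcomp S Sg y n \<in> ?J" for n
      using hcomp_homogeneous[of y k] genideal_self[OF assms(1)] y J.zero_closed by auto
    then show "y \<in> ?K" using y assms(1) by auto
  qed
  ultimately have "?J \<subseteq> ?K" by (rule genideal_minimal)
  then show ?thesis unfolding homogeneous_def by blast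
qed

lemma hcomp_mult_zero:
  assumes "a \<in> carrier S" "b \<in> carrier S"
  shows "hcomp S Sg (a \<otimes> b) 0 = hcomp S Sg a 0 \<otimes> hcomp S Sg b 0"
  using assms(1)
proof (induction rule: homogeneous_induct)
  case (part k a)
  show ?case
  proof (cases "k = 0")
    case True
    then show ?thesis using hcomp_mult(1)[of a k b 0] part assms(2) hcomp_homogeneous[OF part] by simp
  next
    case False
    then have "\<nexists>n. 0 = k + n" by (auto simp: vec_eq_iff)
    then have "hcomp S Sg (a \<otimes> b) 0 = \<zero>" using hcomp_mult(2)[OF part assms(2)] by blast
    moreover have "hcomp S Sg a 0 = \<zero>" using hcomp_homogeneous[OF part] False by auto
    ultimately show ?thesis using hcomp_carrier[OF assms(2)] by simp
  qed
next
  case (add y z)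
  then show ?case using assms(2) by (simp add: l_distr hcomp_add hcomp_carrier)
qed

lemma homogeneous_generators:
  assumes "noetherian_ring S" and J: "ideal J S" "homogeneous S Sg J"
  obtains X where "finite X" "\<And>y. y \<in> X \<Longrightarrow> \<exists>k. y \<in> Sg k" "Idl X = J"
proof -
  interpret noetherian_ring S by fact
  interpret J: ideal J S by (rule J(1))
  obtain A where A: "A \<subseteq> carrier S" "finite A" "J = Idl A" using finetely_gen[OF J(1)] by blast
  have AJ: "A \<subseteq> J" using A genideal_self by blast
  define X where "X = (\<Union>a\<in>A. hcomp S Sg a ` {n. hcomp S Sg a n \<noteq> \<zero>})"
  have XJ: "X \<subseteq> J" unfolding X_def using J(2) AJ unfolding homogeneous_def by blast
  have XS: "X \<subseteq> carrier S" using XJ J.a_subset by blast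
  interpret X: ideal "Idl X" S by (rule genideal_ideal[OF XS])
  have Xz: "\<zero> \<in> Idl X" by (rule additive_subgroup.zero_closed[OF X.additive_subgroup_axioms])
  have "A \<subseteq> Idl X"
  proof
    fix a assume a: "a \<in> A"
    then have aS: "a \<in> carrier S" using A by blast
    show "a \<in> Idl X"
    proof (rule mem_of_hcomp_mem[OF aS])
      fix n show "hcomp S Sg a n \<in> Idl X"
      proof (cases "hcomp S Sg a n = \<zero>")
        case False
        then have "hcomp S Sg a n \<in> X" unfolding X_def using a by blast
        then show ?thesis using genideal_self[OF XS] by blast
      qed (use Xz in simp)
    qed (use Xz additive_subgroup.a_closed[OF X.additive_subgroup_axioms] in auto)
  qed
  then have "J \<subseteq> Idl X" unfolding A(3) by (rule genideal_minimal[OF X.ideal_axioms])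
  moreover have "Idl X \<subseteq> J" by (rule genideal_minimal[OF J(1) XJ])
  ultimately have "Idl X = J" by blast
  moreover have "finite X" unfolding X_def using A hcomp_finite by auto
  moreover have "\<exists>k. y \<in> Sg k" if "y \<in> X" for y
    using that A(1) hcomp_part unfolding X_def by blast
  ultimately show ?thesis using that by blast
qed

lemma max_homogeneous_ideal_iff:
  "x \<in> max_homogeneous_ideal S Sg \<mm> \<longleftrightarrow> x \<in> carrier S \<and> hcomp S Sg x 0 \<in> \<mm>"
  unfolding max_homogeneous_ideal_def using hcomp_unique decomposes_hcomp by auto

lemma homogeneous_max_homogeneous_ideal:
  assumes "local_ring (degree_zero_part S Sg) \<mm>"
  shows "homogeneous S Sg (max_homogeneous_ideal S Sg \<mm>)"
proof -
  interpret m: maximalideal \<mm> "S\<lparr>carrier := Sg 0\<rparr>" using assms unfolding local_ring_def by blast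
  have "\<zero> \<in> \<mm>" using additive_subgroup.zero_closed[OF m.additive_subgroup_axioms] by simp
  then have "hcomp S Sg (hcomp S Sg x n) 0 \<in> \<mm>" if "x \<in> carrier S" "hcomp S Sg x 0 \<in> \<mm>" for x n
    using that hcomp_homogeneous[OF hcomp_part, of x n] by auto
  then show ?thesis
    using hcomp_carrier by (simp add: homogeneous_def max_homogeneous_ideal_iff)
qed

text \<open>The quotient of \<open>S\<close> by this ideal is the residue field of \<open>S\<^sub>0\<close>. An ideal that contains it
  together with \<open>s\<close> also contains the component \<open>s\<^sub>0\<close>, hence, if \<open>s\<^sub>0 \<notin> \<mm>\<close>, the unit.\<close>
lemma maximalideal_max_homogeneous_ideal:
  assumes local: "local_ring (degree_zero_part S Sg) \<mm>"
  shows "maximalideal (max_homogeneous_ideal S Sg \<mm>) S"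
proof -
  have m: "maximalideal \<mm> (S\<lparr>carrier := Sg 0\<rparr>)" using local unfolding local_ring_def by blast
  interpret m: maximalideal \<mm> "S\<lparr>carrier := Sg 0\<rparr>" by (rule m)
  have msub: "\<mm> \<subseteq> Sg 0" using m.a_subset by simp
  have eq: "max_homogeneous_ideal S Sg \<mm> = {x \<in> carrier S. hcomp S Sg x 0 \<in> \<mm>}" (is "_ = ?N")
    using max_homogeneous_ideal_iff by blast
  have m_add: "x \<in> \<mm> \<Longrightarrow> y \<in> \<mm> \<Longrightarrow> x \<oplus> y \<in> \<mm>" for x y using additive_subgroup.a_closed[OF m.additive_subgroup_axioms] by simp
  have m_zero: "\<zero> \<in> \<mm>" using additive_subgroup.zero_closed[OF m.additive_subgroup_axioms] by simp
  have m_mult: "x \<in> \<mm> \<Longrightarrow> y \<in> Sg 0 \<Longrightarrow> y \<otimes> x \<in> \<mm>" for x y using m.I_l_closed by simp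
  have l: "r \<otimes> a \<in> ?N" if "a \<in> ?N" "r \<in> carrier S" for a r
    using that m_mult hcomp_part by (auto simp: hcomp_mult_zero)
  have N: "ideal ?N S"
  proof (rule idealI)
    show "subgroup ?N (add_monoid S)"
    proof (rule add.subgroupI)
      fix a assume a: "a \<in> ?N"
      have "(\<ominus> \<one>) \<otimes> a \<in> ?N" by (rule l[OF a]) simp
      then show "\<ominus> a \<in> ?N" using a by (simp add: l_minus)
    qed (auto simp: hcomp_add m_add hcomp_zero m_zero intro!: exI[of _ \<zero>])
    fix a r assume a: "a \<in> ?N" "r \<in> carrier S"
    show "r \<otimes> a \<in> ?N" by (rule l[OF a])
    then show "a \<otimes> r \<in> ?N" using a by (simp add: m_comm)
  qed (rule ring_axioms)
  have "\<one> \<notin> \<mm>"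
  proof
    assume "\<one> \<in> \<mm>"
    then have "Sg 0 \<subseteq> \<mm>" using m_mult part_carrier by fastforce
    then show False using m.I_notcarr msub by simp
  qed
  show ?thesis
    unfolding eq
  proof (rule maximalidealI[OF N])
    have "\<one> \<notin> ?N" using \<open>\<one> \<notin> \<mm>\<close> hcomp_homogeneous[OF one_part] by simp
    then show "carrier S \<noteq> ?N" by blast
  next
    fix J assume J: "ideal J S" "?N \<subseteq> J" "J \<subseteq> carrier S"
    interpret J: ideal J S by (rule J(1))
    show "J = ?N \<or> J = carrier S"
    proof (cases "J \<subseteq> ?N")
      case False
      then obtain s where s: "s \<in> J" "s \<in> carrier S" "hcomp S Sg s 0 \<notin> \<mm>" using J by blast
      let ?s = "hcomp S Sg s 0"
      have s0: "?s \<in> Sg 0" "?s \<in> carrier S" using hcomp_part hcomp_carrier s by auto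
      have "s \<ominus> ?s \<in> ?N"
        using s s0 hcomp_homogeneous[OF s0(1)] m_zero
        by (simp add: a_minus_def hcomp_add hcomp_minus r_neg)
      then have "s \<ominus> ?s \<in> J" using J by blast
      then have "s \<ominus> (s \<ominus> ?s) \<in> J" using s(1) unfolding a_minus_def by simp
      then have sJ: "?s \<in> J" using s s0 by (simp add: a_minus_def minus_add r_neg2 r_neg)
      have mJ: "\<mm> \<subseteq> J"
        using J(2) msub hcomp_homogeneous part_carrier by fastforce
      let ?I = "J \<inter> Sg 0"
      have "ideal ?I (S\<lparr>carrier := Sg 0\<rparr>)"
      proof (rule idealI)
        show "ring (S\<lparr>carrier := Sg 0\<rparr>)" using m.ring_axioms by simp
        show "subgroup ?I (add_monoid (S\<lparr>carrier := Sg 0\<rparr>))"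
        proof (rule group.subgroupI)
          show "group (add_monoid (S\<lparr>carrier := Sg 0\<rparr>))" using m.a_group by simp
          have "\<zero> \<in> ?I" using additive_subgroup.zero_closed[OF J.additive_subgroup_axioms] part_zero by simp
          then show "?I \<noteq> {}" by blast
          fix a assume a: "a \<in> ?I"
          then have "\<ominus>\<^bsub>S\<lparr>carrier := Sg 0\<rparr>\<^esub> a = \<ominus> a"
            using part_minus[of a 0] part_carrier
            by (intro m.minus_equality) (auto simp: l_neg)
          then show "inv\<^bsub>add_monoid (S\<lparr>carrier := Sg 0\<rparr>)\<^esub> a \<in> ?I"
            unfolding a_inv_def[of "S\<lparr>carrier := Sg 0\<rparr>", symmetric] using a part_minus J.a_inv_closed by simp
        qed (use part_add in auto)
      qed (use J.I_l_closed J.I_r_closed part_carrier mult_part[of _ 0 _ 0] in auto)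
      moreover have "\<mm> \<subseteq> ?I" using mJ msub by blast
      ultimately have "?I = \<mm> \<or> ?I = Sg 0" using m.I_maximal[of ?I] by auto
      then have "\<one> \<in> J" using sJ s0 s(3) one_part by blast
      then show ?thesis using J.one_imp_carrier by blast
    qed (use J in blast)
  qed
qed

end

section \<open>Graded modules\<close>

locale graded_mod = S: graded_cring S Sg for S :: "'a ring" (structure) and Sg :: "nat^'r \<Rightarrow> 'a set" +
  fixes M :: "('a, 'm) module" (structure) and Mg :: "int^'r \<Rightarrow> 'm set"
  assumes graded_mod: "graded_module S Sg M Mg"
begin

sublocale module S M using graded_mod unfolding graded_module_def by blast
sublocale M: graded_group M Mg
  by unfold_locales (use graded_mod in \<open>auto simp: graded_module_def\<close>)

lemma smult_part: "a \<in> Sg k \<Longrightarrow> x \<in> Mg n \<Longrightarrow> a \<odot>\<^bsub>M\<^esub> x \<in> Mg (zdeg k + n)"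
  using graded_mod unfolding graded_module_def by blast

lemma hcomp_smult:
  assumes "a \<in> Sg k" "x \<in> carrier M"
  shows "hcomp M Mg (a \<odot>\<^bsub>M\<^esub> x) n = a \<odot>\<^bsub>M\<^esub> hcomp M Mg x (n - zdeg k)"
proof -
  have "hcomp M Mg (a \<odot>\<^bsub>M\<^esub> x) (zdeg k + (n - zdeg k)) = a \<odot>\<^bsub>M\<^esub> hcomp M Mg x (n - zdeg k)"
  proof (rule hcomp_map[OF M.graded_group_axioms M.graded_group_axioms assms(2)])
    show "inj (\<lambda>n. zdeg k + n)" by (simp add: inj_on_def)
  qed (use assms smult_part S.part_carrier smult_r_distr in auto)
  then show ?thesis by simp
qed

lemma homogeneous_Int: "homogeneous M Mg L \<Longrightarrow> homogeneous M Mg K \<Longrightarrow> homogeneous M Mg (L \<inter> K)"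
  unfolding homogeneous_def by blast

text \<open>The powers of \<open>y\<close> are homogeneous, so \<open>y\<^sup>p z = 0\<close> can be tested on components.\<close>
lemma homogeneous_power_torsion:
  assumes "\<And>y. y \<in> Y \<Longrightarrow> \<exists>k. y \<in> Sg k"
  shows "homogeneous M Mg (power_torsion S M Y)"
  unfolding homogeneous_def
proof (intro ballI allI)
  fix z n assume z: "z \<in> power_torsion S M Y"
  then have zM: "z \<in> carrier M" by (simp add: power_torsion_def)
  have "\<exists>p::nat. (y [^] p) \<odot>\<^bsub>M\<^esub> hcomp M Mg z n = \<zero>\<^bsub>M\<^esub>" if y: "y \<in> Y" for y
  proof -
    obtain p :: nat where p: "(y [^] p) \<odot>\<^bsub>M\<^esub> z = \<zero>\<^bsub>M\<^esub>" using z y by (auto simp: power_torsion_def)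
    obtain l where "y [^] p \<in> Sg l" using assms[OF y] S.pow_part by blast
    then have "(y [^] p) \<odot>\<^bsub>M\<^esub> hcomp M Mg z n = \<zero>\<^bsub>M\<^esub>"
      using hcomp_smult[of "y [^] p" l z "n + zdeg l"] p zM M.hcomp_zero by simp
    then show ?thesis by blast
  qed
  then show "hcomp M Mg z n \<in> power_torsion S M Y"
    using zM M.hcomp_carrier by (simp add: power_torsion_def)
qed

lemma homogeneous_image_plus:
  assumes "a \<in> Sg k" "submodule L S M" "submodule B S M" "homogeneous M Mg L" "homogeneous M Mg B"
  shows "homogeneous M Mg (image_plus M a L B)"
  unfolding homogeneous_def
proof (intro ballI allI)
  fix z n assume "z \<in> image_plus M a L B"
  then obtain l b where lb: "l \<in> L" "b \<in> B" "z = a \<odot>\<^bsub>M\<^esub> l \<oplus>\<^bsub>M\<^esub> b" by (auto simp: image_plus_def)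
  have c: "l \<in> carrier M" "b \<in> carrier M" "a \<in> carrier S"
    using lb assms submodule_carrier S.part_carrier by blast+
  show "hcomp M Mg z n \<in> image_plus M a L B"
  proof (rule image_plusI)
    show "hcomp M Mg z n = a \<odot>\<^bsub>M\<^esub> hcomp M Mg l (n - zdeg k) \<oplus>\<^bsub>M\<^esub> hcomp M Mg b n"
      using c lb(3) by (simp add: M.hcomp_add hcomp_smult[OF assms(1)])
  qed (use lb assms(4,5) in \<open>auto simp: homogeneous_def\<close>)
qed

end

lemma graded_homD:
  assumes "f \<in> graded_hom S M Mg N Ng"
  shows "x \<in> carrier M \<Longrightarrow> f x \<in> carrier N"
    and "x \<in> carrier M \<Longrightarrow> y \<in> carrier M \<Longrightarrow> f (x \<oplus>\<^bsub>M\<^esub> y) = f x \<oplus>\<^bsub>N\<^esub> f y"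
    and "a \<in> carrier S \<Longrightarrow> x \<in> carrier M \<Longrightarrow> f (a \<odot>\<^bsub>M\<^esub> x) = a \<odot>\<^bsub>N\<^esub> f x"
    and "x \<in> Mg n \<Longrightarrow> f x \<in> Ng n"
  using assms unfolding graded_hom_def hom_def by (auto simp: image_subset_iff)

lemma graded_hom_linear: "f \<in> graded_hom S M Mg N Ng \<Longrightarrow> linear_map S M N f"
  unfolding linear_map_def by (auto dest: graded_homD)

lemma hcomp_graded_hom:
  assumes "graded_group M Mg" "graded_group N Ng" "f \<in> graded_hom S M Mg N Ng" "x \<in> carrier M"
  shows "hcomp N Ng (f x) n = f (hcomp M Mg x n)"
  using hcomp_map(1)[OF assms(1,2,4), of f "\<lambda>n. n"] graded_homD[OF assms(3)] by auto

section \<open>Torsion with respect to an ideal\<close>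

text \<open>Torsion with respect to an ideal is thus tested on generators, where it is visibly compatible with
  gradings and cones.\<close>
lemma torsion_genideal:
  fixes S :: "'a ring" (structure) and M :: "('a, 'm) module"
  assumes "module S M" "acc {I. ideal I S}" and Y: "Y \<subseteq> carrier S"
  shows "torsion S (Idl Y) M = power_torsion S M Y"
proof -
  interpret module S M by fact
  interpret I: comm_monoid "ideals_set S" by (rule R.ideals_set_is_comm_monoid)
  have pow: "a [^] k \<in> J [^]\<^bsub>ideals_set S\<^esub> k" if "a \<in> J" "ideal J S" for a J and k :: nat
    using that
  proof (induction k)
    case 0
    then show ?case by (simp add: ideals_set_def)
  next
    case (Suc k)
    then have "a [^] k \<otimes> a \<in> ideal_prod S (J [^]\<^bsub>ideals_set S\<^esub> k) J" by (intro ideal_prod.prod) auto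
    then show ?case by (simp add: ideals_set_def)
  qed
  show ?thesis
  proof (intro equalityI subsetI)
    fix z assume "z \<in> torsion S (Idl Y) M"
    then obtain k :: nat where z: "z \<in> carrier M"
      "\<forall>a\<in>(Idl Y) [^]\<^bsub>ideals_set S\<^esub> k. a \<odot>\<^bsub>M\<^esub> z = \<zero>\<^bsub>M\<^esub>" unfolding torsion_def by blast
    have "(y [^] k) \<odot>\<^bsub>M\<^esub> z = \<zero>\<^bsub>M\<^esub>" if "y \<in> Y" for y
      using z(2) pow[OF _ R.genideal_ideal[OF Y]] R.genideal_self[OF Y] that by blast
    then show "z \<in> power_torsion S M Y" using z(1) unfolding power_torsion_def by blast
  next
    fix z assume z: "z \<in> power_torsion S M Y"
    then have zM: "z \<in> carrier M" by (simp add: power_torsion_def)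
    let ?A = "{a \<in> carrier S. a \<odot>\<^bsub>M\<^esub> z \<in> {\<zero>\<^bsub>M\<^esub>}}"
    have "submodule {\<zero>\<^bsub>M\<^esub>} S M" by (rule submoduleI_smult) auto
    then have "ideal ?A S" using zM by (rule colon_ideal)
    moreover have "\<exists>p::nat. y [^] p \<in> ?A" if "y \<in> Y" for y
      using z that Y by (auto simp: power_torsion_def)
    ultimately obtain k :: nat where "(Idl Y) [^]\<^bsub>ideals_set S\<^esub> k \<subseteq> ?A"
      using R.ideal_power_le[OF assms(2) Y] by blast
    then show "z \<in> torsion S (Idl Y) M" using zM unfolding torsion_def by blast
  qed
qed

section \<open>Graded injective modules\<close>

definition ideal_module :: "'a ring \<Rightarrow> 'a set \<Rightarrow> ('a, 'a) module" where
  "ideal_module S I = \<lparr>carrier = I, monoid.mult = monoid.mult S, one = one S, zero = zero S,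
     add = add S, smult = monoid.mult S\<rparr>"

text \<open>The inverse of the degree map \<open>k \<mapsto> k + s\<close> from \<open>\<nat>\<^sup>r\<close> to \<open>\<int>\<^sup>r\<close>; degrees outside its range are
  recognized by \<open>zdeg (unshift s n) + s \<noteq> n\<close>.\<close>
definition unshift :: "int^'r \<Rightarrow> int^'r \<Rightarrow> nat^'r" where
  "unshift s n = (\<chi> i. nat ((n - s) $ i))"

text \<open>The grading of the ideal \<open>I\<close> as a submodule of the shifted module \<open>S(-s)\<close>.\<close>
definition shifted_grading :: "'a ring \<Rightarrow> (nat^'r \<Rightarrow> 'a set) \<Rightarrow> 'a set \<Rightarrow> int^'r \<Rightarrow> int^'r \<Rightarrow> 'a set" where
  "shifted_grading S Sg I s n = (if zdeg (unshift s n) + s = n then Sg (unshift s n) \<inter> I else {\<zero>\<^bsub>S\<^esub>})"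

lemma unshift_zdeg [simp]: "unshift s (zdeg k + s) = k"
  by (simp add: unshift_def zdeg_def vec_eq_iff)

lemma ideal_module_simps [simp]:
  "carrier (ideal_module S I) = I" "zero (ideal_module S I) = zero S"
  "add (ideal_module S I) = add S" "smult (ideal_module S I) = monoid.mult S"
  by (simp_all add: ideal_module_def)

lemma shifted_grading_zdeg: "shifted_grading S Sg I s (zdeg k + s) = Sg k \<inter> I"
  by (simp add: shifted_grading_def)

lemma module_ideal_module:
  fixes S (structure)
  assumes "cring S" "ideal I S"
  shows "module S (ideal_module S I)"
proof -
  interpret cring S by fact
  interpret I: ideal I S by fact
  have c: "x \<in> I \<Longrightarrow> x \<in> carrier S" for x by (rule I.Icarr)
  have "abelian_group (ideal_module S I)"
  proof (rule abelian_groupI)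
    fix x assume "x \<in> carrier (ideal_module S I)"
    then show "\<exists>y\<in>carrier (ideal_module S I). y \<oplus>\<^bsub>ideal_module S I\<^esub> x = \<zero>\<^bsub>ideal_module S I\<^esub>"
      using c by (intro bexI[of _ "\<ominus> x"]) (auto simp: l_neg)
  qed (use c in \<open>auto simp: a_ac additive_subgroup.zero_closed[OF I.additive_subgroup_axioms]
        additive_subgroup.a_closed[OF I.additive_subgroup_axioms]\<close>)
  then show ?thesis
    by (intro moduleI is_cring) (use c in \<open>auto simp: l_distr r_distr m_assoc I.I_l_closed\<close>)
qed

context graded_cring
begin

lemma graded_module_ideal_module:
  assumes I: "ideal I S" "homogeneous S Sg I"
  shows "graded_module S Sg (ideal_module S I) (shifted_grading S Sg I s)"
proof -
  let ?N = "ideal_module S I" and ?G = "shifted_grading S Sg I s"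
  interpret I: ideal I S by (rule I(1))
  interpret N: module S ?N by (rule module_ideal_module[OF is_cring I(1)])
  have c: "x \<in> I \<Longrightarrow> x \<in> carrier S" for x by (rule I.Icarr)
  have Iz: "\<zero> \<in> I" and Ia: "x \<in> I \<Longrightarrow> y \<in> I \<Longrightarrow> x \<oplus> y \<in> I" for x y
    by (auto simp: additive_subgroup.zero_closed[OF I.additive_subgroup_axioms]
        additive_subgroup.a_closed[OF I.additive_subgroup_axioms])
  have neg: "\<ominus>\<^bsub>?N\<^esub> x = \<ominus> x" if "x \<in> I" for x
    by (rule N.M.minus_equality) (use that c I.a_inv_closed in \<open>auto simp: l_neg\<close>)
  have fsum: "(\<Oplus>\<^bsub>?N\<^esub>n\<in>F. f n) = (\<Oplus>n\<in>F. f n) \<and> (\<Oplus>n\<in>F. f n) \<in> I"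
    if "finite F" "\<And>n. n \<in> F \<Longrightarrow> f n \<in> I" for F and f :: "'i \<Rightarrow> 'a"
    using that
  proof (induction F rule: finite_induct)
    case empty
    then show ?case using N.M.finsum_empty Iz by simp
  next
    case (insert n F)
    have "(\<Oplus>\<^bsub>?N\<^esub>n\<in>insert n F. f n) = f n \<oplus>\<^bsub>?N\<^esub> (\<Oplus>\<^bsub>?N\<^esub>n\<in>F. f n)"
      by (rule N.M.finsum_insert) (use insert in auto)
    moreover have "(\<Oplus>n\<in>insert n F. f n) = f n \<oplus> (\<Oplus>n\<in>F. f n)"
      by (rule finsum_insert) (use insert c in auto)
    ultimately show ?case using insert Ia by simp
  qed
  have G_sub: "additive_subgroup (?G n) ?N" for n
  proof (rule additive_subgroup.intro, rule group.subgroupI[OF N.M.a_group])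
    show "?G n \<subseteq> carrier (add_monoid ?N)" using Iz by (auto simp: shifted_grading_def)
    have "\<zero> \<in> ?G n" using Iz part_zero by (auto simp: shifted_grading_def)
    then show "?G n \<noteq> {}" by blast
    fix a assume a: "a \<in> ?G n"
    then have "a \<in> I" using Iz by (auto simp: shifted_grading_def split: if_splits)
    then show "inv\<^bsub>add_monoid ?N\<^esub> a \<in> ?G n"
      unfolding a_inv_def[of ?N, symmetric] neg[OF \<open>a \<in> I\<close>]
      using a part_minus I.a_inv_closed by (auto simp: shifted_grading_def split: if_splits)
    fix b assume "b \<in> ?G n"
    then show "a \<otimes>\<^bsub>add_monoid ?N\<^esub> b \<in> ?G n"
      using a part_add Ia by (auto simp: shifted_grading_def split: if_splits)
  qed
  have "\<exists>!d. decomposes ?N ?G x d" if x: "x \<in> carrier ?N" for x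
  proof -
    have xI: "x \<in> I" and xS: "x \<in> carrier S" using x c by auto
    have hI: "hcomp S Sg x k \<in> I" for k using I(2) xI unfolding homogeneous_def by blast
    let ?d = "\<lambda>n. if zdeg (unshift s n) + s = n then hcomp S Sg x (unshift s n) else \<zero>"
    let ?K = "{k. hcomp S Sg x k \<noteq> \<zero>}"
    have supp: "{n. ?d n \<noteq> \<zero>} = (\<lambda>k. zdeg k + s) ` ?K"
    proof (intro equalityI subsetI)
      fix n assume "n \<in> {n. ?d n \<noteq> \<zero>}"
      then have n: "zdeg (unshift s n) + s = n" "hcomp S Sg x (unshift s n) \<noteq> \<zero>" by (auto split: if_splits)
      then show "n \<in> (\<lambda>k. zdeg k + s) ` ?K" by (intro image_eqI[of _ _ "unshift s n"]) auto
    qed auto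
    have inj: "inj_on (\<lambda>k. zdeg k + s) ?K" by (auto simp: inj_on_def)
    have fin: "finite ?K" using hcomp_finite[OF xS] .
    have "(\<Oplus>\<^bsub>?N\<^esub>n\<in>{n. ?d n \<noteq> \<zero>}. ?d n) = (\<Oplus>n\<in>{n. ?d n \<noteq> \<zero>}. ?d n)"
      using fsum[of "{n. ?d n \<noteq> \<zero>}" ?d] supp fin hI Iz by auto
    also have "\<dots> = (\<Oplus>k\<in>?K. ?d (zdeg k + s))"
      unfolding supp by (rule finsum_reindex) (use inj hcomp_carrier[OF xS] in auto)
    also have "\<dots> = (\<Oplus>k\<in>?K. hcomp S Sg x k)" by simp
    also have "\<dots> = x" using decomposes_hcomp[OF xS] unfolding decomposes_def by simp
    finally have sum: "(\<Oplus>\<^bsub>?N\<^esub>n\<in>{n. ?d n \<noteq> \<zero>}. ?d n) = x" .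
    have dec: "decomposes ?N ?G x ?d"
      unfolding decomposes_def
    proof (intro conjI allI)
      fix n show "?d n \<in> ?G n" using hI hcomp_part[OF xS] by (auto simp: shifted_grading_def)
    qed (use sum supp fin in auto)
    have "d = ?d" if d: "decomposes ?N ?G x d" for d
    proof
      have dG: "d n \<in> ?G n" for n using d unfolding decomposes_def by blast
      have d0: "d n = \<zero>" if "zdeg (unshift s n) + s \<noteq> n" for n
        using dG[of n] that by (simp add: shifted_grading_def)
      have dk: "d (zdeg k + s) \<in> Sg k" "d (zdeg k + s) \<in> I" for k
        using dG[of "zdeg k + s"] unfolding shifted_grading_zdeg by auto
      let ?L = "{k. d (zdeg k + s) \<noteq> \<zero>}"
      have sL: "{n. d n \<noteq> \<zero>} = (\<lambda>k. zdeg k + s) ` ?L"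
      proof (intro equalityI subsetI)
        fix n assume "n \<in> {n. d n \<noteq> \<zero>}"
        then have "d n \<noteq> \<zero>" "zdeg (unshift s n) + s = n" using d0 by auto
        then show "n \<in> (\<lambda>k. zdeg k + s) ` ?L" by (intro image_eqI[of _ _ "unshift s n"]) auto
      qed auto
      have fd: "finite {n. d n \<noteq> \<zero>}" using d unfolding decomposes_def by simp
      have injL: "inj_on (\<lambda>k. zdeg k + s) ?L" by (auto simp: inj_on_def)
      have fL: "finite ?L" using fd unfolding sL by (rule finite_imageD[OF _ injL])
      have "x = (\<Oplus>\<^bsub>?N\<^esub>n\<in>{n. d n \<noteq> \<zero>}. d n)" using d unfolding decomposes_def by simp
      also have "\<dots> = (\<Oplus>n\<in>{n. d n \<noteq> \<zero>}. d n)"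
        using fsum[OF fd, of d] sL dk by auto
      also have "\<dots> = (\<Oplus>k\<in>?L. d (zdeg k + s))"
        unfolding sL by (rule finsum_reindex) (use injL dk c in auto)
      finally have "decomposes S Sg x (\<lambda>k. d (zdeg k + s))"
        unfolding decomposes_def using fL dk by blast
      then have eq: "hcomp S Sg x = (\<lambda>k. d (zdeg k + s))" by (rule hcomp_unique[OF xS])
      fix n show "d n = ?d n" using d0[of n] eq by auto
    qed
    with dec show ?thesis by blast
  qed
  then have "direct_sum ?N ?G" unfolding direct_sum_def using G_sub by blast
  moreover have "a \<odot>\<^bsub>?N\<^esub> x \<in> ?G (zdeg m + n)" if "a \<in> Sg m" "x \<in> ?G n" for m n a x
  proof (cases "zdeg (unshift s n) + s = n")
    case True
    then obtain k where n: "n = zdeg k + s" by metis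
    have x: "x \<in> Sg k" "x \<in> I" using that(2) unfolding n shifted_grading_zdeg by auto
    have "zdeg m + n = zdeg (m + k) + s" using n by (simp add: zdeg_add)
    then show ?thesis
      using x that(1) mult_part part_carrier I.I_l_closed by (simp add: shifted_grading_zdeg)
  next
    case False
    then have "x = \<zero>" using that(2) by (simp add: shifted_grading_def)
    then have "a \<odot>\<^bsub>?N\<^esub> x = \<zero>" using that(1) part_carrier by simp
    then show ?thesis using Iz part_zero by (auto simp: shifted_grading_def)
  qed
  ultimately show ?thesis unfolding graded_module_def using N.module_axioms by blast
qed

text \<open>The graded form of Baer's criterion: \<open>e\<close> is the image of \<open>1\<close> under an extension of \<open>\<phi>\<close> to \<open>S\<close>.\<close>
lemma graded_injective_extend:
  assumes inj: "graded_injective S Sg E Eg" and I: "ideal I S" "homogeneous S Sg I"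
    and \<phi>: "\<And>a. a \<in> I \<Longrightarrow> \<phi> a \<in> carrier E" "\<And>a b. a \<in> I \<Longrightarrow> b \<in> I \<Longrightarrow> \<phi> (a \<oplus> b) = \<phi> a \<oplus>\<^bsub>E\<^esub> \<phi> b"
      "\<And>r a. r \<in> carrier S \<Longrightarrow> a \<in> I \<Longrightarrow> \<phi> (r \<otimes> a) = r \<odot>\<^bsub>E\<^esub> \<phi> a"
    and deg: "\<And>k a. a \<in> Sg k \<Longrightarrow> a \<in> I \<Longrightarrow> \<phi> a \<in> Eg (zdeg k + s)"
  obtains e where "e \<in> Eg s" "\<And>a. a \<in> I \<Longrightarrow> \<phi> a = a \<odot>\<^bsub>E\<^esub> e"
proof -
  interpret E: graded_mod S Sg E Eg
    by unfold_locales (use inj in \<open>simp add: graded_injective_def\<close>)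
  interpret I: ideal I S by (rule I(1))
  have c: "x \<in> I \<Longrightarrow> x \<in> carrier S" for x by (rule I.Icarr)
  let ?L = "ideal_module S I" and ?N = "ideal_module S (carrier S)"
  let ?Lg = "shifted_grading S Sg I s" and ?Ng = "shifted_grading S Sg (carrier S) s"
  have hS: "homogeneous S Sg (carrier S)" unfolding homogeneous_def using hcomp_carrier by blast
  have "\<phi> \<zero> = \<zero>\<^bsub>E\<^esub>"
    using \<phi>(3)[of \<zero> \<zero>] \<phi>(1)[of \<zero>] additive_subgroup.zero_closed[OF I.additive_subgroup_axioms] by simp
  then have "\<phi> ` ?Lg n \<subseteq> Eg n" for n
    using deg E.M.part_zero by (auto simp: shifted_grading_def) (metis)
  then have "\<phi> \<in> graded_hom S ?L ?Lg E Eg"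
    unfolding graded_hom_def hom_def using \<phi> by auto
  moreover have "?Lg n \<subseteq> ?Ng n" for n
    using c by (auto simp: shifted_grading_def)
  then have "(\<lambda>x. x) \<in> graded_hom S ?L ?Lg ?N ?Ng"
    unfolding graded_hom_def hom_def using c by auto
  moreover have "graded_module S Sg ?L ?Lg" "graded_module S Sg ?N ?Ng"
    using graded_module_ideal_module I oneideal hS by auto
  ultimately obtain h where h: "h \<in> graded_hom S ?N ?Ng E Eg" "\<forall>x\<in>I. h x = \<phi> x"
    using inj unfolding graded_injective_def
    by (metis ideal_module_simps(1) inj_on_id2)
  show ?thesis
  proof
    have "\<one> \<in> ?Ng (zdeg 0 + s)" unfolding shifted_grading_zdeg using one_part by simp
    then show "h \<one> \<in> Eg s" using graded_homD(4)[OF h(1), of \<one> s] by simp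
    fix a assume a: "a \<in> I"
    have "h (a \<odot>\<^bsub>?N\<^esub> \<one>) = a \<odot>\<^bsub>E\<^esub> h \<one>"
      by (rule graded_homD(3)[OF h(1)]) (use a c in auto)
    then show "\<phi> a = a \<odot>\<^bsub>E\<^esub> h \<one>" using h(2) a c by simp
  qed
qed

text \<open>Let \<open>J\<close> be the ideal generated by the powers \<open>y\<^sup>p\<close>; it kills \<open>e\<close>. The ascending chain of the ideals
  \<open>(J : x\<^sup>m)\<close> becomes stationary at some \<open>m\<close>, and then \<open>j + s x\<^sup>m\<^sup>+\<^sup>1 \<mapsto> s x\<^sup>m e\<close> is a well-defined map
  on \<open>J + (x\<^sup>m\<^sup>+\<^sup>1)\<close>. By injectivity it is multiplication by some \<open>e'\<close>, which is then killed by \<open>J\<close> and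
  satisfies \<open>x\<^sup>m\<^sup>+\<^sup>1 e' = x\<^sup>m e\<close>.\<close>
lemma graded_injective_divide_part:
  assumes acc: "acc {I. ideal I S}" and inj: "graded_injective S Sg E Eg"
    and Y: "\<And>y. y \<in> Y \<Longrightarrow> \<exists>k. y \<in> Sg k" and x: "x \<in> Sg k" and e: "e \<in> Eg n"
    and kill: "\<And>y. y \<in> Y \<Longrightarrow> (y [^] (p::nat)) \<odot>\<^bsub>E\<^esub> e = \<zero>\<^bsub>E\<^esub>"
  obtains m :: nat and e' where "e' \<in> carrier E" "\<And>y. y \<in> Y \<Longrightarrow> (y [^] p) \<odot>\<^bsub>E\<^esub> e' = \<zero>\<^bsub>E\<^esub>"
    "(x [^] Suc m) \<odot>\<^bsub>E\<^esub> e' = (x [^] m) \<odot>\<^bsub>E\<^esub> e"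
proof -
  interpret E: graded_mod S Sg E Eg
    by unfold_locales (use inj in \<open>simp add: graded_injective_def\<close>)
  have xS: "x \<in> carrier S" using x part_carrier by blast
  have eE: "e \<in> carrier E" using e E.M.part_carrier by blast
  let ?Yp = "(\<lambda>y. y [^] p) ` Y"
  have Yp: "?Yp \<subseteq> carrier S" using Y part_carrier by blast
  define J where "J = Idl ?Yp"
  have J: "ideal J S" unfolding J_def by (rule genideal_ideal[OF Yp])
  interpret J: ideal J S by (rule J)
  have Jh: "homogeneous S Sg J"
    unfolding J_def by (rule homogeneous_genideal[OF Yp]) (use Y pow_part in blast)
  note Jz = additive_subgroup.zero_closed[OF J.additive_subgroup_axioms]
  note Ja = additive_subgroup.a_closed[OF J.additive_subgroup_axioms]
  have Je: "j \<odot>\<^bsub>E\<^esub> e = \<zero>\<^bsub>E\<^esub>" if "j \<in> J" for j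
  proof -
    have "submodule {\<zero>\<^bsub>E\<^esub>} S E" by (rule E.submoduleI_smult) auto
    then have "ideal {a \<in> carrier S. a \<odot>\<^bsub>E\<^esub> e \<in> {\<zero>\<^bsub>E\<^esub>}} S" using eE by (rule E.colon_ideal)
    then have "J \<subseteq> {a \<in> carrier S. a \<odot>\<^bsub>E\<^esub> e \<in> {\<zero>\<^bsub>E\<^esub>}}"
      unfolding J_def by (rule genideal_minimal) (use Yp kill in auto)
    then show ?thesis using that by blast
  qed
  define A where "A m = {s \<in> carrier S. s \<otimes> x [^] m \<in> J}" for m :: nat
  have A: "ideal (A m) S" for m
    unfolding A_def by (rule colon_element_ideal[OF J]) (use xS in simp)
  have A_mono: "A m \<subseteq> A m'" if "m \<le> m'" for m m'
  proof -
    have "s \<otimes> x [^] m' = x [^] (m' - m) \<otimes> (s \<otimes> x [^] m)" if "s \<in> carrier S" for s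
      using that xS \<open>m \<le> m'\<close> nat_pow_mult[OF xS, of m "m' - m"] by (simp add: m_ac)
    then show ?thesis using xS J.I_l_closed unfolding A_def by auto
  qed
  obtain m where m: "\<And>m'. m \<le> m' \<Longrightarrow> A m' = A m"
    using strictly_wf_stabilizes[OF acc, of A] A A_mono by auto
  have Am: "s \<otimes> x [^] m \<in> J" if "s \<in> carrier S" "s \<otimes> x [^] Suc m \<in> J" for s
  proof -
    have "s \<in> A (Suc m)" using that unfolding A_def by blast
    then have "s \<in> A m" using m[of "Suc m"] by simp
    then show ?thesis unfolding A_def by blast
  qed
  define X where "X = x [^] Suc m"
  obtain q where q: "x [^] m \<in> Sg q" using pow_part[OF x] by blast
  have Xq: "X \<in> Sg (q + k)" unfolding X_def using mult_part[OF q x] by simp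
  have XS: "X \<in> carrier S" and xmS: "x [^] m \<in> carrier S" unfolding X_def using xS by auto
  define I where "I = J <+>\<^bsub>S\<^esub> PIdl X"
  have I: "ideal I S" unfolding I_def by (intro add_ideals J cgenideal_ideal XS)
  have I_iff: "c \<in> I \<longleftrightarrow> (\<exists>j\<in>J. \<exists>s\<in>carrier S. c = j \<oplus> s \<otimes> X)" for c
    unfolding I_def set_add_def' cgenideal_def by auto
  define \<phi> where "\<phi> a = (SOME v. \<exists>j\<in>J. \<exists>s\<in>carrier S. a = j \<oplus> s \<otimes> X \<and> v = (s \<otimes> x [^] m) \<odot>\<^bsub>E\<^esub> e)" for a
  have \<phi>_eq: "\<phi> (j \<oplus> s \<otimes> X) = (s \<otimes> x [^] m) \<odot>\<^bsub>E\<^esub> e" if js: "j \<in> J" "s \<in> carrier S" for j s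
  proof -
    have "\<exists>j'\<in>J. \<exists>s'\<in>carrier S. j \<oplus> s \<otimes> X = j' \<oplus> s' \<otimes> X \<and> \<phi> (j \<oplus> s \<otimes> X) = (s' \<otimes> x [^] m) \<odot>\<^bsub>E\<^esub> e"
      unfolding \<phi>_def by (rule someI_ex) (use js in blast)
    then obtain j' s' where *: "j' \<in> J" "s' \<in> carrier S" "j \<oplus> s \<otimes> X = j' \<oplus> s' \<otimes> X"
      "\<phi> (j \<oplus> s \<otimes> X) = (s' \<otimes> x [^] m) \<odot>\<^bsub>E\<^esub> e" by blast
    have c: "j \<in> carrier S" "j' \<in> carrier S" using js *(1) J.Icarr by auto
    have "s' \<otimes> X = \<ominus> j' \<oplus> (j \<oplus> s \<otimes> X)"
      using *(2,3) c js(2) XS by (simp add: r_neg1)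
    then have "(s' \<ominus> s) \<otimes> X = \<ominus> j' \<oplus> j"
      using *(2) c js(2) XS by (simp add: a_minus_def l_distr l_minus a_assoc r_neg)
    moreover have "\<ominus> j' \<oplus> j \<in> J" using js(1) *(1) Ja J.a_inv_closed by blast
    ultimately have "(s' \<ominus> s) \<otimes> x [^] m \<in> J" using Am[of "s' \<ominus> s"] js(2) *(2) X_def by simp
    then have "((s' \<ominus> s) \<otimes> x [^] m) \<odot>\<^bsub>E\<^esub> e = \<zero>\<^bsub>E\<^esub>" by (rule Je)
    moreover have "(s' \<otimes> x [^] m) \<odot>\<^bsub>E\<^esub> e = ((s' \<ominus> s) \<otimes> x [^] m) \<odot>\<^bsub>E\<^esub> e \<oplus>\<^bsub>E\<^esub> (s \<otimes> x [^] m) \<odot>\<^bsub>E\<^esub> e"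
    proof -
      have "s' \<otimes> x [^] m = (s' \<ominus> s) \<otimes> x [^] m \<oplus> s \<otimes> x [^] m"
        using js(2) *(2) xmS by (simp add: a_minus_def l_distr l_minus a_assoc l_neg)
      then show ?thesis using E.smult_l_distr js(2) *(2) xmS eE by simp
    qed
    ultimately show ?thesis using *(4) js(2) xmS eE by simp
  qed
  have h_eq: "hcomp S Sg (j \<oplus> s \<otimes> X) l = hcomp S Sg j l \<oplus> hcomp S Sg (s \<otimes> X) l"
    if "j \<in> J" "s \<in> carrier S" for j s l using that J.Icarr XS by (simp add: hcomp_add)
  have h1: "hcomp S Sg (s \<otimes> X) (q + k + l) = hcomp S Sg s l \<otimes> X" if "s \<in> carrier S" for s l
    using hcomp_mult(1)[OF Xq that, of l] that XS hcomp_carrier[OF that] by (simp add: m_comm)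
  have h2: "hcomp S Sg (s \<otimes> X) l = \<zero>" if "s \<in> carrier S" "\<nexists>n. l = q + k + n" for s l
    using hcomp_mult(2)[OF Xq that] that XS by (simp add: m_comm)
  have h_phi: "hcomp S Sg a l \<in> I \<and> \<phi> (hcomp S Sg a l) \<in> Eg (zdeg l + (n - zdeg k))" if a: "a \<in> I" for a l
  proof -
    obtain j s where js: "j \<in> J" "s \<in> carrier S" "a = j \<oplus> s \<otimes> X" using a I_iff by blast
    have hj: "hcomp S Sg j l \<in> J" using Jh js unfolding homogeneous_def by blast
    show ?thesis
    proof (cases "\<exists>n. l = q + k + n")
      case True
      then obtain i where i: "l = q + k + i" by blast
      have si: "hcomp S Sg s i \<in> Sg i" "hcomp S Sg s i \<in> carrier S"
        using hcomp_part hcomp_carrier js by auto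
      have h: "hcomp S Sg a l = hcomp S Sg j l \<oplus> hcomp S Sg s i \<otimes> X"
        using h_eq[OF js(1,2)] h1[OF js(2)] js(3) i by simp
      have "\<phi> (hcomp S Sg a l) = (hcomp S Sg s i \<otimes> x [^] m) \<odot>\<^bsub>E\<^esub> e"
        unfolding h by (rule \<phi>_eq[OF hj si(2)])
      moreover have "\<dots> \<in> Eg (zdeg (i + q) + n)"
        by (rule E.smult_part[OF mult_part[OF si(1) q] e])
      moreover have "zdeg (i + q) + n = zdeg l + (n - zdeg k)"
        unfolding i by (simp add: zdeg_add)
      ultimately show ?thesis using h hj si I_iff by auto
    next
      case False
      have h: "hcomp S Sg a l = hcomp S Sg j l \<oplus> \<zero> \<otimes> X"
        using h_eq[OF js(1,2)] h2[OF js(2)] False js(3) XS by simp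
      have "\<phi> (hcomp S Sg a l) = (\<zero> \<otimes> x [^] m) \<odot>\<^bsub>E\<^esub> e"
        unfolding h by (rule \<phi>_eq[OF hj zero_closed])
      then have "\<phi> (hcomp S Sg a l) = \<zero>\<^bsub>E\<^esub>" using xmS eE by simp
      then show ?thesis using h hj I_iff E.M.part_zero by auto
    qed
  qed
  obtain e' where e': "e' \<in> Eg (n - zdeg k)" "\<And>a. a \<in> I \<Longrightarrow> \<phi> a = a \<odot>\<^bsub>E\<^esub> e'"
  proof (rule graded_injective_extend[OF inj I, of \<phi> "n - zdeg k"])
    show "homogeneous S Sg I" unfolding homogeneous_def using h_phi by blast
    fix a assume a: "a \<in> I"
    then obtain j s where js: "j \<in> J" "s \<in> carrier S" "a = j \<oplus> s \<otimes> X" using I_iff by blast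
    then have cj: "j \<in> carrier S" using J.Icarr by blast
    have pa: "\<phi> a = (s \<otimes> x [^] m) \<odot>\<^bsub>E\<^esub> e" using js \<phi>_eq by simp
    then show "\<phi> a \<in> carrier E" using js xmS eE by simp
    show "\<phi> a \<in> Eg (zdeg l + (n - zdeg k))" if "a \<in> Sg l" for l
      using h_phi[OF a, of l] hcomp_homogeneous[OF that] by simp
    show "\<phi> (r \<otimes> a) = r \<odot>\<^bsub>E\<^esub> \<phi> a" if r: "r \<in> carrier S" for r
    proof -
      have "r \<otimes> a = r \<otimes> j \<oplus> (r \<otimes> s) \<otimes> X" using r js cj XS by (simp add: r_distr m_assoc)
      then have "\<phi> (r \<otimes> a) = ((r \<otimes> s) \<otimes> x [^] m) \<odot>\<^bsub>E\<^esub> e"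
        using \<phi>_eq[of "r \<otimes> j" "r \<otimes> s"] r js J.I_l_closed by simp
      then show ?thesis using pa r js xmS eE by (simp add: m_assoc E.smult_assoc1)
    qed
    fix b assume "b \<in> I"
    then obtain j' s' where js': "j' \<in> J" "s' \<in> carrier S" "b = j' \<oplus> s' \<otimes> X" using I_iff by blast
    then have cj': "j' \<in> carrier S" using J.Icarr by blast
    have "a \<oplus> b = (j \<oplus> j') \<oplus> (s \<oplus> s') \<otimes> X" using js js' cj cj' XS by (simp add: l_distr a_ac)
    then have "\<phi> (a \<oplus> b) = ((s \<oplus> s') \<otimes> x [^] m) \<odot>\<^bsub>E\<^esub> e"
      using \<phi>_eq[of "j \<oplus> j'" "s \<oplus> s'"] js js' Ja by simp
    then show "\<phi> (a \<oplus> b) = \<phi> a \<oplus>\<^bsub>E\<^esub> \<phi> b"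
      using pa \<phi>_eq[OF js'(1,2)] js js' xmS eE by (simp add: l_distr E.smult_l_distr)
  qed blast
  show ?thesis
  proof
    show "e' \<in> carrier E" using e'(1) E.M.part_carrier by blast
    show "(y [^] p) \<odot>\<^bsub>E\<^esub> e' = \<zero>\<^bsub>E\<^esub>" if "y \<in> Y" for y
    proof -
      have yJ: "y [^] p \<in> J" unfolding J_def using genideal_self[OF Yp] that by blast
      then have eq: "y [^] p = y [^] p \<oplus> \<zero> \<otimes> X" using J.Icarr XS by simp
      then have "y [^] p \<in> I" unfolding I_iff using yJ by blast
      then show ?thesis using e'(2) \<phi>_eq[OF yJ zero_closed] eq xmS eE by simp
    qed
    have eq: "X = \<zero> \<oplus> \<one> \<otimes> X" using XS by simp
    then have "X \<in> I" unfolding I_iff using Jz by blast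
    then have "X \<odot>\<^bsub>E\<^esub> e' = (x [^] m) \<odot>\<^bsub>E\<^esub> e"
      using e'(2) \<phi>_eq[OF Jz one_closed] eq xmS by simp
    then show "(x [^] Suc m) \<odot>\<^bsub>E\<^esub> e' = (x [^] m) \<odot>\<^bsub>E\<^esub> e" unfolding X_def .
  qed
qed

text \<open>The homogeneous components of \<open>e\<close> are treated one by one. A solution for the exponent \<open>m\<close> is one
  for every larger exponent, so the finitely many solutions can be added.\<close>
lemma graded_injective_torsion_divisible:
  assumes acc: "acc {I. ideal I S}" and inj: "graded_injective S Sg E Eg"
    and X: "\<And>y. y \<in> X \<Longrightarrow> \<exists>k. y \<in> Sg k"
  shows "torsion_divisible S E X"
  unfolding torsion_divisible_def
proof (intro allI ballI impI)
  interpret E: graded_mod S Sg E Eg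
    by unfold_locales (use inj in \<open>simp add: graded_injective_def\<close>)
  fix Y x and p :: nat and e
  assume Y: "Y \<subseteq> X" and x: "x \<in> X" and e: "e \<in> carrier E" and kill: "\<forall>y\<in>Y. (y [^] p) \<odot>\<^bsub>E\<^esub> e = \<zero>\<^bsub>E\<^esub>"
  obtain k where k: "x \<in> Sg k" using X[OF x] by blast
  have xS: "x \<in> carrier S" using k part_carrier by blast
  have YS: "y \<in> carrier S" if "y \<in> Y" for y using that Y X part_carrier by blast
  let ?Q = "\<lambda>m u v. u \<in> carrier E \<and> v \<in> carrier E \<and> (\<forall>y\<in>Y. (y [^] p) \<odot>\<^bsub>E\<^esub> v = \<zero>\<^bsub>E\<^esub>) \<and>
      (x [^] Suc m) \<odot>\<^bsub>E\<^esub> v = (x [^] m) \<odot>\<^bsub>E\<^esub> u"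
  have raise: "?Q (m + i) u v" if "?Q m u v" for m i :: nat and u v
    using that E.pow_add_smult[OF xS, of v i "Suc m"] E.pow_add_smult[OF xS, of u i m]
    by (simp add: add.commute)
  have "e \<in> {u. \<exists>m v. ?Q m u v}"
  proof (rule E.M.mem_of_hcomp_mem[OF e])
    fix n
    have "(y [^] p) \<odot>\<^bsub>E\<^esub> hcomp E Eg e n = \<zero>\<^bsub>E\<^esub>" if y: "y \<in> Y" for y
    proof -
      obtain l where "y [^] p \<in> Sg l" using X Y y pow_part by blast
      then show ?thesis
        using E.hcomp_smult[of "y [^] p" l e "n + zdeg l"] kill y e E.M.hcomp_zero by simp
    qed
    note killn = this
    have Yh: "\<And>y. y \<in> Y \<Longrightarrow> \<exists>k. y \<in> Sg k" using X Y by blast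
    obtain w and i :: nat where "w \<in> carrier E" "\<And>y. y \<in> Y \<Longrightarrow> (y [^] p) \<odot>\<^bsub>E\<^esub> w = \<zero>\<^bsub>E\<^esub>"
      "(x [^] Suc i) \<odot>\<^bsub>E\<^esub> w = (x [^] i) \<odot>\<^bsub>E\<^esub> hcomp E Eg e n"
    proof (rule graded_injective_divide_part[OF acc inj Yh k E.M.hcomp_part[OF e] killn])
      fix i :: nat and w assume "w \<in> carrier E" "\<And>y. y \<in> Y \<Longrightarrow> (y [^] p) \<odot>\<^bsub>E\<^esub> w = \<zero>\<^bsub>E\<^esub>"
        "(x [^] Suc i) \<odot>\<^bsub>E\<^esub> w = (x [^] i) \<odot>\<^bsub>E\<^esub> hcomp E Eg e n"
      then show thesis by (rule that)
    qed
    then have "?Q i (hcomp E Eg e n) w" using E.M.hcomp_carrier[OF e] by blast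
    then show "hcomp E Eg e n \<in> {u. \<exists>m v. ?Q m u v}" by blast
  next
    have "?Q 0 \<zero>\<^bsub>E\<^esub> \<zero>\<^bsub>E\<^esub>" using xS YS by simp
    then show "\<zero>\<^bsub>E\<^esub> \<in> {u. \<exists>m v. ?Q m u v}" by blast
  next
    fix u u' assume "u \<in> {u. \<exists>m v. ?Q m u v}" "u' \<in> {u. \<exists>m v. ?Q m u v}"
    then obtain m v m' v' where "?Q m u v" "?Q m' u' v'" by auto
    then have *: "?Q (m + m') u v" "?Q (m + m') u' v'"
      using raise[where m = m and i = m' and u = u and v = v] raise[where m = m' and i = m and u = u' and v = v'] by (simp_all add: add.commute)
    have "?Q (m + m') (u \<oplus>\<^bsub>E\<^esub> u') (v \<oplus>\<^bsub>E\<^esub> v')"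
      using * xS YS by (simp add: E.smult_r_distr del: nat_pow_Suc)
    then show "u \<oplus>\<^bsub>E\<^esub> u' \<in> {u. \<exists>m v. ?Q m u v}" by blast
  qed
  then show "\<exists>m::nat. \<exists>e'\<in>carrier E. (\<forall>y\<in>Y. (y [^] p) \<odot>\<^bsub>E\<^esub> e' = \<zero>\<^bsub>E\<^esub>) \<and>
      (x [^] Suc m) \<odot>\<^bsub>E\<^esub> e' = (x [^] m) \<odot>\<^bsub>E\<^esub> e"
    by blast
qed

end

section \<open>Local cohomology is Artinian\<close>

text \<open>The direct sum of all \<open>E i\<close>. Finite support is essential for \<open>torsion_divisible_D\<close>, where
  finitely many exponents have to be bounded.\<close>
definition total_module :: "(nat \<Rightarrow> ('a, 'e) module) \<Rightarrow> ('a, nat \<Rightarrow> 'e) module" where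
  "total_module E =
     \<lparr>carrier = {f. (\<forall>i. f i \<in> carrier (E i)) \<and> (\<exists>N. \<forall>i\<ge>N. f i = \<zero>\<^bsub>E i\<^esub>)},
      monoid.mult = undefined, one = undefined, zero = (\<lambda>i. \<zero>\<^bsub>E i\<^esub>),
      add = (\<lambda>f g i. f i \<oplus>\<^bsub>E i\<^esub> g i), smult = (\<lambda>a f i. a \<odot>\<^bsub>E i\<^esub> f i)\<rparr>"

definition total_diff :: "(nat \<Rightarrow> ('a, 'e) module) \<Rightarrow> (nat \<Rightarrow> 'e \<Rightarrow> 'e) \<Rightarrow> (nat \<Rightarrow> 'e) \<Rightarrow> nat \<Rightarrow> 'e" where
  "total_diff E d f i = (case i of 0 \<Rightarrow> \<zero>\<^bsub>E 0\<^esub> | Suc j \<Rightarrow> d j (f j))"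

definition single :: "(nat \<Rightarrow> ('a, 'e) module) \<Rightarrow> nat \<Rightarrow> 'e \<Rightarrow> nat \<Rightarrow> 'e" where
  "single E i x j = (if j = i then x else \<zero>\<^bsub>E j\<^esub>)"

lemma total_module_simps [simp]:
  "f \<in> carrier (total_module E) \<longleftrightarrow> (\<forall>i. f i \<in> carrier (E i)) \<and> (\<exists>N. \<forall>i\<ge>N. f i = \<zero>\<^bsub>E i\<^esub>)"
  "\<zero>\<^bsub>total_module E\<^esub> = (\<lambda>i. \<zero>\<^bsub>E i\<^esub>)"
  "f \<oplus>\<^bsub>total_module E\<^esub> g = (\<lambda>i. f i \<oplus>\<^bsub>E i\<^esub> g i)"
  "a \<odot>\<^bsub>total_module E\<^esub> f = (\<lambda>i. a \<odot>\<^bsub>E i\<^esub> f i)"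
  by (simp_all add: total_module_def)

lemma total_diff_simps [simp]:
  "total_diff E d f 0 = \<zero>\<^bsub>E 0\<^esub>" "total_diff E d f (Suc j) = d j (f j)"
  by (simp_all add: total_diff_def)

locale graded_resolution = S: graded_cring S Sg for S :: "'a ring" (structure) and Sg :: "nat^'r \<Rightarrow> 'a set" +
  fixes M :: "('a, 'm) module" and Mg :: "int^'r \<Rightarrow> 'm set"
    and E :: "nat \<Rightarrow> ('a, 'e) module" and Eg :: "nat \<Rightarrow> int^'r \<Rightarrow> 'e set"
    and d :: "nat \<Rightarrow> 'e \<Rightarrow> 'e" and \<epsilon> :: "'m \<Rightarrow> 'e"
  assumes M: "graded_module S Sg M Mg"
    and res: "graded_injective_resolution S Sg M Mg E Eg d \<epsilon>"
begin

sublocale M: graded_mod S Sg M Mg by unfold_locales (rule M)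
sublocale E: graded_mod S Sg "E i" "Eg i" for i
  by unfold_locales (use res in \<open>auto simp: graded_injective_resolution_def graded_injective_def\<close>)

abbreviation "D \<equiv> total_module E"
abbreviation "\<delta> \<equiv> total_diff E d"

lemma d_hom: "d i \<in> graded_hom S (E i) (Eg i) (E (Suc i)) (Eg (Suc i))"
  using res unfolding graded_injective_resolution_def by blast

lemma \<epsilon>_hom: "\<epsilon> \<in> graded_hom S M Mg (E 0) (Eg 0)"
  using res unfolding graded_injective_resolution_def by blast

lemma \<epsilon>_image: "\<epsilon> ` carrier M = {x \<in> carrier (E 0). d 0 x = \<zero>\<^bsub>E 1\<^esub>}"
  using res unfolding graded_injective_resolution_def a_kernel_def kernel_def by simp

lemma d_image: "d i ` carrier (E i) = {x \<in> carrier (E (Suc i)). d (Suc i) x = \<zero>\<^bsub>E (Suc (Suc i))\<^esub>}"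
  using res unfolding graded_injective_resolution_def a_kernel_def kernel_def by simp

lemmas d_linear = graded_hom_linear[OF d_hom]
  and d_carrier = graded_homD(1)[OF d_hom]
  and d_plus = graded_homD(2)[OF d_hom]
  and d_scale = graded_homD(3)[OF d_hom]
  and d_null = linear_map_zero_minus(1)[OF E.module_axioms E.module_axioms graded_hom_linear[OF d_hom]]

lemma d_dd: "x \<in> carrier (E i) \<Longrightarrow> d (Suc i) (d i x) = \<zero>\<^bsub>E (Suc (Suc i))\<^esub>"
  using d_image[of i] by blast

lemma D_carrierI:
  "(\<And>i. f i \<in> carrier (E i)) \<Longrightarrow> (\<And>i. N \<le> i \<Longrightarrow> f i = \<zero>\<^bsub>E i\<^esub>) \<Longrightarrow> f \<in> carrier D"
  by auto

sublocale D: differential_module S D \<delta>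
proof -
  have "abelian_group D"
  proof (rule abelian_groupI)
    fix f g assume "f \<in> carrier D" "g \<in> carrier D"
    then obtain m n where *: "\<And>i. f i \<in> carrier (E i)" "\<And>i. m \<le> i \<Longrightarrow> f i = \<zero>\<^bsub>E i\<^esub>"
      "\<And>i. g i \<in> carrier (E i)" "\<And>i. n \<le> i \<Longrightarrow> g i = \<zero>\<^bsub>E i\<^esub>" by auto
    have "f \<oplus>\<^bsub>D\<^esub> g \<in> carrier D"
      by (rule D_carrierI[of _ "max m n"]) (use * in auto)
    then show "f \<oplus>\<^bsub>D\<^esub> g \<in> carrier D" .
  next
    fix f assume f: "f \<in> carrier D"
    then obtain n where *: "\<And>i. f i \<in> carrier (E i)" "\<And>i. n \<le> i \<Longrightarrow> f i = \<zero>\<^bsub>E i\<^esub>" by auto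
    have "(\<lambda>i. \<ominus>\<^bsub>E i\<^esub> f i) \<in> carrier D"
      by (rule D_carrierI[of _ n]) (use * E.neg_zero in auto)
    then show "\<exists>g\<in>carrier D. g \<oplus>\<^bsub>D\<^esub> f = \<zero>\<^bsub>D\<^esub>"
      by (rule bexI[rotated]) (use * E.M.l_neg in auto)
  qed (auto simp: E.M.a_ac)
  then interpret D: module S D
  proof (intro moduleI S.is_cring)
    fix a f assume a: "a \<in> carrier S" and "f \<in> carrier D"
    then obtain n where *: "\<And>i. f i \<in> carrier (E i)" "\<And>i. n \<le> i \<Longrightarrow> f i = \<zero>\<^bsub>E i\<^esub>" by auto
    show "a \<odot>\<^bsub>D\<^esub> f \<in> carrier D"
      by (rule D_carrierI[of _ n]) (use * a in auto)
  qed (auto simp: E.smult_l_distr E.smult_r_distr E.smult_assoc1)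
  show "differential_module S D \<delta>"
  proof
    show "linear_map S D D \<delta>"
      unfolding linear_map_def
    proof (intro ballI conjI)
      fix f assume f: "f \<in> carrier D"
      then obtain n where *: "\<And>i. f i \<in> carrier (E i)" "\<And>i. n \<le> i \<Longrightarrow> f i = \<zero>\<^bsub>E i\<^esub>" by auto
      show "\<delta> f \<in> carrier D"
      proof (rule D_carrierI[of _ "Suc n"])
        fix i show "\<delta> f i \<in> carrier (E i)" using * d_carrier by (cases i) auto
        show "\<delta> f i = \<zero>\<^bsub>E i\<^esub>" if "Suc n \<le> i" using * d_null that by (cases i) auto
      qed
      show "\<delta> (a \<odot>\<^bsub>D\<^esub> f) = a \<odot>\<^bsub>D\<^esub> \<delta> f" if a: "a \<in> carrier S" for a
      proof
        fix i show "\<delta> (a \<odot>\<^bsub>D\<^esub> f) i = (a \<odot>\<^bsub>D\<^esub> \<delta> f) i" using * a d_scale by (cases i) auto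
      qed
      show "\<delta> (f \<oplus>\<^bsub>D\<^esub> g) = \<delta> f \<oplus>\<^bsub>D\<^esub> \<delta> g" if g: "g \<in> carrier D" for g
      proof
        fix i show "\<delta> (f \<oplus>\<^bsub>D\<^esub> g) i = (\<delta> f \<oplus>\<^bsub>D\<^esub> \<delta> g) i" using * g d_plus by (cases i) auto
      qed
    qed
    fix f assume "f \<in> carrier D"
    then have *: "\<And>i. f i \<in> carrier (E i)" by simp
    show "\<delta> (\<delta> f) = \<zero>\<^bsub>D\<^esub>"
    proof
      fix i show "\<delta> (\<delta> f) i = \<zero>\<^bsub>D\<^esub> i"
      proof (cases i)
        case (Suc j)
        then show ?thesis using * d_null d_dd by (cases j) auto
      qed simp
    qed
  qed
qed

lemma cycles_D: "f \<in> cycles D \<delta> \<longleftrightarrow> f \<in> carrier D \<and> (\<forall>i. d i (f i) = \<zero>\<^bsub>E (Suc i)\<^esub>)"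
proof -
  have "\<delta> f = \<zero>\<^bsub>D\<^esub> \<longleftrightarrow> (\<forall>i. d i (f i) = \<zero>\<^bsub>E (Suc i)\<^esub>)"
  proof
    assume eq: "\<delta> f = \<zero>\<^bsub>D\<^esub>"
    have "d i (f i) = \<zero>\<^bsub>E (Suc i)\<^esub>" for i using fun_cong[OF eq, of "Suc i"] by simp
    then show "\<forall>i. d i (f i) = \<zero>\<^bsub>E (Suc i)\<^esub>" by blast
  next
    assume *: "\<forall>i. d i (f i) = \<zero>\<^bsub>E (Suc i)\<^esub>"
    show "\<delta> f = \<zero>\<^bsub>D\<^esub>"
    proof
      fix i show "\<delta> f i = \<zero>\<^bsub>D\<^esub> i" using * by (cases i) auto
    qed
  qed
  then show ?thesis by (simp add: cycles_def)
qed

lemma single_carrier: "x \<in> carrier (E i) \<Longrightarrow> single E i x \<in> carrier D"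
  by (rule D_carrierI[of _ "Suc i"]) (auto simp: single_def)

lemma single_plus: "single E i (x \<oplus>\<^bsub>E i\<^esub> y) = single E i x \<oplus>\<^bsub>D\<^esub> single E i y"
  by (rule ext) (auto simp: single_def)

lemma single_scale: "a \<in> carrier S \<Longrightarrow> single E i (a \<odot>\<^bsub>E i\<^esub> x) = a \<odot>\<^bsub>D\<^esub> single E i x"
  by (rule ext) (auto simp: single_def)

lemma single_zero: "single E i \<zero>\<^bsub>E i\<^esub> = \<zero>\<^bsub>D\<^esub>"
  by (rule ext) (auto simp: single_def)

lemma single_cycle: "x \<in> carrier (E i) \<Longrightarrow> d i x = \<zero>\<^bsub>E (Suc i)\<^esub> \<Longrightarrow> single E i x \<in> cycles D \<delta>"
  unfolding cycles_D using single_carrier[of x i] d_null by (simp add: single_def)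

text \<open>The resolution is exact except at the start, where its cohomology is \<open>M\<close>.\<close>
lemma cycle_mod_boundary:
  assumes f: "f \<in> cycles D \<delta>"
  obtains m u where "m \<in> carrier M" "u \<in> carrier D" "f = single E 0 (\<epsilon> m) \<oplus>\<^bsub>D\<^esub> \<delta> u"
proof -
  have fD: "f \<in> carrier D" and fd: "\<And>i. d i (f i) = \<zero>\<^bsub>E (Suc i)\<^esub>" using f cycles_D by blast+
  obtain n where fE: "\<And>i. f i \<in> carrier (E i)" and fn: "\<And>i. n \<le> i \<Longrightarrow> f i = \<zero>\<^bsub>E i\<^esub>"
    using fD by auto
  have "f 0 \<in> \<epsilon> ` carrier M" unfolding \<epsilon>_image using fE[of 0] fd[of 0] by simp
  then obtain m where m: "m \<in> carrier M" "\<epsilon> m = f 0" by force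
  have "\<exists>u. u \<in> carrier (E i) \<and> d i u = f (Suc i) \<and> (n \<le> i \<longrightarrow> u = \<zero>\<^bsub>E i\<^esub>)" for i
  proof (cases "n \<le> i")
    case True
    then show ?thesis using fn[of "Suc i"] d_null by (intro exI[of _ "\<zero>\<^bsub>E i\<^esub>"]) auto
  next
    case False
    have "f (Suc i) \<in> d i ` carrier (E i)" unfolding d_image using fE fd by blast
    then show ?thesis using False by auto
  qed
  then obtain u where u: "\<And>i. u i \<in> carrier (E i)" "\<And>i. d i (u i) = f (Suc i)"
    "\<And>i. n \<le> i \<Longrightarrow> u i = \<zero>\<^bsub>E i\<^esub>" by metis
  have "f = single E 0 (\<epsilon> m) \<oplus>\<^bsub>D\<^esub> \<delta> u"
  proof
    fix i show "f i = (single E 0 (\<epsilon> m) \<oplus>\<^bsub>D\<^esub> \<delta> u) i"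
      using m u fE by (cases i) (auto simp: single_def)
  qed
  moreover have "u \<in> carrier D" by (rule D_carrierI[of _ n]) (use u in auto)
  ultimately show ?thesis using that m by blast
qed

text \<open>Since every cycle is homologous to the image of an element of \<open>M\<close>, a submodule that contains the
  boundaries is determined by its trace on \<open>M\<close>.\<close>
lemma acc_cohomology_D:
  assumes "acc (intermediate S M {\<zero>\<^bsub>M\<^esub>} (carrier M))"
  shows "acc (intermediate S D (\<delta> ` carrier D) (cycles D \<delta>))" (is "acc ?A")
proof (rule strictly_wf_by_map[OF assms, where f = "\<lambda>L. {m \<in> carrier M. single E 0 (\<epsilon> m) \<in> L}"])
  note \<epsilon> = graded_homD[OF \<epsilon>_hom]
  fix L assume "L \<in> ?A"
  note L = D.intermediateD[OF this]
  have "submodule {m \<in> carrier M. single E 0 (\<epsilon> m) \<in> L} S M"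
  proof (rule submodule_preimage[OF M.module_axioms D.module_axioms _ L(1)])
    show "linear_map S M D (\<lambda>m. single E 0 (\<epsilon> m))"
      unfolding linear_map_def using \<epsilon>(1-3) single_carrier single_plus single_scale by simp
  qed
  then show "{m \<in> carrier M. single E 0 (\<epsilon> m) \<in> L} \<in> intermediate S M {\<zero>\<^bsub>M\<^esub>} (carrier M)"
    using M.submodule_zero by (auto simp: intermediate_def)
next
  fix X Y assume XY: "X \<in> ?A" "Y \<in> ?A" "Y \<subseteq> X"
    and eq: "{m \<in> carrier M. single E 0 (\<epsilon> m) \<in> X} = {m \<in> carrier M. single E 0 (\<epsilon> m) \<in> Y}"
  note X = D.intermediateD[OF XY(1)] and Y = D.intermediateD[OF XY(2)]
  have "X \<subseteq> Y"
  proof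
    fix f assume f: "f \<in> X"
    then obtain m u where m: "m \<in> carrier M" "u \<in> carrier D" "f = single E 0 (\<epsilon> m) \<oplus>\<^bsub>D\<^esub> \<delta> u"
      using cycle_mod_boundary[of f] X(3) by blast
    have "\<delta> u \<in> X" "\<delta> u \<in> Y" using m(2) X(2) Y(2) by blast+
    moreover have "single E 0 (\<epsilon> m) \<in> carrier D"
      by (rule single_carrier[OF graded_homD(1)[OF \<epsilon>_hom m(1)]])
    ultimately have "single E 0 (\<epsilon> m) \<in> X"
      using D.submodule_add_cancel[OF X(1)] f unfolding m(3) by blast
    then have "single E 0 (\<epsilon> m) \<in> Y" using eq m(1) by blast
    then show "f \<in> Y" unfolding m(3) using \<open>\<delta> u \<in> Y\<close> by (rule D.submodule_add[OF Y(1)])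
  qed
  then show "X = Y" using XY(3) by blast
qed auto

lemma torsion_divisible_D:
  assumes acc: "acc {I. ideal I S}" and X: "\<And>y. y \<in> X \<Longrightarrow> \<exists>k. y \<in> Sg k"
  shows "torsion_divisible S D X"
  unfolding torsion_divisible_def
proof (intro allI ballI impI)
  fix Y x and p :: nat and e
  assume Y: "Y \<subseteq> X" and x: "x \<in> X" and e: "e \<in> carrier D"
    and kill: "\<forall>y\<in>Y. (y [^] p) \<odot>\<^bsub>D\<^esub> e = \<zero>\<^bsub>D\<^esub>"
  obtain n where eE: "\<And>i. e i \<in> carrier (E i)" and en: "\<And>i. n \<le> i \<Longrightarrow> e i = \<zero>\<^bsub>E i\<^esub>" using e by auto
  have xS: "x \<in> carrier S" using X[OF x] S.part_carrier by blast
  have YS: "y \<in> carrier S" if "y \<in> Y" for y using that Y X S.part_carrier by blast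
  have killi: "(y [^] p) \<odot>\<^bsub>E i\<^esub> e i = \<zero>\<^bsub>E i\<^esub>" if "y \<in> Y" for y i
    using fun_cong[OF kill[rule_format, OF that], of i] by simp
  have "\<exists>m::nat. \<exists>v\<in>carrier (E i). (\<forall>y\<in>Y. (y [^] p) \<odot>\<^bsub>E i\<^esub> v = \<zero>\<^bsub>E i\<^esub>) \<and>
      (x [^] Suc m) \<odot>\<^bsub>E i\<^esub> v = (x [^] m) \<odot>\<^bsub>E i\<^esub> e i" for i
  proof -
    have "graded_injective S Sg (E i) (Eg i)"
      using res unfolding graded_injective_resolution_def by blast
    then have div: "torsion_divisible S (E i) X" by (rule S.graded_injective_torsion_divisible[OF acc _ X])
    then show ?thesis
      using killi by (intro div[unfolded torsion_divisible_def, rule_format, OF Y x eE, of p])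
  qed
  then obtain m :: "nat \<Rightarrow> nat" and v where v: "\<And>i. v i \<in> carrier (E i)"
    "\<And>i y. y \<in> Y \<Longrightarrow> (y [^] p) \<odot>\<^bsub>E i\<^esub> v i = \<zero>\<^bsub>E i\<^esub>"
    "\<And>i. (x [^] Suc (m i)) \<odot>\<^bsub>E i\<^esub> v i = (x [^] m i) \<odot>\<^bsub>E i\<^esub> e i" by metis
  define N where "N = Max (insert 0 (m ` {..<n}))"
  have mN: "m i \<le> N" if "i < n" for i unfolding N_def using that by (intro Max_ge) auto
  define w where "w i = (if i < n then v i else \<zero>\<^bsub>E i\<^esub>)" for i
  have "w \<in> carrier D" by (rule D_carrierI[of _ n]) (use v in \<open>auto simp: w_def\<close>)
  moreover have "(y [^] p) \<odot>\<^bsub>D\<^esub> w = \<zero>\<^bsub>D\<^esub>" if "y \<in> Y" for y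
    using v(2)[OF that] YS[OF that] by (auto simp: w_def fun_eq_iff)
  moreover have "(x [^] Suc N) \<odot>\<^bsub>D\<^esub> w = (x [^] N) \<odot>\<^bsub>D\<^esub> e"
  proof
    fix i
    show "((x [^] Suc N) \<odot>\<^bsub>D\<^esub> w) i = ((x [^] N) \<odot>\<^bsub>D\<^esub> e) i"
    proof (cases "i < n")
      case True
      have "(x [^] Suc N) \<odot>\<^bsub>E i\<^esub> v i = (x [^] N) \<odot>\<^bsub>E i\<^esub> e i"
      proof -
        have "N - m i + Suc (m i) = Suc N" "N - m i + m i = N" using mN[OF True] by auto
        then show ?thesis
          using E.pow_add_smult[OF xS v(1), of i "N - m i" "Suc (m i)"]
            E.pow_add_smult[OF xS eE, of i "N - m i" "m i"] v(3)[of i] by (simp only:)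
      qed
      then show ?thesis using True by (simp add: w_def)
    next
      case False
      then show ?thesis using en xS by (simp add: w_def)
    qed
  qed
  ultimately show "\<exists>m::nat. \<exists>e'\<in>carrier D. (\<forall>y\<in>Y. (y [^] p) \<odot>\<^bsub>D\<^esub> e' = \<zero>\<^bsub>D\<^esub>) \<and>
      (x [^] Suc m) \<odot>\<^bsub>D\<^esub> e' = (x [^] m) \<odot>\<^bsub>D\<^esub> e" by blast
qed

text \<open>Submodules of \<open>H\<^sup>i\<close> are recovered from submodules of the cohomology of the torsion part of \<open>D\<close>,
  because a cocycle of \<open>E i\<close> is a cycle of \<open>D\<close> concentrated in one place.\<close>
theorem artinian_local_cohomology:
  assumes acc: "acc {I. ideal I S}" and fg: "fin_gen_module S M"
    and X: "finite X" "\<And>y. y \<in> X \<Longrightarrow> \<exists>k. y \<in> Sg k" "maximalideal (Idl X) S"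
  shows "dcc (intermediate S (E i) (coboundaries S (Idl X) E d i) (cocycles S (Idl X) E d i))"
proof -
  have XS: "X \<subseteq> carrier S" using X(2) S.part_carrier by blast
  obtain G where "finite G" "G \<subseteq> carrier M" "\<And>N. submodule N S M \<Longrightarrow> G \<subseteq> N \<Longrightarrow> N = carrier M"
    using fg unfolding fin_gen_module_def by blast
  then have "acc (intermediate S M {\<zero>\<^bsub>M\<^esub>} (carrier M))" by (rule M.acc_finitely_generated[OF acc])
  then have dcc: "dcc (intermediate S D (\<delta> ` power_torsion S D X) (cycles D \<delta> \<inter> power_torsion S D X))"
    (is "dcc ?B")
    by (intro dcc_torsion_cohomology[OF X(1) XS X(3) X(1) order_refl D.differential_module_axioms
          torsion_divisible_D[OF acc X(2)] acc_cohomology_D]) auto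
  have tors: "torsion S (Idl X) (E j) = power_torsion S (E j) X" for j
    by (rule torsion_genideal[OF E.module_axioms acc XS])
  have pt: "f i \<in> power_torsion S (E i) X" if "f \<in> power_torsion S D X" for f i
    using that by (fastforce simp: power_torsion_def fun_eq_iff)
  have pt_single: "single E i x \<in> power_torsion S D X" if x: "x \<in> power_torsion S (E i) X" for x
  proof -
    have "\<exists>p::nat. (y [^] p) \<odot>\<^bsub>D\<^esub> single E i x = \<zero>\<^bsub>D\<^esub>" if y: "y \<in> X" for y
    proof -
      obtain p :: nat where "(y [^] p) \<odot>\<^bsub>E i\<^esub> x = \<zero>\<^bsub>E i\<^esub>" using x y by (auto simp: power_torsion_def)
      moreover have "y [^] p \<in> carrier S" using y XS by blast
      ultimately have "(y [^] p) \<odot>\<^bsub>D\<^esub> single E i x = \<zero>\<^bsub>D\<^esub>" using single_scale single_zero by metis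
      then show ?thesis by blast
    qed
    moreover have "single E i x \<in> carrier D" using x by (intro single_carrier) (simp add: power_torsion_def)
    ultimately show ?thesis unfolding power_torsion_def by blast
  qed
  note PT = D.submodule_power_torsion[OF XS]
  define ZX where "ZX = cycles D \<delta> \<inter> power_torsion S D X"
  have ZP: "submodule ZX S D" unfolding ZX_def by (rule D.submodule_Int[OF D.submodule_cycles PT])
  show ?thesis
  proof (rule strictly_wf_by_map[OF dcc, where f = "\<lambda>L. ZX \<inter> {f \<in> carrier D. f i \<in> L}"])
    fix L assume "L \<in> intermediate S (E i) (coboundaries S (Idl X) E d i) (cocycles S (Idl X) E d i)"
    note L = E.intermediateD[OF this]
    show "ZX \<inter> {f \<in> carrier D. f i \<in> L} \<in> ?B"
    proof (rule D.intermediateI)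
      have "submodule {f \<in> carrier D. f i \<in> L} S D"
        by (rule submodule_preimage[OF D.module_axioms E.module_axioms _ L(1)]) (simp add: linear_map_def)
      then show "submodule (ZX \<inter> {f \<in> carrier D. f i \<in> L}) S D" by (rule D.submodule_Int[OF ZP])
      fix b assume "b \<in> \<delta> ` power_torsion S D X"
      then obtain u where u: "u \<in> power_torsion S D X" "b = \<delta> u" by blast
      then have "b \<in> ZX"
        using D.d_power_torsion[OF XS u(1)] D.d_d D.d_closed D.submodule_carrier[OF PT u(1)]
        by (simp add: ZX_def cycles_def del: total_module_simps)
      moreover have "b i \<in> coboundaries S (Idl X) E d i"
        using u(2) pt[OF u(1)] by (cases i) (auto simp: coboundaries_def tors)
      ultimately show "b \<in> ZX \<inter> {f \<in> carrier D. f i \<in> L}"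
        using L(2) D.submodule_carrier[OF ZP] by blast
    qed (simp add: ZX_def)
  next
    fix K L assume KL: "K \<in> intermediate S (E i) (coboundaries S (Idl X) E d i) (cocycles S (Idl X) E d i)"
      "L \<in> intermediate S (E i) (coboundaries S (Idl X) E d i) (cocycles S (Idl X) E d i)" "K \<subseteq> L"
      and eq: "ZX \<inter> {f \<in> carrier D. f i \<in> K} = ZX \<inter> {f \<in> carrier D. f i \<in> L}"
    have "L \<subseteq> K"
    proof
      fix z assume z: "z \<in> L"
      then have "z \<in> power_torsion S (E i) X" "z \<in> carrier (E i)" "d i z = \<zero>\<^bsub>E (Suc i)\<^esub>"
        using E.intermediateD(3)[OF KL(2)]
        by (auto simp: cocycles_def tors a_kernel_def kernel_def)
      then have "single E i z \<in> ZX" unfolding ZX_def using pt_single single_cycle by blast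
      moreover have "single E i z \<in> carrier D" by (rule D.submodule_carrier[OF ZP \<open>single E i z \<in> ZX\<close>])
      moreover have "single E i z i = z" by (simp add: single_def)
      ultimately have "single E i z \<in> ZX \<inter> {f \<in> carrier D. f i \<in> K}" unfolding eq using z by simp
      then show "z \<in> K" using \<open>single E i z i = z\<close> by simp
    qed
    then show "K = L" using KL(3) by blast
  qed blast
qed

end

section \<open>Vanishing outside finitely many strips\<close>

text \<open>For \<open>L = Z\<close> this is the property of being \<open>\<Gamma>\<close>-finitely graded for the quotient \<open>Z/B\<close>: its nonzero
  components lie in finitely many strips \<open>\<bar>n\<^sub>i\<bar> < \<beta>\<^sub>i\<close>.\<close>
definition strip_finite :: "(int^'r \<Rightarrow> 'm set) \<Rightarrow> 'm set \<Rightarrow> 'm set \<Rightarrow> bool" where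
  "strip_finite Mg B L \<longleftrightarrow> (\<exists>\<beta>::nat^'r. \<forall>n. (\<forall>i. int (\<beta> $ i) \<le> \<bar>n $ i\<bar>) \<longrightarrow> L \<inter> Mg n \<subseteq> B)"

lemma cone_iff: "n \<in> cone \<beta> \<longleftrightarrow> (\<forall>i. \<beta> $ i \<le> n $ i)"
proof
  assume "n \<in> cone \<beta>"
  then obtain x :: "real^'a" where x: "\<forall>i. 0 \<le> x $ i" "\<forall>i. real (n $ i) = real (\<beta> $ i) + x $ i"
    unfolding cone_def by blast
  have "real (\<beta> $ i) \<le> real (n $ i)" for i using x(1)[rule_format, of i] x(2)[rule_format, of i] by linarith
  then show "\<forall>i. \<beta> $ i \<le> n $ i" by simp
next
  assume "\<forall>i. \<beta> $ i \<le> n $ i"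
  then show "n \<in> cone \<beta>"
    unfolding cone_def by (intro CollectI exI[of _ "\<chi> i. real (n $ i) - real (\<beta> $ i)"]) simp
qed

lemma abs_deg_mem_cone: "abs_deg n \<in> cone \<beta> \<longleftrightarrow> (\<forall>i. int (\<beta> $ i) \<le> \<bar>n $ i\<bar>)"
  unfolding cone_iff abs_deg_def by (simp add: nat_le_iff le_nat_iff)

text \<open>For each \<open>i\<close> the integers \<open>n\<^sub>i + t G\<^sub>i\<close> are distinct, and at most \<open>2\<beta>\<^sub>i\<close> of them have absolute value
  below \<open>\<beta>\<^sub>i\<close>. So not all \<open>2\<Sum>\<beta>\<^sub>i + 1\<close> values of \<open>t\<close> can be bad.\<close>
lemma line_leaves_strips:
  fixes n :: "int^'r" and G \<beta> :: "nat^'r"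
  assumes "\<And>i. 0 < G $ i"
  shows "\<exists>t\<le>(\<Sum>i\<in>UNIV. 2 * \<beta> $ i). \<forall>i. int (\<beta> $ i) \<le> \<bar>n $ i + int t * int (G $ i)\<bar>"
proof (rule ccontr)
  let ?T = "\<Sum>i\<in>UNIV. 2 * \<beta> $ i"
  define bad where "bad i = {t \<in> {..?T}. \<bar>n $ i + int t * int (G $ i)\<bar> < int (\<beta> $ i)}" for i
  assume "\<not> (\<exists>t\<le>?T. \<forall>i. int (\<beta> $ i) \<le> \<bar>n $ i + int t * int (G $ i)\<bar>)"
  then have "\<exists>i. t \<in> bad i" if "t \<le> ?T" for t
    using that unfolding bad_def by (metis (mono_tags, lifting) atMost_iff mem_Collect_eq not_le)
  then have "{..?T} \<subseteq> (\<Union>i\<in>UNIV. bad i)" by auto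
  then have "card {..?T} \<le> card (\<Union>i\<in>UNIV. bad i)"
    by (intro card_mono) (auto simp: bad_def)
  also have "\<dots> \<le> (\<Sum>i\<in>UNIV. card (bad i))" by (rule card_UN_le) simp
  also have "\<dots> \<le> ?T"
  proof (rule sum_mono)
    fix i
    have "card (bad i) \<le> card {- int (\<beta> $ i)..<int (\<beta> $ i)}"
    proof (rule card_inj_on_le)
      show "inj_on (\<lambda>t. n $ i + int t * int (G $ i)) (bad i)"
        using assms[of i] by (auto simp: inj_on_def)
    qed (auto simp: bad_def)
    then show "card (bad i) \<le> 2 * \<beta> $ i" by simp
  qed
  finally show False by simp
qed

context graded_mod
begin

lemma pow_part_scaled: "g \<in> Sg G \<Longrightarrow> g [^] (t::nat) \<in> Sg (\<chi> i. t * G $ i)"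
proof (induction t)
  case 0
  have "(\<chi> i. 0 * G $ i) = 0" by (simp add: vec_eq_iff)
  then show ?case using S.one_part by simp
next
  case (Suc t)
  have "(\<chi> i. Suc t * G $ i) = (\<chi> i. t * G $ i) + G" by (simp add: vec_eq_iff)
  then show ?case using S.mult_part[OF Suc.IH[OF Suc.prems] Suc.prems] by simp
qed

lemma strip_finite_nilpotent:
  assumes Z: "submodule Z S M" "homogeneous M Mg Z" and B: "submodule B S M"
    and fin: "strip_finite Mg B Z" and g: "g \<in> Sg G" "\<And>i. 0 < G $ i"
  shows "\<exists>T::nat. \<forall>z\<in>Z. (g [^] T) \<odot>\<^bsub>M\<^esub> z \<in> B"
proof -
  obtain \<beta> :: "nat^'r" where \<beta>: "\<And>n. (\<And>i. int (\<beta> $ i) \<le> \<bar>n $ i\<bar>) \<Longrightarrow> Z \<inter> Mg n \<subseteq> B"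
    using fin unfolding strip_finite_def by blast
  let ?T = "\<Sum>i\<in>UNIV. 2 * \<beta> $ i"
  have gS: "g \<in> carrier S" using g S.part_carrier by blast
  have hom: "(g [^] ?T) \<odot>\<^bsub>M\<^esub> z \<in> B" if z: "z \<in> Z" "z \<in> Mg n" for z n
  proof -
    obtain t where t: "t \<le> ?T" "\<forall>i. int (\<beta> $ i) \<le> \<bar>n $ i + int t * int (G $ i)\<bar>"
      using line_leaves_strips[OF g(2), of \<beta> n] by blast
    have zM: "z \<in> carrier M" using z M.part_carrier by blast
    have "(g [^] t) \<odot>\<^bsub>M\<^esub> z \<in> Z \<inter> Mg (zdeg (\<chi> i. t * G $ i) + n)"
      using smult_part[OF pow_part_scaled[OF g(1), of t] z(2)] submodule_smult[OF Z(1) _ z(1)] gS by simp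
    moreover have "Z \<inter> Mg (zdeg (\<chi> i. t * G $ i) + n) \<subseteq> B"
      by (rule \<beta>) (use t(2) in \<open>simp add: zdeg_def add.commute\<close>)
    ultimately show ?thesis using pow_smult_mem_mono[OF B gS zM _ t(1)] by blast
  qed
  have "(g [^] ?T) \<odot>\<^bsub>M\<^esub> z \<in> B" if z: "z \<in> Z" for z
  proof -
    have zM: "z \<in> carrier M" using Z z submodule_carrier by blast
    have "z \<in> {z \<in> carrier M. (g [^] ?T) \<odot>\<^bsub>M\<^esub> z \<in> B}"
    proof (rule M.mem_of_hcomp_mem[OF zM])
      fix n show "hcomp M Mg z n \<in> {z \<in> carrier M. (g [^] ?T) \<odot>\<^bsub>M\<^esub> z \<in> B}"
        using hom[of "hcomp M Mg z n" n] Z(2) z M.hcomp_part[OF zM] M.hcomp_carrier[OF zM]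
        unfolding homogeneous_def by blast
    qed (use gS submodule_zero[OF B] submodule_add[OF B] in \<open>auto simp: smult_r_distr\<close>)
    then show ?thesis by blast
  qed
  then show ?thesis by blast
qed

lemma strip_finite_sum:
  assumes L: "L \<in> intermediate S M B Z" and B: "submodule B S M" "homogeneous M Mg B"
    and F: "finite F" "\<And>j. j \<in> F \<Longrightarrow> W j \<in> intermediate S M B L \<and> homogeneous M Mg (W j) \<and> strip_finite Mg B (W j)"
  shows "\<exists>V\<in>intermediate S M B L. homogeneous M Mg V \<and> strip_finite Mg B V \<and> (\<forall>j\<in>F. W j \<subseteq> V)"
  using F
proof (induction F rule: finite_induct)
  case empty
  have "B \<in> intermediate S M B L" using L B by (auto simp: intermediate_def)
  moreover have "strip_finite Mg B B" unfolding strip_finite_def by blast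
  ultimately show ?case using B(2) by blast
next
  case (insert j F)
  then obtain V where V: "V \<in> intermediate S M B L" "homogeneous M Mg V" "strip_finite Mg B V" "\<forall>j\<in>F. W j \<subseteq> V"
    by auto
  have W: "W j \<in> intermediate S M B L" "homogeneous M Mg (W j)" "strip_finite Mg B (W j)"
    using insert.prems by auto
  note VD = intermediateD[OF V(1)] and WD = intermediateD[OF W(1)]
  let ?U = "image_plus M \<one> (W j) V"
  have U: "submodule ?U S M" by (rule submodule_image_plus[OF S.one_closed WD(1) VD(1)])
  have VU: "V \<subseteq> ?U" by (rule image_plus_upper[OF S.one_closed WD(1) VD(1)])
  have UL: "?U \<subseteq> L"
    by (rule image_plus_least[OF S.one_closed intermediateD(1)[OF L] WD(3) VD(3)])
  have WU: "W j \<subseteq> ?U"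
  proof
    fix w assume "w \<in> W j"
    then show "w \<in> ?U"
      by (intro image_plusI[of w M \<one> w "\<zero>\<^bsub>M\<^esub>"])
         (use submodule_carrier[OF WD(1)] submodule_zero[OF VD(1)] in auto)
  qed
  have Uh: "homogeneous M Mg ?U"
    by (rule homogeneous_image_plus[OF S.one_part WD(1) VD(1) W(2) V(2)])
  obtain \<beta> \<beta>' :: "nat^'r" where \<beta>: "\<And>n. (\<And>i. int (\<beta> $ i) \<le> \<bar>n $ i\<bar>) \<Longrightarrow> W j \<inter> Mg n \<subseteq> B"
    and \<beta>': "\<And>n. (\<And>i. int (\<beta>' $ i) \<le> \<bar>n $ i\<bar>) \<Longrightarrow> V \<inter> Mg n \<subseteq> B"
    using W(3) V(3) unfolding strip_finite_def by blast
  have "?U \<inter> Mg n \<subseteq> B" if n: "\<And>i. int ((\<chi> i. max (\<beta> $ i) (\<beta>' $ i)) $ i) \<le> \<bar>n $ i\<bar>" for n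
  proof
    fix u assume u: "u \<in> ?U \<inter> Mg n"
    then obtain w v where wv: "w \<in> W j" "v \<in> V" "u = \<one> \<odot>\<^bsub>M\<^esub> w \<oplus>\<^bsub>M\<^esub> v" by (auto simp: image_plus_def)
    have c: "w \<in> carrier M" "v \<in> carrier M"
      using wv submodule_carrier[OF WD(1)] submodule_carrier[OF VD(1)] by auto
    have "u = hcomp M Mg u n" using u M.hcomp_homogeneous by auto
    also have "\<dots> = hcomp M Mg w n \<oplus>\<^bsub>M\<^esub> hcomp M Mg v n" using wv(3) c by (simp add: M.hcomp_add)
    finally have u_eq: "u = hcomp M Mg w n \<oplus>\<^bsub>M\<^esub> hcomp M Mg v n" .
    have "hcomp M Mg w n \<in> W j \<inter> Mg n" "hcomp M Mg v n \<in> V \<inter> Mg n"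
      using W(2) V(2) wv M.hcomp_part c unfolding homogeneous_def by auto
    moreover have n': "int (\<beta> $ i) \<le> \<bar>n $ i\<bar>" "int (\<beta>' $ i) \<le> \<bar>n $ i\<bar>" for i
      using n[of i] by (simp_all add: of_nat_max)
    moreover have "W j \<inter> Mg n \<subseteq> B" by (rule \<beta>[OF n'(1)])
    moreover have "V \<inter> Mg n \<subseteq> B" by (rule \<beta>'[OF n'(2)])
    ultimately show "u \<in> B" using u_eq submodule_add[OF B(1)] by blast
  qed
  then have "strip_finite Mg B ?U" unfolding strip_finite_def by blast
  moreover have "?U \<in> intermediate S M B L" using U VU UL VD by (auto simp: intermediate_def)
  moreover have "\<forall>k\<in>insert j F. W k \<subseteq> ?U" using WU VU V(4) by blast
  ultimately show ?case using Uh by blast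
qed

text \<open>Let \<open>V c\<close> consist of the elements of \<open>L\<close> that are supported, modulo \<open>W\<close>, in degrees with
  \<open>\<bar>n\<^sub>i\<bar> \<ge> c\<close>. It is a submodule: \<open>S\<^sub>0\<close> and the generators \<open>g i' j\<close> with \<open>i' \<noteq> i\<close> preserve the \<open>i\<close>-th
  coordinate, and the generators \<open>g i j\<close> map \<open>L\<close> into \<open>W\<close>. These submodules descend, and where they
  become stationary, at \<open>c0\<close>, the components of \<open>L\<close> with \<open>\<bar>n\<^sub>i\<bar> \<ge> c0\<close> lie in all \<open>V c\<close>, hence in \<open>W\<close>.\<close>
lemma strip_finite_of_quotient:
  fixes g :: "'r \<Rightarrow> nat \<Rightarrow> 'a" and \<gamma> :: "'r \<Rightarrow> nat"
  assumes gen: "carrier S = generate_ring S (Sg 0 \<union> {g i j | i j. j \<in> {1..\<mu> i}})"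
    and deg: "\<And>i j. j \<in> {1..\<mu> i} \<Longrightarrow> g i j \<in> Sg (axis i (\<gamma> i))"
    and dcc: "dcc (intermediate S M B Z)"
    and L: "L \<in> intermediate S M B Z"
    and W: "W \<in> intermediate S M B L" "homogeneous M Mg W" "strip_finite Mg B W"
    and gW: "\<And>j l. j \<in> {1..\<mu> i} \<Longrightarrow> l \<in> L \<Longrightarrow> g i j \<odot>\<^bsub>M\<^esub> l \<in> W"
  shows "strip_finite Mg B L"
proof -
  note LD = intermediateD[OF L] and WD = intermediateD[OF W(1)]
  note Lr = submodule_rules[OF LD(1)] and Wr = submodule_rules[OF WD(1)]
  define V where "V c = {l \<in> L. \<forall>n. \<bar>n $ i\<bar> < int c \<longrightarrow> hcomp M Mg l n \<in> W}" for c :: nat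
  have VL: "V c \<subseteq> L" for c unfolding V_def by blast
  have V: "V c \<in> intermediate S M B Z" for c
  proof (rule intermediateI)
    have add: "x \<oplus>\<^bsub>M\<^esub> y \<in> V c" if "x \<in> V c" "y \<in> V c" for x y
      using that Lr Wr unfolding V_def by (auto simp: M.hcomp_add)
    have minus: "\<ominus>\<^bsub>M\<^esub> x \<in> V c" if "x \<in> V c" for x
      using that Lr Wr unfolding V_def by (auto simp: M.hcomp_minus)
    have VM: "x \<in> V c \<Longrightarrow> x \<in> carrier M" for x using VL Lr(1) by blast
    have smult: "\<forall>x\<in>V c. a \<odot>\<^bsub>M\<^esub> x \<in> V c" if "a \<in> generate_ring S (Sg 0 \<union> {g i j | i j. j \<in> {1..\<mu> i}})" for a
      using that
    proof induction
      case one
      then show ?case using VM by simp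
    next
      case (incl a)
      then consider "a \<in> Sg 0" | i' j where "a = g i' j" "j \<in> {1..\<mu> i'}" "i' \<noteq> i" | j where "a = g i j" "j \<in> {1..\<mu> i}"
        by blast
      then show ?case
      proof cases
        case 1
        then show ?thesis
          using Lr Wr S.part_carrier[OF 1] unfolding V_def by (auto simp: hcomp_smult[OF 1])
      next
        case 2
        note a = deg[OF 2(2), folded 2(1)]
        have "hcomp M Mg (a \<odot>\<^bsub>M\<^esub> x) n \<in> W" if x: "x \<in> V c" "\<bar>n $ i\<bar> < int c" for x n
        proof -
          have "\<bar>(n - zdeg (axis i' (\<gamma> i'))) $ i\<bar> < int c"
            using x(2) 2(3) by (simp add: zdeg_def axis_def)
          then have "hcomp M Mg x (n - zdeg (axis i' (\<gamma> i'))) \<in> W" using x(1) unfolding V_def by blast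
          then show ?thesis using hcomp_smult[OF a VM[OF x(1)]] Wr(4) S.part_carrier[OF a] by simp
        qed
        then show ?thesis using Lr(4)[OF S.part_carrier[OF a]] VL unfolding V_def by blast
      next
        case 3
        have "a \<odot>\<^bsub>M\<^esub> x \<in> W" if "x \<in> V c" for x using gW 3 that VL by blast
        then show ?thesis using W(2) WD(3) unfolding V_def homogeneous_def by blast
      qed
    next
      case (a_inv a)
      have "a \<in> carrier S" using a_inv.hyps gen by simp
      then show ?case using a_inv.IH minus VM by (simp add: smult_l_minus)
    next
      case (eng_add a b)
      have "a \<in> carrier S" "b \<in> carrier S" using eng_add.hyps gen by auto
      then show ?case using eng_add.IH add VM by (simp add: smult_l_distr)
    next
      case (eng_mult a b)
      have "a \<in> carrier S" "b \<in> carrier S" using eng_mult.hyps gen by auto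
      then show ?case using eng_mult.IH VM by (simp add: smult_assoc1)
    qed
    show "submodule (V c) S M"
    proof (rule submoduleI_smult)
      show "\<zero>\<^bsub>M\<^esub> \<in> V c" using Lr(2) Wr(2) M.hcomp_zero unfolding V_def by auto
    qed (use VM add smult gen in auto)
  next
    fix b assume "b \<in> B"
    then have "b \<in> W" using WD by blast
    then show "b \<in> V c" using WD(3) W(2) unfolding V_def homogeneous_def by blast
  qed (use VL LD in blast)
  have V_mono: "V c' \<subseteq> V c" if "c \<le> c'" for c c' using that unfolding V_def by auto
  obtain c0 where c0: "\<And>c. c0 \<le> c \<Longrightarrow> V c = V c0"
    using strictly_wf_stabilizes[OF dcc, of V] V V_mono by auto
  obtain \<beta> :: "nat^'r" where \<beta>: "\<And>n. (\<And>i. int (\<beta> $ i) \<le> \<bar>n $ i\<bar>) \<Longrightarrow> W \<inter> Mg n \<subseteq> B"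
    using W(3) unfolding strip_finite_def by blast
  have "L \<inter> Mg n \<subseteq> B" if n: "\<And>k. int ((\<chi> k. max (\<beta> $ k) c0) $ k) \<le> \<bar>n $ k\<bar>" for n
  proof
    fix l assume l: "l \<in> L \<inter> Mg n"
    have c0n: "c0 \<le> nat \<bar>n $ i\<bar>" using n[of i] by simp
    have "hcomp M Mg l m \<in> W" if "\<bar>m $ i\<bar> < int c0" for m
      using that c0n l M.hcomp_homogeneous[of l n] Wr(2) by auto
    then have "l \<in> V c0" using l unfolding V_def by blast
    then have "l \<in> V (Suc (nat \<bar>n $ i\<bar>))" using c0[of "Suc (nat \<bar>n $ i\<bar>)"] c0n by simp
    then have "hcomp M Mg l n \<in> W" unfolding V_def by simp
    then have "l \<in> W \<inter> Mg n" using l M.hcomp_homogeneous[of l n] by simp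
    moreover have n': "int (\<beta> $ k) \<le> \<bar>n $ k\<bar>" for k using n[of k] by (simp add: of_nat_max)
    moreover have "W \<inter> Mg n \<subseteq> B" by (rule \<beta>[OF n'])
    ultimately show "l \<in> B" by blast
  qed
  then show ?thesis unfolding strip_finite_def by blast
qed

lemma image_plus_prod:
  assumes "a \<in> carrier S" "b \<in> carrier S" "submodule L S M" "submodule B S M"
  shows "image_plus M (a \<otimes> b) L B = image_plus M a (image_plus M b L B) B"
proof (intro equalityI subsetI)
  note Lr = submodule_rules[OF assms(3)] and Br = submodule_rules[OF assms(4)]
  fix u assume "u \<in> image_plus M (a \<otimes> b) L B"
  then obtain l c where *: "l \<in> L" "c \<in> B" "u = (a \<otimes> b) \<odot>\<^bsub>M\<^esub> l \<oplus>\<^bsub>M\<^esub> c" by (auto simp: image_plus_def)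
  have "b \<odot>\<^bsub>M\<^esub> l \<in> image_plus M b L B"
    by (rule image_plusI[of _ M b l "\<zero>\<^bsub>M\<^esub>"]) (use * Lr(1) Br(2) assms in auto)
  then show "u \<in> image_plus M a (image_plus M b L B) B"
    by (rule image_plusI[rotated]) (use * Lr(1) assms in \<open>auto simp: smult_assoc1\<close>)
next
  note Lr = submodule_rules[OF assms(3)] and Br = submodule_rules[OF assms(4)]
  fix u assume "u \<in> image_plus M a (image_plus M b L B) B"
  then obtain l c c' where *: "l \<in> L" "c \<in> B" "c' \<in> B" "u = a \<odot>\<^bsub>M\<^esub> (b \<odot>\<^bsub>M\<^esub> l \<oplus>\<^bsub>M\<^esub> c) \<oplus>\<^bsub>M\<^esub> c'"
    by (auto simp: image_plus_def)
  have cM: "l \<in> carrier M" "c \<in> carrier M" "c' \<in> carrier M" using * Lr(1) Br(1) by auto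
  show "u \<in> image_plus M (a \<otimes> b) L B"
    by (rule image_plusI[of _ M _ l "a \<odot>\<^bsub>M\<^esub> c \<oplus>\<^bsub>M\<^esub> c'"])
       (use * cM Br(3,4) assms in \<open>auto simp: smult_assoc1 smult_r_distr M.a_assoc\<close>)
qed

lemma image_plus_one:
  assumes "submodule L S M" "submodule B S M" "B \<subseteq> L"
  shows "image_plus M \<one> L B = L"
proof
  show "image_plus M \<one> L B \<subseteq> L" by (rule image_plus_least[OF S.one_closed assms(1) order_refl assms(3)])
  show "L \<subseteq> image_plus M \<one> L B"
  proof
    fix l assume "l \<in> L"
    then show "l \<in> image_plus M \<one> L B"
      by (intro image_plusI[of l M \<one> l "\<zero>\<^bsub>M\<^esub>"]) (use submodule_carrier[OF assms(1)] submodule_zero[OF assms(2)] in auto)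
  qed
qed

text \<open>A minimal counterexample \<open>L\<close> satisfies \<open>g i (j i) L + B = L\<close> for some choice of one generator in
  each direction \<open>i\<close>; for otherwise all \<open>g i j L + B\<close> for one \<open>i\<close> would be smaller, and \<open>L\<close> would be no
  counterexample by \<open>strip_finite_of_quotient\<close>. Then the nilpotent product of these generators
  reproduces \<open>L\<close> modulo \<open>B\<close>.\<close>
lemma strip_finite_of_nilpotent:
  fixes g :: "'r \<Rightarrow> nat \<Rightarrow> 'a" and \<gamma> :: "'r \<Rightarrow> nat"
  assumes gen: "carrier S = generate_ring S (Sg 0 \<union> {g i j | i j. j \<in> {1..\<mu> i}})"
    and deg: "\<And>i j. j \<in> {1..\<mu> i} \<Longrightarrow> g i j \<in> Sg (axis i (\<gamma> i))"
    and dcc: "dcc (intermediate S M B Z)"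
    and B: "submodule B S M" "homogeneous M Mg B" and Z: "submodule Z S M" "homogeneous M Mg Z" "B \<subseteq> Z"
    and nil: "\<And>j. (\<And>i. j i \<in> {1..\<mu> i}) \<Longrightarrow> \<exists>T::nat. \<forall>z\<in>Z. (finprod S (\<lambda>i. g i (j i)) UNIV [^] T) \<odot>\<^bsub>M\<^esub> z \<in> B"
  shows "strip_finite Mg B Z"
proof (rule ccontr)
  assume "\<not> strip_finite Mg B Z"
  moreover have "Z \<in> intermediate S M B Z" using Z by (auto simp: intermediate_def)
  ultimately obtain L where L: "L \<in> intermediate S M B Z" "homogeneous M Mg L" "\<not> strip_finite Mg B L"
    and L_min: "\<And>K. K \<in> intermediate S M B Z \<Longrightarrow> homogeneous M Mg K \<Longrightarrow> \<not> strip_finite Mg B K \<Longrightarrow> K \<subseteq> L \<Longrightarrow> K = L"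
    using Z(2) by (auto elim!: strictly_wf_minimal[OF dcc, of Z "\<lambda>L. homogeneous M Mg L \<and> \<not> strip_finite Mg B L"])
  note LD = intermediateD[OF L(1)]
  have gS: "g i j \<in> carrier S" if "j \<in> {1..\<mu> i}" for i j using deg[OF that] S.part_carrier by blast
  have "\<exists>j\<in>{1..\<mu> i}. image_plus M (g i j) L B = L" for i
  proof (rule ccontr)
    assume no: "\<not> (\<exists>j\<in>{1..\<mu> i}. image_plus M (g i j) L B = L)"
    have K: "image_plus M (g i j) L B \<in> intermediate S M B L \<and> homogeneous M Mg (image_plus M (g i j) L B)
        \<and> strip_finite Mg B (image_plus M (g i j) L B)" if j: "j \<in> {1..\<mu> i}" for j
    proof -
      let ?K = "image_plus M (g i j) L B"
      have sub: "?K \<subseteq> L" by (rule image_plus_least[OF gS[OF j] LD(1) order_refl LD(2)])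
      have K: "?K \<in> intermediate S M B L"
        unfolding intermediate_def using submodule_image_plus[OF gS[OF j] LD(1) B(1)]
          image_plus_upper[OF gS[OF j] LD(1) B(1)] sub by blast
      then have KZ: "?K \<in> intermediate S M B Z" using LD(3) unfolding intermediate_def by blast
      have hK: "homogeneous M Mg ?K" by (rule homogeneous_image_plus[OF deg[OF j] LD(1) B(1) L(2) B(2)])
      have "strip_finite Mg B ?K" using L_min[OF KZ hK _ sub] no j by blast
      then show ?thesis using K hK by blast
    qed
    obtain W where W: "W \<in> intermediate S M B L" "homogeneous M Mg W" "strip_finite Mg B W"
      "\<forall>j\<in>{1..\<mu> i}. image_plus M (g i j) L B \<subseteq> W"
      using strip_finite_sum[OF L(1) B, of "{1..\<mu> i}" "\<lambda>j. image_plus M (g i j) L B"] K by blast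
    have gW: "g i j \<odot>\<^bsub>M\<^esub> l \<in> W" if jl: "j \<in> {1..\<mu> i}" "l \<in> L" for j l
    proof -
      have "g i j \<odot>\<^bsub>M\<^esub> l \<in> image_plus M (g i j) L B"
        by (rule image_plusI[of _ M _ l "\<zero>\<^bsub>M\<^esub>"])
           (use jl gS[OF jl(1)] submodule_carrier[OF LD(1)] submodule_zero[OF B(1)] in auto)
      then show ?thesis using W(4) jl by blast
    qed
    have "strip_finite Mg B L" by (rule strip_finite_of_quotient[OF gen deg dcc L(1) W(1-3) gW])
    then show False using L(3) by blast
  qed
  then obtain j where j: "\<And>i. j i \<in> {1..\<mu> i}" "\<And>i. image_plus M (g i (j i)) L B = L" by metis
  have "finprod S (\<lambda>i. g i (j i)) F \<in> carrier S \<and> image_plus M (finprod S (\<lambda>i. g i (j i)) F) L B = L" if "finite F" for F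
    using that
  proof (induction F rule: finite_induct)
    case empty
    then show ?case using image_plus_one[OF LD(1) B(1) LD(2)] by simp
  next
    case (insert i F)
    have "finprod S (\<lambda>i. g i (j i)) (insert i F) = g i (j i) \<otimes> finprod S (\<lambda>i. g i (j i)) F"
      using S.finprod_insert[of F i "\<lambda>i. g i (j i)"] insert.hyps gS j(1) by (simp add: Pi_def)
    then show ?case using insert.IH image_plus_prod[OF gS[OF j(1)] _ LD(1) B(1)] j(2) gS[OF j(1)] by simp
  qed
  then have P: "finprod S (\<lambda>i. g i (j i)) UNIV \<in> carrier S" "image_plus M (finprod S (\<lambda>i. g i (j i)) UNIV) L B = L"
    by auto
  have pow: "image_plus M (finprod S (\<lambda>i. g i (j i)) UNIV [^] t) L B = L" for t :: nat
    by (induction t) (use P image_plus_one[OF LD(1) B(1) LD(2)] image_plus_prod[OF _ P(1) LD(1) B(1)] in simp_all)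
  obtain T :: nat where T: "\<forall>z\<in>Z. (finprod S (\<lambda>i. g i (j i)) UNIV [^] T) \<odot>\<^bsub>M\<^esub> z \<in> B"
    using nil[of j] j(1) by blast
  have "L \<subseteq> B"
  proof
    fix l assume "l \<in> L"
    then have "l \<in> image_plus M (finprod S (\<lambda>i. g i (j i)) UNIV [^] T) L B" using pow by simp
    then obtain l' b where "l' \<in> L" "b \<in> B" "l = (finprod S (\<lambda>i. g i (j i)) UNIV [^] T) \<odot>\<^bsub>M\<^esub> l' \<oplus>\<^bsub>M\<^esub> b"
      unfolding image_plus_def by blast
    then show "l \<in> B" using T LD(3) submodule_add[OF B(1)] by blast
  qed
  then have "strip_finite Mg B L" unfolding strip_finite_def by blast
  then show False using L(3) by blast
qed

end

section \<open>Local cohomology as a graded subquotient\<close>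

context module
begin

lemma coset_eq_iff:
  assumes B: "submodule B R M" and z: "z \<in> carrier M"
  shows "B +>\<^bsub>M\<^esub> z = B \<longleftrightarrow> z \<in> B"
proof
  note Br = submodule_rules[OF B]
  assume "B +>\<^bsub>M\<^esub> z = B"
  moreover have "\<zero>\<^bsub>M\<^esub> \<oplus>\<^bsub>M\<^esub> z \<in> B +>\<^bsub>M\<^esub> z" unfolding a_r_coset_def' using Br(2) by blast
  ultimately show "z \<in> B" using z by simp
next
  note Br = submodule_rules[OF B]
  assume zB: "z \<in> B"
  show "B +>\<^bsub>M\<^esub> z = B"
  proof (intro equalityI subsetI)
    fix b assume b: "b \<in> B"
    have "b = (b \<ominus>\<^bsub>M\<^esub> z) \<oplus>\<^bsub>M\<^esub> z"
      using Br(1)[OF b] z by (simp add: a_minus_def M.a_assoc M.l_neg)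
    then show "b \<in> B +>\<^bsub>M\<^esub> z" unfolding a_r_coset_def' using Br(6)[OF b zB] by blast
  qed (use zB Br(3) in \<open>auto simp: a_r_coset_def'\<close>)
qed

end

lemma image_eq_singleton_iff: "T \<noteq> {} \<Longrightarrow> f ` T = {b} \<longleftrightarrow> (\<forall>z\<in>T. f z = b)"
  by auto

text \<open>Scalar multiplication on cosets is induced by that on representatives.\<close>
lemma annihilator_subquotient:
  fixes S :: "'a ring" and M :: "('a, 'm) module"
  assumes "module S M" and B: "submodule B S M" and Z: "submodule Z S M"
  shows "annihilator S (subquotient M Z B) = {a \<in> carrier S. \<forall>z\<in>Z. a \<odot>\<^bsub>M\<^esub> z \<in> B}"
proof -
  interpret module S M by fact
  note Br = submodule_rules[OF B] and Zr = submodule_rules[OF Z]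
  have car: "carrier (subquotient M Z B) = {B +>\<^bsub>M\<^esub> z | z. z \<in> Z}"
    unfolding subquotient_def A_RCOSETS_def' by (auto simp: a_r_coset_def')
  have smult: "a \<odot>\<^bsub>subquotient M Z B\<^esub> (B +>\<^bsub>M\<^esub> z) = B +>\<^bsub>M\<^esub> (a \<odot>\<^bsub>M\<^esub> z)"
    if a: "a \<in> carrier S" and z: "z \<in> Z" for a z
  proof -
    have zM: "z \<in> carrier M" using Zr(1)[OF z] .
    have "a \<odot>\<^bsub>subquotient M Z B\<^esub> (B +>\<^bsub>M\<^esub> z) = {b \<oplus>\<^bsub>M\<^esub> a \<odot>\<^bsub>M\<^esub> (b' \<oplus>\<^bsub>M\<^esub> z) | b b'. b \<in> B \<and> b' \<in> B}"
      unfolding subquotient_def set_add_def' a_r_coset_def' by auto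
    also have "\<dots> = B +>\<^bsub>M\<^esub> (a \<odot>\<^bsub>M\<^esub> z)"
    proof (intro equalityI subsetI)
      fix u assume "u \<in> {b \<oplus>\<^bsub>M\<^esub> a \<odot>\<^bsub>M\<^esub> (b' \<oplus>\<^bsub>M\<^esub> z) | b b'. b \<in> B \<and> b' \<in> B}"
      then obtain b b' where b: "b \<in> B" "b' \<in> B" "u = b \<oplus>\<^bsub>M\<^esub> a \<odot>\<^bsub>M\<^esub> (b' \<oplus>\<^bsub>M\<^esub> z)" by blast
      then have "u = (b \<oplus>\<^bsub>M\<^esub> a \<odot>\<^bsub>M\<^esub> b') \<oplus>\<^bsub>M\<^esub> a \<odot>\<^bsub>M\<^esub> z"
        using a zM Br(1) by (simp add: smult_r_distr M.a_assoc)
      moreover have "b \<oplus>\<^bsub>M\<^esub> a \<odot>\<^bsub>M\<^esub> b' \<in> B" using b a Br(3,4) by simp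
      ultimately show "u \<in> B +>\<^bsub>M\<^esub> (a \<odot>\<^bsub>M\<^esub> z)" unfolding a_r_coset_def' by blast
    next
      fix u assume "u \<in> B +>\<^bsub>M\<^esub> (a \<odot>\<^bsub>M\<^esub> z)"
      then obtain b where b: "b \<in> B" "u = b \<oplus>\<^bsub>M\<^esub> a \<odot>\<^bsub>M\<^esub> z" unfolding a_r_coset_def' by blast
      then have "u = b \<oplus>\<^bsub>M\<^esub> a \<odot>\<^bsub>M\<^esub> (\<zero>\<^bsub>M\<^esub> \<oplus>\<^bsub>M\<^esub> z)" using zM by simp
      then show "u \<in> {b \<oplus>\<^bsub>M\<^esub> a \<odot>\<^bsub>M\<^esub> (b' \<oplus>\<^bsub>M\<^esub> z) | b b'. b \<in> B \<and> b' \<in> B}" using b(1) Br(2) by blast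
    qed
    finally show ?thesis .
  qed
  have zero: "\<zero>\<^bsub>subquotient M Z B\<^esub> = B" by (simp add: subquotient_def)
  have "a \<odot>\<^bsub>subquotient M Z B\<^esub> (B +>\<^bsub>M\<^esub> z) = \<zero>\<^bsub>subquotient M Z B\<^esub> \<longleftrightarrow> a \<odot>\<^bsub>M\<^esub> z \<in> B"
    if "a \<in> carrier S" "z \<in> Z" for a z
    unfolding smult[OF that] zero using coset_eq_iff[OF B] that Zr(1) by simp
  then show ?thesis unfolding annihilator_def car by blast
qed

context graded_resolution
begin

context
  fixes X :: "'a set"
  assumes acc: "acc {I. ideal I S}" and X: "\<And>y. y \<in> X \<Longrightarrow> \<exists>k. y \<in> Sg k"
begin

lemma X_carrier: "X \<subseteq> carrier S"
  using X S.part_carrier by blast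

lemma torsion_E: "torsion S (Idl X) (E i) = power_torsion S (E i) X"
  by (rule torsion_genideal[OF E.module_axioms acc X_carrier])

lemma submodule_cocycles: "submodule (cocycles S (Idl X) E d i) S (E i)"
proof -
  have "submodule {\<zero>\<^bsub>E (Suc i)\<^esub>} S (E (Suc i))" by (rule E.submoduleI_smult) auto
  from submodule_preimage[OF E.module_axioms E.module_axioms d_linear this]
  have "submodule (a_kernel (E i) (E (Suc i)) (d i)) S (E i)" by (simp add: a_kernel_def kernel_def)
  then show ?thesis
    unfolding cocycles_def torsion_E using E.submodule_power_torsion[OF X_carrier] by (intro E.submodule_Int)
qed

lemma homogeneous_cocycles: "homogeneous (E i) (Eg i) (cocycles S (Idl X) E d i)"
proof -
  have "homogeneous (E i) (Eg i) (a_kernel (E i) (E (Suc i)) (d i))"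
    unfolding homogeneous_def
  proof (intro ballI allI)
    fix x n assume "x \<in> a_kernel (E i) (E (Suc i)) (d i)"
    then have x: "x \<in> carrier (E i)" "d i x = \<zero>\<^bsub>E (Suc i)\<^esub>" by (auto simp: a_kernel_def kernel_def)
    have "d i (hcomp (E i) (Eg i) x n) = hcomp (E (Suc i)) (Eg (Suc i)) (d i x) n"
      by (rule hcomp_graded_hom[OF E.M.graded_group_axioms E.M.graded_group_axioms d_hom x(1), symmetric])
    then show "hcomp (E i) (Eg i) x n \<in> a_kernel (E i) (E (Suc i)) (d i)"
      using x E.M.hcomp_zero E.M.hcomp_carrier by (simp add: a_kernel_def kernel_def)
  qed
  then show ?thesis
    unfolding cocycles_def torsion_E using E.homogeneous_power_torsion[OF X] by (intro E.homogeneous_Int)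
qed

lemma submodule_coboundaries: "submodule (coboundaries S (Idl X) E d i) S (E i)"
proof (cases i)
  case 0
  have "submodule {\<zero>\<^bsub>E 0\<^esub>} S (E 0)" by (rule E.submoduleI_smult) auto
  then show ?thesis using 0 by (simp add: coboundaries_def)
next
  case (Suc j)
  have "submodule (d j ` power_torsion S (E j) X) S (E (Suc j))"
    by (rule submodule_image[OF E.module_axioms E.module_axioms d_linear E.submodule_power_torsion[OF X_carrier]])
  then show ?thesis using Suc by (simp add: coboundaries_def torsion_E)
qed

lemma homogeneous_coboundaries: "homogeneous (E i) (Eg i) (coboundaries S (Idl X) E d i)"
proof (cases i)
  case 0
  then show ?thesis using E.M.hcomp_zero by (simp add: coboundaries_def homogeneous_def)
next
  case (Suc j)
  have "hcomp (E (Suc j)) (Eg (Suc j)) (d j u) n \<in> d j ` power_torsion S (E j) X"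
    if u: "u \<in> power_torsion S (E j) X" for u n
  proof -
    have uE: "u \<in> carrier (E j)" using u by (simp add: power_torsion_def)
    have "hcomp (E (Suc j)) (Eg (Suc j)) (d j u) n = d j (hcomp (E j) (Eg j) u n)"
      by (rule hcomp_graded_hom[OF E.M.graded_group_axioms E.M.graded_group_axioms d_hom uE])
    moreover have "hcomp (E j) (Eg j) u n \<in> power_torsion S (E j) X"
      using E.homogeneous_power_torsion[where Y = X and i = j, OF X] u unfolding homogeneous_def by blast
    ultimately show ?thesis by blast
  qed
  then show ?thesis using Suc by (auto simp: coboundaries_def torsion_E homogeneous_def)
qed

lemma coboundaries_subset_cocycles: "coboundaries S (Idl X) E d i \<subseteq> cocycles S (Idl X) E d i"
proof (cases i)
  case 0
  then show ?thesis using E.submodule_zero[OF submodule_cocycles, of 0] by (simp add: coboundaries_def)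
next
  case (Suc j)
  have "d j u \<in> cocycles S (Idl X) E d (Suc j)" if u: "u \<in> power_torsion S (E j) X" for u
  proof -
    have uE: "u \<in> carrier (E j)" using u by (simp add: power_torsion_def)
    have "(y [^] p) \<odot>\<^bsub>E (Suc j)\<^esub> d j u = \<zero>\<^bsub>E (Suc j)\<^esub>"
      if "y \<in> X" "(y [^] p) \<odot>\<^bsub>E j\<^esub> u = \<zero>\<^bsub>E j\<^esub>" for y and p :: nat
      using that X_carrier uE d_scale[of "y [^] p" u j] d_null by auto
    then have "d j u \<in> power_torsion S (E (Suc j)) X"
      using u d_carrier[OF uE] unfolding power_torsion_def by blast
    then show ?thesis
      using d_carrier[OF uE] d_dd[OF uE] by (simp add: cocycles_def torsion_E a_kernel_def kernel_def)
  qed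
  then show ?thesis using Suc by (auto simp: coboundaries_def torsion_E)
qed

lemma annihilator_local_cohomology:
  "annihilator S (local_cohomology S (Idl X) E d i)
    = {a \<in> carrier S. \<forall>z\<in>cocycles S (Idl X) E d i. a \<odot>\<^bsub>E i\<^esub> z \<in> coboundaries S (Idl X) E d i}"
  unfolding local_cohomology_def
  by (rule annihilator_subquotient[OF E.module_axioms submodule_coboundaries submodule_cocycles])

lemma Gamma_finitely_graded_local_cohomology:
  "Gamma_finitely_graded (local_cohomology S (Idl X) E d i) (local_cohomology_grading S (Idl X) E Eg d i)
    \<longleftrightarrow> strip_finite (Eg i) (coboundaries S (Idl X) E d i) (cocycles S (Idl X) E d i)"
proof -
  let ?B = "coboundaries S (Idl X) E d i" and ?Z = "cocycles S (Idl X) E d i"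
  have zero: "\<zero>\<^bsub>local_cohomology S (Idl X) E d i\<^esub> = ?B"
    by (simp add: local_cohomology_def subquotient_def)
  have "local_cohomology_grading S (Idl X) E Eg d i n = {?B} \<longleftrightarrow> ?Z \<inter> Eg i n \<subseteq> ?B" for n
  proof -
    have "\<zero>\<^bsub>E i\<^esub> \<in> ?Z \<inter> Eg i n"
      using E.submodule_zero[OF submodule_cocycles] E.M.part_zero by (rule IntI)
    then have "?Z \<inter> Eg i n \<noteq> {}" by (rule ex_in_conv[THEN iffD1, OF exI])
    moreover have "?B +>\<^bsub>E i\<^esub> z = ?B \<longleftrightarrow> z \<in> ?B" if "z \<in> ?Z" for z
      by (rule E.coset_eq_iff[OF submodule_coboundaries E.submodule_carrier[OF submodule_cocycles that]])
    ultimately show ?thesis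
      unfolding local_cohomology_grading_def by (subst image_eq_singleton_iff) auto
  qed
  then show ?thesis
    unfolding Gamma_finitely_graded_def strip_finite_def zero abs_deg_mem_cone by simp
qed

end

end

theorem theorem2p8:
  fixes S :: "'a ring"
    and Sg :: "nat^'r::{finite,linorder} \<Rightarrow> 'a set"
    and \<mm> :: "'a set"
    and M :: "('a, 'm) module"
    and Mg :: "int^'r::{finite,linorder} \<Rightarrow> 'm set"
    and E :: "nat \<Rightarrow> ('a, 'e) module"
    and Eg :: "nat \<Rightarrow> int^'r::{finite,linorder} \<Rightarrow> 'e set"
    and d :: "nat \<Rightarrow> 'e \<Rightarrow> 'e"
    and \<epsilon> :: "'m \<Rightarrow> 'e"
  assumes "graded_ring S Sg"
    and "noetherian_ring S"
    and "local_ring (degree_zero_part S Sg) \<mm>"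
    and "infinite (carrier (degree_zero_part S Sg Quot \<mm>))"
    and "almost_standard S Sg"
    and "graded_module S Sg M Mg"
    and "fin_gen_module S M"
    and "graded_injective_resolution S Sg M Mg E Eg d \<epsilon>"
  shows "Gamma_fg S Sg \<mm> E Eg d = gdepth S Sg \<mm> E d"
proof -
  interpret graded_resolution S Sg M Mg E Eg d \<epsilon>
    by unfold_locales (fact assms)+
  interpret noetherian_ring S by fact
  note acc = acc_ideals
  let ?J = "max_homogeneous_ideal S Sg \<mm>"
  have max: "maximalideal ?J S" by (rule S.maximalideal_max_homogeneous_ideal[OF assms(3)])
  have J: "ideal ?J S" by (rule maximalideal.axioms(1)[OF max])
  have "homogeneous S Sg ?J" by (rule S.homogeneous_max_homogeneous_ideal[OF assms(3)])
  \<comment> \<open>Homogeneous generators make torsion compatible with gradings; finitely many keep the number of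
    Koszul cones finite.\<close>
  then obtain X where X: "finite X" "\<And>y. y \<in> X \<Longrightarrow> \<exists>k. y \<in> Sg k" and XJ: "Idl\<^bsub>S\<^esub> X = ?J"
    using S.homogeneous_generators[OF assms(2) J] by blast
  obtain \<gamma> \<mu> :: "'r \<Rightarrow> nat" and g :: "'r \<Rightarrow> nat \<Rightarrow> 'a" where
    "(\<forall>i. 0 < \<gamma> i) \<and> (\<forall>i. \<forall>j\<in>{1..\<mu> i}. g i j \<in> Sg (axis i (\<gamma> i)))
      \<and> carrier S = generate_ring S (Sg 0 \<union> {g i j | i j. j \<in> {1..\<mu> i}})"
    using assms(5) unfolding almost_standard_def by (elim exE)
  then have \<gamma>: "\<And>i. 0 < \<gamma> i" and deg: "\<And>i j. j \<in> {1..\<mu> i} \<Longrightarrow> g i j \<in> Sg (axis i (\<gamma> i))"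
    and gen: "carrier S = generate_ring S (Sg 0 \<union> {g i j | i j. j \<in> {1..\<mu> i}})"
    by blast+
  define H where "H i = \<Union>{Sg n | n. n $ i \<noteq> 0 \<and> (\<forall>j>i. n $ j = 0)}" for i
  have HS: "H i \<subseteq> carrier S" for i unfolding H_def using S.part_carrier by blast
  have irr: "irrelevant_ideal S Sg = finprod (ideals_set S) (\<lambda>i. Idl\<^bsub>S\<^esub> (H i)) UNIV"
    unfolding irrelevant_ideal_def irrelevant_factor_def H_def ..
  have "Gamma_finitely_graded (local_cohomology S ?J E d i) (local_cohomology_grading S ?J E Eg d i)
      \<longleftrightarrow> irrelevant_ideal S Sg \<subseteq> ideal_radical S (annihilator S (local_cohomology S ?J E d i))" for i
  proof -
    let ?B = "coboundaries S ?J E d i" and ?Z = "cocycles S ?J E d i"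
    let ?A = "{a \<in> carrier S. \<forall>z\<in>?Z. a \<odot>\<^bsub>E i\<^esub> z \<in> ?B}"
    note B = submodule_coboundaries[OF acc X(2), of X i, unfolded XJ]
      homogeneous_coboundaries[OF acc X(2), of X i, unfolded XJ]
    note Z = submodule_cocycles[OF acc X(2), of X i, unfolded XJ]
      homogeneous_cocycles[OF acc X(2), of X i, unfolded XJ]
      coboundaries_subset_cocycles[OF acc X(2), of X i, unfolded XJ]
    have ann: "annihilator S (local_cohomology S ?J E d i) = ?A"
      using annihilator_local_cohomology[OF acc X(2), of X i] unfolding XJ by blast
    have gam: "Gamma_finitely_graded (local_cohomology S ?J E d i) (local_cohomology_grading S ?J E Eg d i)
        \<longleftrightarrow> strip_finite (Eg i) ?B ?Z"
      using Gamma_finitely_graded_local_cohomology[OF acc X(2), of X i] unfolding XJ by blast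
    show ?thesis
      unfolding ann gam
    proof
      assume fin: "strip_finite (Eg i) ?B ?Z"
      show "irrelevant_ideal S Sg \<subseteq> ideal_radical S ?A"
        unfolding irr
      proof (rule S.finprod_genideal_le)
        have "ideal ?A S"
        proof (rule idealI)
          show "subgroup ?A (add_monoid S)"
            by (rule S.add.subgroupI)
               (use E.submodule_rules[OF B(1)] E.submodule_carrier[OF Z(1)] in
                 \<open>auto simp: E.smult_l_distr E.smult_l_minus intro!: exI[of _ "\<zero>\<^bsub>S\<^esub>"]\<close>)
          fix a s assume *: "a \<in> ?A" "s \<in> carrier S"
          then show l: "s \<otimes>\<^bsub>S\<^esub> a \<in> ?A"
            using E.submodule_smult[OF B(1)] E.submodule_carrier[OF Z(1)] by (auto simp: E.smult_assoc1)
          then show "a \<otimes>\<^bsub>S\<^esub> s \<in> ?A" using * by (simp add: S.m_comm)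
        qed (rule S.ring_axioms)
        then show "ideal (ideal_radical S ?A) S" by (rule ideal_ideal_radical[OF S.is_cring])
      next
        fix h assume "\<And>k. k \<in> UNIV \<Longrightarrow> h k \<in> H k"
        then have "\<forall>k. \<exists>n. h k \<in> Sg n \<and> n $ k \<noteq> 0" unfolding H_def by blast
        then obtain D where D: "\<And>k. h k \<in> Sg (D k)" "\<And>k. D k $ k \<noteq> 0" by metis
        have prod: "finprod S h F \<in> Sg (\<Sum>k\<in>F. D k)" if "finite F" for F
          using that
        proof (induction F rule: finite_induct)
          case empty
          then show ?case using S.one_part by simp
        next
          case (insert k F)
          have "finprod S h (insert k F) = h k \<otimes>\<^bsub>S\<^esub> finprod S h F"
            by (rule S.finprod_insert) (use insert.hyps D(1) S.part_carrier in blast)+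
          then show ?case using S.mult_part[OF D(1) insert.IH] insert.hyps by simp
        qed
        \<comment> \<open>The factor from \<open>H l\<close> makes the coordinate \<open>l\<close> of the degree positive.\<close>
        have pos: "0 < (\<Sum>k\<in>UNIV. D k) $ l" for l
        proof -
          have "D l $ l \<le> (\<Sum>k\<in>UNIV. D k $ l)" by (rule member_le_sum) auto
          then show ?thesis using D(2)[of l] by simp
        qed
        have "finprod S h UNIV \<in> Sg (\<Sum>k\<in>UNIV. D k)" by (rule prod) simp
        then show "finprod S h UNIV \<in> ideal_radical S ?A"
          using E.strip_finite_nilpotent[OF Z(1,2) B(1) fin _ pos] S.part_carrier
          unfolding ideal_radical_def by blast
      qed (use HS in auto)
    next
      assume rad: "irrelevant_ideal S Sg \<subseteq> ideal_radical S ?A"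
      have dcc: "dcc (intermediate S (E i) ?B ?Z)"
        using artinian_local_cohomology[OF acc assms(7) X] max unfolding XJ by blast
      show "strip_finite (Eg i) ?B ?Z"
      proof (rule E.strip_finite_of_nilpotent[OF gen deg dcc B Z])
        fix j assume j: "\<And>k. j k \<in> {1..\<mu> k}"
        have "finprod S (\<lambda>k. g k (j k)) UNIV \<in> irrelevant_ideal S Sg"
          unfolding irr
        proof (rule S.finprod_mem_finprod_ideals)
          fix k
          show "ideal (Idl\<^bsub>S\<^esub> (H k)) S" by (rule S.genideal_ideal[OF HS])
          have "axis k (\<gamma> k) $ k \<noteq> 0 \<and> (\<forall>l>k. axis k (\<gamma> k) $ l = 0)"
            using \<gamma>[of k] by (auto simp: axis_def)
          then have "g k (j k) \<in> H k" unfolding H_def using deg[OF j] by blast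
          then show "g k (j k) \<in> Idl\<^bsub>S\<^esub> (H k)" using S.genideal_self[OF HS] by blast
        qed simp
        then have "finprod S (\<lambda>k. g k (j k)) UNIV \<in> ideal_radical S ?A" using rad by blast
        then show "\<exists>T::nat. \<forall>z\<in>?Z. (finprod S (\<lambda>k. g k (j k)) UNIV [^]\<^bsub>S\<^esub> T) \<odot>\<^bsub>E i\<^esub> z \<in> ?B"
          unfolding ideal_radical_def by blast
      qed
    qed
  qed
  then show ?thesis unfolding Gamma_fg_def gdepth_def by simp
qed

end
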